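(* Let $\ell\ge m\ge n\ge2$ be integers, let $X$ be the Seifert 3-manifold $M(0;(1,0);(\ell,-1),(m,-1),(n,1))$, with $\pi_1(X)=\langle g,h\mid (gh)^nh^{-m},\ (hg)^ng^{-\ell}\rangle$. Let $d$ be the least common multiple of $n,m,\ell$ and $\mathbb{F}=\mathbb{Q}(\exp(2\pi\sqrt{-1}/d))$, with complex conjugation as involution. Let $\rho_{A,B}:\pi_1(X)\to\mathrm{SU}(2)$ be an irreducible unitary representation with matrices in $\mathrm{SL}_2(\mathbb{F})$ given by $\rho_{A,B}(g)=A=\begin{pmatrix}\alpha&0\\0&\alpha^{-1}\end{pmatrix}$, $\alpha\ne\pm1$, and $\rho_{A,B}(h)=B$, such that $\alpha^\ell=\beta^m=\gamma^n=1$, where $\beta^{\pm1}$ are the eigenvalues of $B$ and $\gamma^{\pm1}$ are the eigenvalues of $AB$. Let $\psi(v,w)={}^t\overline{v}\,w$ for $v,w\in\mathbb{F}^2$. Then $$H^0_{\rho_{A,B}}(X;\mathbb{F}^2)=H^3_{\rho_{A,B}}(X;\mathbb{F}^2)=0,\qquad H^1_{\rho_{A,B}}(X;\mathbb{F}^2)\cong H^2_{\rho_{A,B}}(X;\mathbb{F}^2)\cong\mathbb{F}^2,$$ and the refined torsion $\tau^0_{\rho_{A,B}}(X,\{\mathbf{h}_1,\mathbf{h}_1^{\rm dual}\})$, where $\mathbf{h}_1$ is any basis of $H^1_{\rho_{A,B}}(X;\mathbb{F}^2)$ and $\mathbf{h}_1^{\rm dual}$ is the basis of $H^2_{\rho_{A,B}}(X;\mathbb{F}^2)$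 dual to it under $(x,y)\mapsto\psi_*((x\smile y)\cap[X])$, is equal to $1$ in $\mathbb{F}^\times/N(\mathbb{F})$.
   Context: $N(\mathbb{F})=\{y\bar y\mid y\in\mathbb{F}^\times\}$. The manifold $X$ is the closed oriented Seifert fibered space over $S^2$ with the indicated Seifert data; it has a genus-two Heegaard splitting inducing the presentation above. With $r=(gh)^nh^{-m}$, $s=(hg)^ng^{-\ell}$, the associated CW structure has one 0-cell, two 1-cells (for $g,h$), two 2-cells (for $r,s$) and one 3-cell; the cellular chain complex of the universal cover has $\partial_1$ given by $1-g,1-h$, $\partial_2$ by the Fox derivatives of $r,s$, and $\partial_3$ determined by the identity among relations $W_X=\rho_r\,h\rho_r^{-1}h^{-1}\,\rho_s\,g\rho_s^{-1}g^{-1}$ (where $\rho_r,\rho_s$ are symbols for $r,s$), i.e. $\partial_3$ has entries $1-h$ and $1-g$ on the 2-cells of $r$ and $s$. Torsion: for bases $\mathbf{b},\mathbf{c}$ of a finite-dimensional space, $[\mathbf{b}/\mathbf{c}]$ is the determinant of the matrix $P$ with $b_i=\sum_jP_{(j,i)}c_j$. For a cochain complex $C^*$ in degrees $0,\dots,k$ with bases $\mathbf{c}_i$ of $C^i$ and $\mathbf{h}_i$ of $H^i$, choose bases $\mathbf{b}_i$ of $\mathrm{Im}(\delta^{i-1})$, lifts $\widetilde{\mathbf{b}}_{i+1}\subset C^i$ of $\mathbf{b}_{i+1}$ along $\delta^i$, and lifts $\widetilde{\mathbf{h}}_i$ of $\mathbf{h}_i$ to cocycles; $\tau(C^*,\mathbf{c},\mathbf{h})=\prod_{i=0}^k[(\mathbf{b}_i\cup\widetilde{\mathbf{h}}_i\cup\widetilde{\mathbf{b}}_{i+1})/\mathbf{c}_i]^{(-1)^{i+1}}$.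 The refined torsion $\tau^0_\rho(X,\mathbf{h})$ for a representation of even rank (here rank 2) is $\tau(C^*_\rho(X;\mathbb{F}^2),\mathbf{c}_X,\mathbf{h})$, where $C^*_\rho(X;\mathbb{F}^2)=\mathrm{Hom}_{\mathbb{Z}[\pi_1(X)]}(C_*(\widetilde X;\mathbb{Z}),\mathbb{F}^2)$ and $\mathbf{c}_X$ is the basis dual to (lifted oriented cells)$\otimes$(standard basis of $\mathbb{F}^2$). Its class in $\mathbb{F}^\times/N(\mathbb{F})$ does not depend on $\mathbf{h}_1$. $\psi_*$ is induced by $\psi$ on coefficients. *)

theory Defs
  imports
    "HOL-Analysis.Analysis"
    "HOL-Algebra.Coset"
    "HOL-Library.Poly_Mapping"
    "HOL-Library.Function_Algebras"
    "Jordan_Normal_Form.Determinant"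
begin

no_notation Matrix.vec_index (infixl "$" 100)

definition is_subfield :: "complex set \<Rightarrow> bool" where
  "is_subfield K \<longleftrightarrow> 0 \<in> K \<and> 1 \<in> K \<and>
     (\<forall>x\<in>K. \<forall>y\<in>K. x + y \<in> K \<and> x * y \<in> K) \<and> (\<forall>x\<in>K. - x \<in> K \<and> inverse x \<in> K)"

definition cyclotomic_field :: "nat \<Rightarrow> complex set" where
  "cyclotomic_field d = \<Inter>{K. is_subfield K \<and> exp (2 * of_real pi * \<i> / of_nat d) \<in> K}"

definition field_units :: "complex set \<Rightarrow> complex monoid" where
  "field_units K = \<lparr>carrier = K - {0}, mult = (*), one = 1\<rparr>"

definition norm_group :: "complex set \<Rightarrow> complex set" where
  "norm_group K = {y * cnj y | y. y \<in> carrier (field_units K)}"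

text \<open>A letter \<open>(a, True)\<close> stands for the generator \<open>a\<close>, and \<open>(a, False)\<close> for its inverse.\<close>

datatype gen = Gen_g | Gen_h
datatype rel = Rel_r | Rel_s

type_synonym word = "(gen \<times> bool) list"

definition word_power :: "word \<Rightarrow> nat \<Rightarrow> word" where
  "word_power w k = concat (replicate k w)"

fun relator :: "nat \<Rightarrow> nat \<Rightarrow> nat \<Rightarrow> rel \<Rightarrow> word" where
  "relator l m n Rel_r =
     word_power [(Gen_g, True), (Gen_h, True)] n @ word_power [(Gen_h, False)] m"
| "relator l m n Rel_s =
     word_power [(Gen_h, True), (Gen_g, True)] n @ word_power [(Gen_g, False)] l"

inductive word_eq :: "nat \<Rightarrow> nat \<Rightarrow> nat \<Rightarrow> word \<Rightarrow> word \<Rightarrow> bool" for l m n where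
  refl: "word_eq l m n w w"
| sym: "word_eq l m n v w \<Longrightarrow> word_eq l m n w v"
| trans: "word_eq l m n u v \<Longrightarrow> word_eq l m n v w \<Longrightarrow> word_eq l m n u w"
| cancel: "word_eq l m n (u @ [(a, b), (a, \<not> b)] @ v) (u @ v)"
| relator: "word_eq l m n (u @ relator l m n R @ v) (u @ v)"

definition word_class :: "nat \<Rightarrow> nat \<Rightarrow> nat \<Rightarrow> word \<Rightarrow> word set" where
  "word_class l m n w = {v. word_eq l m n w v}"

definition pi1 :: "nat \<Rightarrow> nat \<Rightarrow> nat \<Rightarrow> word set monoid" where
  "pi1 l m n = \<lparr>carrier = range (word_class l m n),
     mult = (\<lambda>x y. \<Union>u\<in>x. \<Union>v\<in>y. word_class l m n (u @ v)),
     one = word_class l m n []\<rparr>"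

text \<open>
  The pair \<open>(x, c)\<close> with \<open>x\<close> in \<open>pi1\<close> is the translate by \<open>x\<close> of the preferred lift
  of the cell \<open>c\<close>.  Chains are finitely supported integer functions on such pairs; thus
  the chains in degree \<open>i\<close> form the free left \<open>\<int>[pi1]\<close>-module on the \<open>i\<close>-cells.
\<close>

datatype cell = Cell0 | Cell1 gen | Cell2 rel | Cell3

fun cell_dim :: "cell \<Rightarrow> nat" where
  "cell_dim Cell0 = 0"
| "cell_dim (Cell1 _) = 1"
| "cell_dim (Cell2 _) = 2"
| "cell_dim Cell3 = 3"

fun cells :: "nat \<Rightarrow> cell list" where
  "cells i = (if i = 0 then [Cell0] else if i = 1 then [Cell1 Gen_g, Cell1 Gen_h]
     else if i = 2 then [Cell2 Rel_r, Cell2 Rel_s] else if i = 3 then [Cell3] else [])"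

type_synonym lcell = "word set \<times> cell"
type_synonym chain = "lcell \<Rightarrow>\<^sub>0 int"

definition lifted_cells :: "nat \<Rightarrow> nat \<Rightarrow> nat \<Rightarrow> nat \<Rightarrow> lcell set" where
  "lifted_cells l m n i = {(x, c). x \<in> carrier (pi1 l m n) \<and> cell_dim c = i}"

definition translate :: "nat \<Rightarrow> nat \<Rightarrow> nat \<Rightarrow> word set \<Rightarrow> chain \<Rightarrow> chain" where
  "translate l m n x = frag_extend (\<lambda>(y, c). frag_of (x \<otimes>\<^bsub>pi1 l m n\<^esub> y, c))"

text \<open>
  The coefficient of \<open>Cell1 a\<close> in \<open>fox l m n w\<close> is the image in \<open>\<int>[pi1]\<close> of the Fox derivative
  of \<open>w\<close> with respect to \<open>a\<close>.
\<close>

fun fox :: "nat \<Rightarrow> nat \<Rightarrow> nat \<Rightarrow> word \<Rightarrow> chain" where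
  "fox l m n [] = 0"
| "fox l m n ((a, True) # w) =
     frag_of (\<one>\<^bsub>pi1 l m n\<^esub>, Cell1 a) + translate l m n (word_class l m n [(a, True)]) (fox l m n w)"
| "fox l m n ((a, False) # w) =
     translate l m n (word_class l m n [(a, False)])
       (fox l m n w - frag_of (\<one>\<^bsub>pi1 l m n\<^esub>, Cell1 a))"

text \<open>
  The boundary of the 3-cell is read off from the identity among relations
  \<open>\<rho>\<^sub>r h \<rho>\<^sub>r\<inverse> h\<inverse> \<rho>\<^sub>s g \<rho>\<^sub>s\<inverse> g\<inverse>\<close>.
\<close>

fun cell_boundary :: "nat \<Rightarrow> nat \<Rightarrow> nat \<Rightarrow> cell \<Rightarrow> chain" where
  "cell_boundary l m n Cell0 = 0"
| "cell_boundary l m n (Cell1 a) =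
     frag_of (\<one>\<^bsub>pi1 l m n\<^esub>, Cell0) - frag_of (word_class l m n [(a, True)], Cell0)"
| "cell_boundary l m n (Cell2 R) = fox l m n (relator l m n R)"
| "cell_boundary l m n Cell3 =
     (frag_of (\<one>\<^bsub>pi1 l m n\<^esub>, Cell2 Rel_r) - frag_of (word_class l m n [(Gen_h, True)], Cell2 Rel_r))
   + (frag_of (\<one>\<^bsub>pi1 l m n\<^esub>, Cell2 Rel_s) - frag_of (word_class l m n [(Gen_g, True)], Cell2 Rel_s))"

definition boundary :: "nat \<Rightarrow> nat \<Rightarrow> nat \<Rightarrow> lcell \<Rightarrow> chain" where
  "boundary l m n = (\<lambda>(x, c). translate l m n x (cell_boundary l m n c))"

text \<open>
  The group \<open>C\<^sub>* \<otimes> C\<^sub>*\<close> is free on pairs of lifted cells, with the diagonal action of \<open>pi1\<close>.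
\<close>

type_synonym chain2 = "(lcell \<times> lcell) \<Rightarrow>\<^sub>0 int"

definition translate2 :: "nat \<Rightarrow> nat \<Rightarrow> nat \<Rightarrow> word set \<Rightarrow> chain2 \<Rightarrow> chain2" where
  "translate2 l m n x = frag_extend (\<lambda>((y, c), (z, c')).
     frag_of ((x \<otimes>\<^bsub>pi1 l m n\<^esub> y, c), (x \<otimes>\<^bsub>pi1 l m n\<^esub> z, c')))"

definition boundary2 :: "nat \<Rightarrow> nat \<Rightarrow> nat \<Rightarrow> lcell \<times> lcell \<Rightarrow> chain2" where
  "boundary2 l m n = (\<lambda>(p, q).
     frag_extend (\<lambda>p'. frag_of (p', q)) (boundary l m n p)
   + frag_cmul ((-1) ^ cell_dim (snd p)) (frag_extend (\<lambda>q'. frag_of (p, q')) (boundary l m n q)))"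

text \<open>The maps \<open>\<epsilon> \<otimes> 1\<close> and \<open>1 \<otimes> \<epsilon>\<close>, where \<open>\<epsilon>\<close> is the augmentation of \<open>C\<^sub>*\<close>.\<close>

definition counit_left :: "chain2 \<Rightarrow> chain" where
  "counit_left = frag_extend (\<lambda>(p, q). if cell_dim (snd p) = 0 then frag_of q else 0)"

definition counit_right :: "chain2 \<Rightarrow> chain" where
  "counit_right = frag_extend (\<lambda>(p, q). if cell_dim (snd q) = 0 then frag_of p else 0)"

definition homotopic_to_id :: "nat \<Rightarrow> nat \<Rightarrow> nat \<Rightarrow> (lcell \<Rightarrow> chain) \<Rightarrow> bool" where
  "homotopic_to_id l m n f \<longleftrightarrow> (\<exists>s :: lcell \<Rightarrow> chain. \<forall>x\<in>carrier (pi1 l m n). \<forall>c.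
     Poly_Mapping.keys (s (x, c)) \<subseteq> lifted_cells l m n (Suc (cell_dim c)) \<and>
     (\<forall>y\<in>carrier (pi1 l m n). s (y \<otimes>\<^bsub>pi1 l m n\<^esub> x, c) = translate l m n y (s (x, c))) \<and>
     f (x, c) - frag_of (x, c) =
       frag_extend (boundary l m n) (s (x, c)) + frag_extend s (boundary l m n (x, c)))"

text \<open>
  An equivariant chain map \<open>C\<^sub>* \<rightarrow> C\<^sub>* \<otimes> C\<^sub>*\<close>, given on lifted cells, whose two projections to
  \<open>C\<^sub>*\<close> are equivariantly chain homotopic to the identity.  The chain map induced by any
  equivariant cellular approximation to the diagonal of the universal cover is of this kind,
  because composing the diagonal with either projection gives the identity.
\<close>

definition diagonal_approximation :: "nat \<Rightarrow> nat \<Rightarrow> nat \<Rightarrow> (lcell \<Rightarrow> chain2) \<Rightarrow> bool" where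
  "diagonal_approximation l m n D \<longleftrightarrow>
     (\<forall>x\<in>carrier (pi1 l m n). \<forall>c.
        Poly_Mapping.keys (D (x, c)) \<subseteq>
          (\<Union>i\<le>cell_dim c. lifted_cells l m n i \<times> lifted_cells l m n (cell_dim c - i)) \<and>
        (\<forall>y\<in>carrier (pi1 l m n). D (y \<otimes>\<^bsub>pi1 l m n\<^esub> x, c) = translate2 l m n y (D (x, c))) \<and>
        frag_extend D (boundary l m n (x, c)) = frag_extend (boundary2 l m n) (D (x, c))) \<and>
     homotopic_to_id l m n (\<lambda>p. counit_left (D p)) \<and>
     homotopic_to_id l m n (\<lambda>p. counit_right (D p))"

text \<open>
  A complex is given by subsets \<open>C i\<close> of one ambient group, which are \<open>K\<close>-vector spaces under the
  scalar multiplication \<open>sc\<close>, and by a single map \<open>\<delta>\<close> which sends \<open>C i\<close> to \<open>C (Suc i)\<close>.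
  Cohomology classes are cosets, that is, sets of cocycles.
\<close>

definition cocycles :: "(nat \<Rightarrow> 'v set) \<Rightarrow> ('v \<Rightarrow> 'v) \<Rightarrow> nat \<Rightarrow> 'v::ab_group_add set" where
  "cocycles C \<delta> i = {z \<in> C i. \<delta> z = 0}"

definition coboundaries :: "(nat \<Rightarrow> 'v set) \<Rightarrow> ('v \<Rightarrow> 'v) \<Rightarrow> nat \<Rightarrow> 'v::ab_group_add set" where
  "coboundaries C \<delta> i = (if i = 0 then {0} else \<delta> ` C (i - 1))"

definition coh_class :: "(nat \<Rightarrow> 'v set) \<Rightarrow> ('v \<Rightarrow> 'v) \<Rightarrow> nat \<Rightarrow> 'v \<Rightarrow> 'v::ab_group_add set" where
  "coh_class C \<delta> i z = (\<lambda>b. z + b) ` coboundaries C \<delta> i"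

definition cohomology :: "(nat \<Rightarrow> 'v set) \<Rightarrow> ('v \<Rightarrow> 'v) \<Rightarrow> nat \<Rightarrow> 'v::ab_group_add set set" where
  "cohomology C \<delta> i = coh_class C \<delta> i ` cocycles C \<delta> i"

text \<open>
  A \<open>K\<close>-linear isomorphism from \<open>H\<^sup>i\<close> to the \<open>K\<close>-space \<open>W\<close> with scalar multiplication \<open>sc'\<close>; the
  operations on \<open>H\<^sup>i\<close> are those on representatives.
\<close>

definition cohomology_iso ::
  "complex set \<Rightarrow> (complex \<Rightarrow> 'v::ab_group_add \<Rightarrow> 'v) \<Rightarrow> (nat \<Rightarrow> 'v set) \<Rightarrow> ('v \<Rightarrow> 'v) \<Rightarrow> nat
    \<Rightarrow> (complex \<Rightarrow> 'w \<Rightarrow> 'w) \<Rightarrow> 'w::ab_group_add set \<Rightarrow> bool" where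
  "cohomology_iso K sc C \<delta> i sc' W \<longleftrightarrow> (\<exists>f. bij_betw f (cohomology C \<delta> i) W \<and>
     (\<forall>x\<in>cocycles C \<delta> i. \<forall>y\<in>cocycles C \<delta> i.
        f (coh_class C \<delta> i (x + y)) = f (coh_class C \<delta> i x) + f (coh_class C \<delta> i y)) \<and>
     (\<forall>k\<in>K. \<forall>x\<in>cocycles C \<delta> i.
        f (coh_class C \<delta> i (sc k x)) = sc' k (f (coh_class C \<delta> i x))))"

definition lin_comb :: "(complex \<Rightarrow> 'v \<Rightarrow> 'v) \<Rightarrow> complex list \<Rightarrow> 'v list \<Rightarrow> 'v::ab_group_add" where
  "lin_comb sc ks vs = (\<Sum>i<length vs. sc (ks ! i) (vs ! i))"

text \<open>The list \<open>vs\<close> in \<open>Z\<close> represents a \<open>K\<close>-basis of the quotient of \<open>Z\<close> by its subspace \<open>B\<close>.\<close>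

definition basis_modulo ::
  "complex set \<Rightarrow> (complex \<Rightarrow> 'v \<Rightarrow> 'v) \<Rightarrow> 'v::ab_group_add set \<Rightarrow> 'v set \<Rightarrow> 'v list \<Rightarrow> bool" where
  "basis_modulo K sc B Z vs \<longleftrightarrow> set vs \<subseteq> Z \<and>
     (\<forall>z\<in>Z. \<exists>!ks. length ks = length vs \<and> set ks \<subseteq> K \<and> z - lin_comb sc ks vs \<in> B)"

abbreviation basis_of ::
  "complex set \<Rightarrow> (complex \<Rightarrow> 'v \<Rightarrow> 'v) \<Rightarrow> 'v::ab_group_add set \<Rightarrow> 'v list \<Rightarrow> bool" where
  "basis_of K sc Z vs \<equiv> basis_modulo K sc {0} Z vs"

definition cohomology_basis ::
  "complex set \<Rightarrow> (complex \<Rightarrow> 'v \<Rightarrow> 'v) \<Rightarrow> (nat \<Rightarrow> 'v set) \<Rightarrow> ('v \<Rightarrow> 'v) \<Rightarrow> nat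
    \<Rightarrow> 'v::ab_group_add set list \<Rightarrow> bool" where
  "cohomology_basis K sc C \<delta> i hs \<longleftrightarrow> (\<exists>zs. hs = map (coh_class C \<delta> i) zs \<and>
     basis_modulo K sc (coboundaries C \<delta> i) (cocycles C \<delta> i) zs)"

definition coords :: "complex set \<Rightarrow> (complex \<Rightarrow> 'v \<Rightarrow> 'v) \<Rightarrow> 'v::ab_group_add list \<Rightarrow> 'v \<Rightarrow> complex list"
  where "coords K sc cs v =
    (THE ks. length ks = length cs \<and> set ks \<subseteq> K \<and> v = lin_comb sc ks cs)"

text \<open>\<open>[b/c]\<close>: the \<open>(j, i)\<close> entry of the matrix is the coefficient of \<open>c\<^sub>j\<close> in \<open>b\<^sub>i\<close>.\<close>

definition basis_change ::
  "complex set \<Rightarrow> (complex \<Rightarrow> 'v \<Rightarrow> 'v) \<Rightarrow> 'v::ab_group_add list \<Rightarrow> 'v list \<Rightarrow> complex" where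
  "basis_change K sc bs cs = Determinant.det
     (Matrix.mat (length cs) (length cs) (\<lambda>(j, i). coords K sc cs (bs ! i) ! j))"

text \<open>
  The value \<open>t\<close> of the defining product for some admissible choice of the bases \<open>b i\<close> of
  the coboundaries, of the lifts \<open>bt i\<close> in \<open>C (i - 1)\<close> of \<open>b i\<close>, and of the
  representatives \<open>ht i\<close> of the classes \<open>h i\<close>.
\<close>

definition torsion_value ::
  "complex set \<Rightarrow> (complex \<Rightarrow> 'v \<Rightarrow> 'v) \<Rightarrow> nat \<Rightarrow> (nat \<Rightarrow> 'v set) \<Rightarrow> ('v \<Rightarrow> 'v)
    \<Rightarrow> (nat \<Rightarrow> 'v list) \<Rightarrow> (nat \<Rightarrow> 'v::ab_group_add set list) \<Rightarrow> complex \<Rightarrow> bool" where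
  "torsion_value K sc k C \<delta> c h t \<longleftrightarrow> (\<exists>b bt ht.
     (\<forall>i\<le>Suc k. basis_of K sc (coboundaries C \<delta> i) (b i)) \<and>
     (\<forall>i\<le>k. set (bt (Suc i)) \<subseteq> C i \<and> map \<delta> (bt (Suc i)) = b (Suc i)) \<and>
     (\<forall>i\<le>k. set (ht i) \<subseteq> cocycles C \<delta> i \<and> map (coh_class C \<delta> i) (ht i) = h i) \<and>
     t = (\<Prod>i\<le>k. basis_change K sc (b i @ ht i @ bt (Suc i)) (c i) powi ((-1) ^ Suc i)))"

text \<open>
  Definite description is justified because the product does not depend on the choices in
  \<open>torsion_value\<close>, as long as each \<open>h i\<close> is a basis of \<open>H\<^sup>i\<close>.
\<close>

definition torsion ::
  "complex set \<Rightarrow> (complex \<Rightarrow> 'v \<Rightarrow> 'v) \<Rightarrow> nat \<Rightarrow> (nat \<Rightarrow> 'v set) \<Rightarrow> ('v \<Rightarrow> 'v)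
    \<Rightarrow> (nat \<Rightarrow> 'v list) \<Rightarrow> (nat \<Rightarrow> 'v::ab_group_add set list) \<Rightarrow> complex" where
  "torsion K sc k C \<delta> c h = (THE t. torsion_value K sc k C \<delta> c h t)"

definition plane :: "complex set \<Rightarrow> (complex ^ 2) set" where
  "plane K = {v. \<forall>i. v $ i \<in> K}"

text \<open>
  A homomorphism on \<open>i\<close>-chains is given by its values on the lifted \<open>i\<close>-cells; it is extended
  by zero to all other pairs.
\<close>

type_synonym cochain = "lcell \<Rightarrow> complex ^ 2"

definition scale_cochain :: "complex \<Rightarrow> cochain \<Rightarrow> cochain" where
  "scale_cochain k \<phi> = (\<lambda>p. k *s \<phi> p)"

definition tw_cochains ::
  "nat \<Rightarrow> nat \<Rightarrow> nat \<Rightarrow> complex set \<Rightarrow> (word set \<Rightarrow> complex ^ 2 ^ 2) \<Rightarrow> nat \<Rightarrow> cochain set" where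
  "tw_cochains l m n F \<rho> i = {\<phi>.
     (\<forall>p. p \<notin> lifted_cells l m n i \<longrightarrow> \<phi> p = 0) \<and>
     (\<forall>p\<in>lifted_cells l m n i. \<phi> p \<in> plane F) \<and>
     (\<forall>x\<in>carrier (pi1 l m n). \<forall>(y, c)\<in>lifted_cells l m n i.
        \<phi> (x \<otimes>\<^bsub>pi1 l m n\<^esub> y, c) = \<rho> x *v \<phi> (y, c))}"

definition eval_cochain :: "cochain \<Rightarrow> chain \<Rightarrow> complex ^ 2" where
  "eval_cochain \<phi> u = (\<Sum>p\<in>Poly_Mapping.keys u. of_int (Poly_Mapping.lookup u p) *s \<phi> p)"

definition tw_coboundary :: "nat \<Rightarrow> nat \<Rightarrow> nat \<Rightarrow> cochain \<Rightarrow> cochain" where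
  "tw_coboundary l m n \<phi> = (\<lambda>p. if fst p \<in> carrier (pi1 l m n)
     then eval_cochain \<phi> (boundary l m n p) else 0)"

text \<open>The basis dual to (preferred lifts of the cells) \<open>\<otimes>\<close> (standard basis).\<close>

definition dual_cochain ::
  "nat \<Rightarrow> nat \<Rightarrow> nat \<Rightarrow> (word set \<Rightarrow> complex ^ 2 ^ 2) \<Rightarrow> cell \<Rightarrow> 2 \<Rightarrow> cochain" where
  "dual_cochain l m n \<rho> c k = (\<lambda>(x, c').
     if x \<in> carrier (pi1 l m n) \<and> c' = c then \<rho> x *v axis k 1 else 0)"

definition tw_basis ::
  "nat \<Rightarrow> nat \<Rightarrow> nat \<Rightarrow> (word set \<Rightarrow> complex ^ 2 ^ 2) \<Rightarrow> nat \<Rightarrow> cochain list" where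
  "tw_basis l m n \<rho> i = [dual_cochain l m n \<rho> c k. c \<leftarrow> cells i, k \<leftarrow> [1, 2]]"

definition refined_torsion ::
  "nat \<Rightarrow> nat \<Rightarrow> nat \<Rightarrow> complex set \<Rightarrow> (word set \<Rightarrow> complex ^ 2 ^ 2)
    \<Rightarrow> (nat \<Rightarrow> cochain set list) \<Rightarrow> complex" where
  "refined_torsion l m n F \<rho> h =
     torsion F scale_cochain 3 (tw_cochains l m n F \<rho>) (tw_coboundary l m n) (tw_basis l m n \<rho>) h"

definition tw_cohomology_basis ::
  "nat \<Rightarrow> nat \<Rightarrow> nat \<Rightarrow> complex set \<Rightarrow> (word set \<Rightarrow> complex ^ 2 ^ 2) \<Rightarrow> nat
    \<Rightarrow> cochain set list \<Rightarrow> bool" where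
  "tw_cohomology_basis l m n F \<rho> i hs \<longleftrightarrow>
     cohomology_basis F scale_cochain (tw_cochains l m n F \<rho>) (tw_coboundary l m n) i hs"

definition psi :: "complex ^ 2 \<Rightarrow> complex ^ 2 \<Rightarrow> complex" where
  "psi v w = (\<Sum>i\<in>UNIV. cnj (v $ i) * w $ i)"

text \<open>
  The cochain \<open>\<psi>\<^sub>*(\<phi> \<smile> \<theta>)\<close> with values in the trivial module \<open>F\<close>, on lifted cells.  Cochains
  vanish outside their degree, so only one bidegree of \<open>D p\<close> contributes.  The usual sign is
  absent: it is \<open>+1\<close> when the second factor has even degree.
\<close>

definition cup_psi :: "(lcell \<Rightarrow> chain2) \<Rightarrow> cochain \<Rightarrow> cochain \<Rightarrow> lcell \<Rightarrow> complex" where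
  "cup_psi D \<phi> \<theta> p = (\<Sum>(a, b)\<in>Poly_Mapping.keys (D p).
     of_int (Poly_Mapping.lookup (D p) (a, b)) * psi (\<phi> a) (\<theta> b))"

text \<open>
  The value of \<open>\<psi>\<^sub>*(x \<smile> y) \<inter> [X]\<close> in \<open>H\<^sub>0(X; F) = F\<close>, which does not depend on the representatives.
  The class \<open>[X]\<close> is represented by \<open>\<sigma>\<close> times the 3-cell, with \<open>\<sigma> = \<plusminus>1\<close> depending on whether
  the orientation of the cell agrees with that of \<open>X\<close>.
\<close>

definition duality_pairing ::
  "nat \<Rightarrow> nat \<Rightarrow> nat \<Rightarrow> (lcell \<Rightarrow> chain2) \<Rightarrow> int \<Rightarrow> cochain set \<Rightarrow> cochain set \<Rightarrow> complex" where
  "duality_pairing l m n D \<sigma> x y =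
     (THE t. \<forall>\<phi>\<in>x. \<forall>\<theta>\<in>y. t = of_int \<sigma> * cup_psi D \<phi> \<theta> (\<one>\<^bsub>pi1 l m n\<^esub>, Cell3))"

definition is_dual_basis ::
  "nat \<Rightarrow> nat \<Rightarrow> nat \<Rightarrow> complex set \<Rightarrow> (word set \<Rightarrow> complex ^ 2 ^ 2) \<Rightarrow> (lcell \<Rightarrow> chain2) \<Rightarrow> int
    \<Rightarrow> cochain set list \<Rightarrow> cochain set list \<Rightarrow> bool" where
  "is_dual_basis l m n F \<rho> D \<sigma> hs ks \<longleftrightarrow>
     tw_cohomology_basis l m n F \<rho> 2 ks \<and> length ks = length hs \<and>
     (\<forall>i<length hs. \<forall>j<length ks.
        duality_pairing l m n D \<sigma> (hs ! i) (ks ! j) = (if i = j then 1 else 0))"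

definition adjoint_mat :: "complex ^ 2 ^ 2 \<Rightarrow> complex ^ 2 ^ 2" where
  "adjoint_mat M = (\<chi> i j. cnj (M $ j $ i))"

definition SU2 :: "(complex ^ 2 ^ 2) monoid" where
  "SU2 = \<lparr>carrier = {M. adjoint_mat M ** M = Finite_Cartesian_Product.mat 1 \<and> Determinants.det M = 1},
     mult = (**), one = Finite_Cartesian_Product.mat 1\<rparr>"

definition SL2 :: "complex set \<Rightarrow> (complex ^ 2 ^ 2) monoid" where
  "SL2 K = \<lparr>carrier = {M. (\<forall>i j. M $ i $ j \<in> K) \<and> Determinants.det M = 1},
     mult = (**), one = Finite_Cartesian_Product.mat 1\<rparr>"

text \<open>Irreducibility is over the complex numbers.\<close>

definition irreducible_rep :: "'g monoid \<Rightarrow> ('g \<Rightarrow> complex ^ 2 ^ 2) \<Rightarrow> bool" where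
  "irreducible_rep G \<rho> \<longleftrightarrow> (\<forall>W. vec.subspace W \<and> (\<forall>x\<in>carrier G. \<forall>w\<in>W. \<rho> x *v w \<in> W)
     \<longrightarrow> W = {0} \<or> W = UNIV)"

definition eigenvalues :: "complex ^ 2 ^ 2 \<Rightarrow> complex set" where
  "eigenvalues M = {\<mu>. \<exists>v. v \<noteq> 0 \<and> M *v v = \<mu> *s v}"

end

theory Submission
  imports Defs
begin

text \<open>
  Write \<open>A\<close>, \<open>B\<close> for the images of \<open>g\<close>, \<open>h\<close>.  From \<open>\<alpha>\<^sup>l = 1\<close> and the relations it follows that
  \<open>A\<^sup>l\<close>, \<open>B\<^sup>m\<close>, \<open>(AB)\<^sup>n\<close> and \<open>(BA)\<^sup>n\<close> are the identity (\<open>rep_powers\<close>).  By irreducibility none of \<open>A\<close>,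
  \<open>B\<close>, \<open>AB\<close>, \<open>BA\<close> fixes a nonzero vector (\<open>A_fixed\<close>, \<open>no_fixed_vector\<close>), since a fixed vector makes a
  matrix in \<open>SU(2)\<close> trivial.  The Fox derivatives of the relators are geometric sums in these
  matrices, so they act by zero and the coboundary from degree 1 to degree 2 vanishes
  (\<open>value_fox_relator\<close>).  The complex is then explicit:
  \<open>v \<mapsto> ((1 - A) v, (1 - B) v)\<close> in degree 0 and \<open>(x, y) \<mapsto> (1 - B) x + (1 - A) y\<close> in degree 2, where
  \<open>1 - A\<close> is invertible.  Thus the cohomology in degrees 0 and 3 is zero.  The value on \<open>h\<close>, corrected
  by a coboundary to have value 0 on \<open>g\<close>, is a coordinate on \<open>H\<^sup>1\<close> with values in the plane, and the
  value on the 2-cell of \<open>r\<close> is a coordinate on \<open>H\<^sup>2\<close>.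

  The duality pairing has to be found for an arbitrary diagonal approximation.  A 1-cocycle \<open>\<phi>\<close> extends
  to a crossed homomorphism on the fundamental group, which is a primitive of \<open>- \<phi>\<close> on the universal
  cover.  Pairing this primitive, instead of \<open>\<phi>\<close>, with a 2-cocycle \<open>\<theta>\<close> moves the cup product from the
  3-cell to its boundary \<open>(1 - h) r + (1 - g) s\<close>.  There only the failure of the primitive to be
  equivariant survives, and it sees the diagonal just through its left projection, which is homotopic
  to the identity.  The result is \<open>\<psi>(\<phi> h, B \<theta> r) + \<psi>(\<phi> g, A \<theta> s)\<close>
  (\<open>cup_psi_fundamental_cell\<close>), and in the coordinates \<open>w\<close> on \<open>H\<^sup>1\<close> and \<open>x\<close> on \<open>H\<^sup>2\<close> it is \<open>\<psi>(w, B x)\<close>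
  (\<open>cup_psi_H1_coord\<close>).

  Let \<open>H\<close> and \<open>X\<close> be the determinants of the coordinates of a basis and of its dual basis.  As \<open>B\<close> has
  determinant 1, duality gives \<open>cnj H * X = 1\<close> (\<open>dual_pair_det\<close>).  On the other hand the torsion is
  \<open>p\<^sup>2 H / X\<close> with \<open>p = det (1 - A)\<close> (\<open>torsion_value_eq\<close>).  Since \<open>p\<close> is real, this is the norm of
  \<open>p H\<close>.
\<close>

section \<open>Integer chains and additive functionals\<close>

text \<open>
  Evaluating a twisted cochain on a chain and evaluating a cup product on the chain given by a
  diagonal approximation are two cases of extending a function on generators additively to
  integer chains.  With real scalars both fit into one definition.
\<close>

definition chain_value :: "('a \<Rightarrow> 'v) \<Rightarrow> ('a \<Rightarrow>\<^sub>0 int) \<Rightarrow> 'v::real_vector" where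
  "chain_value f u = (\<Sum>p\<in>Poly_Mapping.keys u. of_int (Poly_Mapping.lookup u p) *\<^sub>R f p)"

lemma chain_value_superset:
  assumes "finite S" "Poly_Mapping.keys u \<subseteq> S"
  shows "chain_value f u = (\<Sum>p\<in>S. of_int (Poly_Mapping.lookup u p) *\<^sub>R f p)"
  unfolding chain_value_def
  by (rule sum.mono_neutral_left) (use assms in \<open>auto simp: in_keys_iff\<close>)

lemma chain_value_0 [simp]: "chain_value f 0 = 0"
  by (simp add: chain_value_def)

lemma chain_value_of [simp]: "chain_value f (frag_of p) = f p"
  by (simp add: chain_value_def keys_frag_of)

lemma chain_value_add: "chain_value f (u + v) = chain_value f u + chain_value f v"
proof -
  let ?S = "Poly_Mapping.keys u \<union> Poly_Mapping.keys v"
  have "Poly_Mapping.keys (u + v) \<subseteq> ?S"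
    by (rule Poly_Mapping.keys_add)
  then show ?thesis
    by (simp add: chain_value_superset[of ?S] lookup_add scaleR_left_distrib sum.distrib)
qed

lemma chain_value_cmul: "chain_value f (frag_cmul k u) = of_int k *\<^sub>R chain_value f u"
  by (simp add: chain_value_superset[OF finite_keys keys_cmul] scaleR_sum_right)
     (simp add: chain_value_def scaleR_sum_right)

lemma chain_value_minus: "chain_value f (- u) = - chain_value f u"
  using chain_value_cmul[of f "-1" u] by simp

lemma chain_value_diff: "chain_value f (u - v) = chain_value f u - chain_value f v"
  using chain_value_add[of f u "- v"] by (simp add: chain_value_minus)

lemma chain_value_extend:
  "chain_value f (frag_extend g u) = chain_value (\<lambda>p. chain_value f (g p)) u"
  by (induction u rule: frag_induction[OF subset_UNIV])
     (simp_all add: frag_extend_diff chain_value_diff)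

lemma chain_value_cong:
  "(\<And>p. p \<in> Poly_Mapping.keys u \<Longrightarrow> f p = g p) \<Longrightarrow> chain_value f u = chain_value g u"
  by (simp add: chain_value_def)

lemma chain_value_fun_add: "chain_value (\<lambda>p. f p + g p) u = chain_value f u + chain_value g u"
  by (simp add: chain_value_def scaleR_right_distrib sum.distrib)

lemma chain_value_fun_zero [simp]: "chain_value (\<lambda>p. 0) u = 0"
  by (simp add: chain_value_def)

lemma chain_value_linear:
  assumes "linear h"
  shows "chain_value (\<lambda>p. h (f p)) u = h (chain_value f u)"
  by (simp add: chain_value_def linear_sum[OF assms] linear_scale[OF assms])

lemma eval_cochain_chain_value: "eval_cochain \<phi> u = chain_value \<phi> u"
proof -
  have "of_int k *s v = of_int k *\<^sub>R v" for k and v :: "complex ^ 2"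
    by (simp only: Finite_Cartesian_Product.vec_eq_iff vector_smult_component vector_scaleR_component)
       (simp add: scaleR_conv_of_real)
  then show ?thesis
    by (simp add: eval_cochain_def chain_value_def)
qed

lemma cup_psi_chain_value: "cup_psi D \<phi> \<theta> p = chain_value (\<lambda>(a, b). psi (\<phi> a) (\<theta> b)) (D p)"
  by (auto simp: cup_psi_def chain_value_def scaleR_conv_of_real intro!: sum.cong)

section \<open>The group of words\<close>

lemma word_eq_append_left: "word_eq l m n v w \<Longrightarrow> word_eq l m n (u @ v) (u @ w)"
proof (induction rule: word_eq.induct)
  case (cancel u' a b v)
  then show ?case using word_eq.cancel[of l m n "u @ u'" a b v] by simp
next
  case (relator u' R v)
  then show ?case using word_eq.relator[of l m n "u @ u'" R v] by simp
qed (auto intro: word_eq.intros)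

lemma word_eq_append_right: "word_eq l m n v w \<Longrightarrow> word_eq l m n (v @ u) (w @ u)"
proof (induction rule: word_eq.induct)
  case (cancel u' a b v)
  then show ?case using word_eq.cancel[of l m n u' a b "v @ u"] by simp
next
  case (relator u' R v)
  then show ?case using word_eq.relator[of l m n u' R "v @ u"] by simp
qed (auto intro: word_eq.intros)

lemma word_eq_append:
  "word_eq l m n u u' \<Longrightarrow> word_eq l m n v v' \<Longrightarrow> word_eq l m n (u @ v) (u' @ v')"
  by (blast intro: word_eq.trans word_eq_append_left word_eq_append_right)

lemma word_class_eq_iff: "word_class l m n u = word_class l m n v \<longleftrightarrow> word_eq l m n u v"
  unfolding word_class_def by (blast intro: word_eq.intros)

lemma mem_word_class: "v \<in> word_class l m n u \<longleftrightarrow> word_eq l m n u v"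
  by (simp add: word_class_def)

lemma word_class_in_pi1 [simp]: "word_class l m n w \<in> carrier (pi1 l m n)"
  by (simp add: pi1_def)

lemma pi1_cases:
  assumes "x \<in> carrier (pi1 l m n)"
  obtains w where "x = word_class l m n w"
  using assms by (auto simp: pi1_def)

lemma pi1_mult [simp]:
  "word_class l m n u \<otimes>\<^bsub>pi1 l m n\<^esub> word_class l m n v = word_class l m n (u @ v)"
proof -
  have "word_class l m n (u' @ v') = word_class l m n (u @ v)"
    if "u' \<in> word_class l m n u" "v' \<in> word_class l m n v" for u' v'
    using that by (auto simp: word_class_eq_iff mem_word_class intro: word_eq.sym word_eq_append)
  moreover have "u \<in> word_class l m n u" "v \<in> word_class l m n v"
    by (simp_all add: mem_word_class word_eq.refl)
  ultimately have "(\<Union>u'\<in>word_class l m n u. \<Union>v'\<in>word_class l m n v. word_class l m n (u' @ v'))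
      = word_class l m n (u @ v)"
    by blast
  then show ?thesis
    by (simp add: pi1_def)
qed

lemma pi1_one: "\<one>\<^bsub>pi1 l m n\<^esub> = word_class l m n []"
  by (simp add: pi1_def)

lemma pi1_mult_closed:
  "x \<in> carrier (pi1 l m n) \<Longrightarrow> y \<in> carrier (pi1 l m n) \<Longrightarrow> x \<otimes>\<^bsub>pi1 l m n\<^esub> y \<in> carrier (pi1 l m n)"
  by (elim pi1_cases) simp

lemma pi1_one_closed [simp]: "\<one>\<^bsub>pi1 l m n\<^esub> \<in> carrier (pi1 l m n)"
  by (simp add: pi1_one)

lemma pi1_mult_one:
  "x \<in> carrier (pi1 l m n) \<Longrightarrow> x \<otimes>\<^bsub>pi1 l m n\<^esub> \<one>\<^bsub>pi1 l m n\<^esub> = x"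
  "x \<in> carrier (pi1 l m n) \<Longrightarrow> \<one>\<^bsub>pi1 l m n\<^esub> \<otimes>\<^bsub>pi1 l m n\<^esub> x = x"
  by (elim pi1_cases, simp add: pi1_one)+

lemma word_power_0 [simp]: "word_power w 0 = []"
  by (simp add: word_power_def)

lemma word_power_Suc: "word_power w (Suc k) = w @ word_power w k"
  by (simp add: word_power_def)

lemma word_power_commutes: "word_power w k @ w = w @ word_power w k"
  by (induction k) (simp_all add: word_power_Suc)

text \<open>
  Both sides spell the same word \<open>uvuv \<dots> vu\<close>, so the powers of \<open>uv\<close> and \<open>vu\<close> are conjugate
  before any relation is imposed.
\<close>

lemma word_power_conjugate: "word_power (u @ v) k @ u = u @ word_power (v @ u) k"
  by (induction k) (simp_all add: word_power_Suc)

lemma word_power_inverse: "word_eq l m n (word_power [(a, b)] k @ word_power [(a, \<not> b)] k) []"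
proof (induction k)
  case 0
  then show ?case by (simp add: word_eq.refl)
next
  case (Suc k)
  let ?u = "word_power [(a, b)] k" and ?v = "word_power [(a, \<not> b)] k"
  have "word_eq l m n (?u @ [(a, b), (a, \<not> b)] @ ?v) (?u @ ?v)"
    by (rule word_eq.cancel)
  moreover have "word_power [(a, b)] (Suc k) @ word_power [(a, \<not> b)] (Suc k)
      = ?u @ [(a, b), (a, \<not> b)] @ ?v"
    using word_power_commutes[of "[(a, b)]" k] by (simp add: word_power_Suc)
  ultimately show ?case
    using Suc.IH word_eq.trans by metis
qed

lemma word_class_inverse:
  "word_class l m n [(a, b)] \<otimes>\<^bsub>pi1 l m n\<^esub> word_class l m n [(a, \<not> b)] = \<one>\<^bsub>pi1 l m n\<^esub>"
  using word_power_inverse[of l m n a b 1] by (simp add: pi1_one word_class_eq_iff word_power_Suc)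

section \<open>Subfields of the complex numbers\<close>

lemma is_subfield_cyclotomic: "is_subfield (cyclotomic_field d)"
  by (auto simp: is_subfield_def cyclotomic_field_def)

text \<open>
  The conjugate of the generating root of unity is its inverse.  Hence the preimage under
  conjugation of a subfield containing it is again such a subfield, and takes part in the
  intersection.
\<close>

lemma cnj_cyclotomic_field:
  assumes "x \<in> cyclotomic_field d"
  shows "cnj x \<in> cyclotomic_field d"
  unfolding cyclotomic_field_def
proof (intro InterI, clarify)
  fix K
  let ?z = "exp (2 * of_real pi * \<i> / of_nat d)"
  assume K: "is_subfield K" "?z \<in> K"
  have "cnj ?z = inverse ?z"
    by (simp add: exp_cnj exp_minus[symmetric])
  then have "is_subfield (cnj -` K)" "?z \<in> cnj -` K"
    using K by (auto simp: is_subfield_def)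
  then have "x \<in> cnj -` K"
    using assms unfolding cyclotomic_field_def by blast
  then show "cnj x \<in> K" by simp
qed

context
  fixes K :: "complex set"
  assumes K: "is_subfield K"
begin

lemma subfield_0: "0 \<in> K" and subfield_1: "1 \<in> K"
  and subfield_add: "x \<in> K \<Longrightarrow> y \<in> K \<Longrightarrow> x + y \<in> K"
  and subfield_mult: "x \<in> K \<Longrightarrow> y \<in> K \<Longrightarrow> x * y \<in> K"
  and subfield_uminus: "x \<in> K \<Longrightarrow> - x \<in> K"
  and subfield_inverse: "x \<in> K \<Longrightarrow> inverse x \<in> K"
  using K by (auto simp: is_subfield_def)

lemma subfield_diff: "x \<in> K \<Longrightarrow> y \<in> K \<Longrightarrow> x - y \<in> K"
  using subfield_add[of x "- y"] subfield_uminus by simp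

lemma subfield_divide: "x \<in> K \<Longrightarrow> y \<in> K \<Longrightarrow> x / y \<in> K"
  by (simp add: divide_inverse subfield_mult subfield_inverse)

lemma subfield_sum: "(\<And>i. i \<in> I \<Longrightarrow> f i \<in> K) \<Longrightarrow> sum f I \<in> K"
  by (induction I rule: infinite_finite_induct) (auto intro: subfield_add subfield_0)

lemmas subfield_closed =
  subfield_0 subfield_1 subfield_add subfield_mult subfield_uminus subfield_inverse
  subfield_diff subfield_divide

end

text \<open>
  Multiplication by the norm of \<open>y\<close> permutes the norms: it is undone by the norm of \<open>1 / y\<close>.
\<close>

lemma norm_group_coset:
  assumes K: "is_subfield K" and y: "y \<in> K" "y \<noteq> 0"
  shows "norm_group K #>\<^bsub>field_units K\<^esub> (y * cnj y) = \<one>\<^bsub>field_units K Mod norm_group K\<^esub>"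
proof -
  note cl = subfield_closed[OF K]
  have norms: "norm_group K = {z * cnj z | z. z \<in> K \<and> z \<noteq> 0}"
    by (auto simp: norm_group_def field_units_def)
  have "norm_group K #>\<^bsub>field_units K\<^esub> (y * cnj y) = norm_group K"
  proof (intro equalityI subsetI)
    fix t assume "t \<in> norm_group K #>\<^bsub>field_units K\<^esub> (y * cnj y)"
    then obtain z where "z \<in> K" "z \<noteq> 0" "t = (z * y) * cnj (z * y)"
      by (auto simp: r_coset_def norms field_units_def)
    then show "t \<in> norm_group K"
      using y unfolding norms by (intro CollectI exI[of _ "z * y"]) (simp add: cl(4))
  next
    fix t assume "t \<in> norm_group K"
    then obtain z where z: "z \<in> K" "z \<noteq> 0" "t = z * cnj z"
      by (auto simp: norms)
    then have "t = ((z / y) * cnj (z / y)) * (y * cnj y)" "z / y \<in> K - {0}"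
      using y by (auto simp: field_simps intro: cl)
    then show "t \<in> norm_group K #>\<^bsub>field_units K\<^esub> (y * cnj y)"
      unfolding r_coset_def norms
      by (intro UN_I[of "(z / y) * cnj (z / y)"] CollectI exI[of _ "z / y"])
         (auto simp: field_units_def)
  qed
  then show ?thesis
    by (simp add: FactGroup_def)
qed

section \<open>Quotient maps and bases over a subfield\<close>

text \<open>
  The map \<open>w\<close> exhibits \<open>W\<close> as the quotient of \<open>Z\<close> by its subspace \<open>B\<close>.  Each nonzero
  cohomology space and each nonzero space of coboundaries below is identified with the plane in this way, so that bases
  and isomorphisms are discussed once, for such maps.
\<close>

definition linear_quotient ::
  "complex set \<Rightarrow> (complex \<Rightarrow> 'v \<Rightarrow> 'v) \<Rightarrow> 'v set \<Rightarrow> 'v set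
    \<Rightarrow> (complex \<Rightarrow> 'w \<Rightarrow> 'w) \<Rightarrow> 'w set \<Rightarrow> ('v::ab_group_add \<Rightarrow> 'w::ab_group_add) \<Rightarrow> bool" where
  "linear_quotient K sc B Z sc' W w \<longleftrightarrow> 0 \<in> Z \<and> w ` Z = W \<and> B = {z \<in> Z. w z = 0} \<and>
     (\<forall>x\<in>Z. \<forall>y\<in>Z. x + y \<in> Z \<and> x - y \<in> Z \<and> w (x + y) = w x + w y) \<and>
     (\<forall>k\<in>K. \<forall>x\<in>Z. sc k x \<in> Z \<and> w (sc k x) = sc' k (w x))"

context
  fixes K :: "complex set" and sc :: "complex \<Rightarrow> 'v::ab_group_add \<Rightarrow> 'v" and B Z :: "'v set"
    and sc' :: "complex \<Rightarrow> 'w::ab_group_add \<Rightarrow> 'w" and W :: "'w set" and w :: "'v \<Rightarrow> 'w"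
  assumes q: "linear_quotient K sc B Z sc' W w"
begin

lemma linear_quotient_diff: "x \<in> Z \<Longrightarrow> y \<in> Z \<Longrightarrow> x - y \<in> Z \<and> w (x - y) = w x - w y"
proof -
  assume "x \<in> Z" "y \<in> Z"
  then have "x - y \<in> Z" "w ((x - y) + y) = w (x - y) + w y"
    using q unfolding linear_quotient_def by blast+
  then show ?thesis by simp
qed

lemma linear_quotient_coset: "z \<in> Z \<Longrightarrow> (\<lambda>b. z + b) ` B = {y \<in> Z. w y = w z}"
proof (intro equalityI subsetI)
  fix y assume z: "z \<in> Z" and y: "y \<in> {y \<in> Z. w y = w z}"
  then have "y - z \<in> B"
    using q linear_quotient_diff[of y z] by (simp add: linear_quotient_def)
  moreover have "y = z + (y - z)" by simp
  ultimately show "y \<in> (\<lambda>b. z + b) ` B" by (rule rev_image_eqI)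
next
  fix y assume "z \<in> Z" "y \<in> (\<lambda>b. z + b) ` B"
  then show "y \<in> {y \<in> Z. w y = w z}"
    using q by (auto simp: linear_quotient_def)
qed

lemma linear_quotient_lin_comb:
  assumes "set vs \<subseteq> Z" "set ks \<subseteq> K" "length ks = length vs"
  shows "lin_comb sc ks vs \<in> Z \<and> w (lin_comb sc ks vs) = lin_comb sc' ks (map w vs)"
proof -
  have z: "0 \<in> Z" "w 0 = 0"
    using q linear_quotient_diff[of 0 0] by (auto simp: linear_quotient_def)
  have "(\<Sum>i<k. sc (ks ! i) (vs ! i)) \<in> Z \<and>
      w (\<Sum>i<k. sc (ks ! i) (vs ! i)) = (\<Sum>i<k. sc' (ks ! i) (map w vs ! i))"
    if "k \<le> length vs" for k
    using that
  proof (induction k)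
    case (Suc k)
    moreover have "vs ! k \<in> Z" "ks ! k \<in> K"
      using assms Suc.prems by auto
    ultimately show ?case
      using q by (simp add: linear_quotient_def)
  qed (use z in auto)
  from this[of "length vs"] show ?thesis
    by (simp add: lin_comb_def)
qed

lemma linear_quotient_basis:
  assumes "set vs \<subseteq> Z"
  shows "basis_modulo K sc B Z vs \<longleftrightarrow> basis_of K sc' W (map w vs)"
proof -
  have *: "z - lin_comb sc ks vs \<in> B \<longleftrightarrow> w z - lin_comb sc' ks (map w vs) \<in> {0}"
    if "z \<in> Z" "length ks = length vs" "set ks \<subseteq> K" for z ks
    using q linear_quotient_lin_comb[OF assms that(3,2)] linear_quotient_diff[OF that(1)]
    by (auto simp: linear_quotient_def)
  have W: "W = w ` Z"
    using q by (simp add: linear_quotient_def)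
  have "(\<exists>!ks. length ks = length vs \<and> set ks \<subseteq> K \<and> z - lin_comb sc ks vs \<in> B) \<longleftrightarrow>
     (\<exists>!ks. length ks = length (map w vs) \<and> set ks \<subseteq> K \<and> w z - lin_comb sc' ks (map w vs) \<in> {0})"
    if "z \<in> Z" for z
    using *[OF that] by (intro arg_cong[where f = Ex1] ext) auto
  then show ?thesis
    using assms unfolding basis_modulo_def W by auto
qed

end

lemma linear_quotient_cohomology_iso:
  assumes q: "linear_quotient K sc (coboundaries C \<delta> i) (cocycles C \<delta> i) sc' W w"
  shows "cohomology_iso K sc C \<delta> i sc' W"
  unfolding cohomology_iso_def
proof (intro exI conjI ballI)
  let ?Z = "cocycles C \<delta> i" and ?f = "\<lambda>X. w (SOME z. z \<in> X)"
  have cl: "coh_class C \<delta> i z = {y \<in> ?Z. w y = w z}" if "z \<in> ?Z" for z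
    using linear_quotient_coset[OF q that] by (simp add: coh_class_def)
  have f: "?f (coh_class C \<delta> i z) = w z" if "z \<in> ?Z" for z
    using someI[of "\<lambda>y. y \<in> ?Z \<and> w y = w z" z] that by (simp add: cl)
  have W: "w ` ?Z = W" and sum: "\<And>x y. x \<in> ?Z \<Longrightarrow> y \<in> ?Z \<Longrightarrow> x + y \<in> ?Z \<and> w (x + y) = w x + w y"
    and scale: "\<And>k x. k \<in> K \<Longrightarrow> x \<in> ?Z \<Longrightarrow> sc k x \<in> ?Z \<and> w (sc k x) = sc' k (w x)"
    using q by (simp_all add: linear_quotient_def)
  show "bij_betw ?f (cohomology C \<delta> i) W"
    unfolding bij_betw_def
  proof
    show "inj_on ?f (cohomology C \<delta> i)"
    proof (rule inj_onI)
      fix X Y assume "X \<in> cohomology C \<delta> i" "Y \<in> cohomology C \<delta> i" and eq: "?f X = ?f Y"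
      then obtain x y where xy: "x \<in> ?Z" "y \<in> ?Z" "X = coh_class C \<delta> i x" "Y = coh_class C \<delta> i y"
        unfolding cohomology_def by blast
      then show "X = Y"
        using eq f[OF xy(1)] f[OF xy(2)] cl[OF xy(1)] cl[OF xy(2)] by simp
    qed
    show "?f ` cohomology C \<delta> i = W"
      unfolding cohomology_def image_image W[symmetric] by (intro image_cong) (auto simp: f)
  qed
  show "?f (coh_class C \<delta> i (x + y)) = ?f (coh_class C \<delta> i x) + ?f (coh_class C \<delta> i y)"
    if "x \<in> ?Z" "y \<in> ?Z" for x y
    using that sum by (simp add: f)
  show "?f (coh_class C \<delta> i (sc k x)) = sc' k (?f (coh_class C \<delta> i x))"
    if "k \<in> K" "x \<in> ?Z" for k x
    using that scale by (simp add: f)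
qed

section \<open>The plane over a subfield\<close>

text \<open>
  Dimension two is small enough to treat linear independence through this one alternating form.
\<close>

definition det2 :: "complex ^ 2 \<Rightarrow> complex ^ 2 \<Rightarrow> complex" where
  "det2 v w = v $ 1 * w $ 2 - v $ 2 * w $ 1"

lemma vec2_eq_iff: "v = w \<longleftrightarrow> v $ 1 = w $ 1 \<and> v $ 2 = w $ 2"
  for v w :: "complex ^ 2"
  by (simp add: Finite_Cartesian_Product.vec_eq_iff forall_2)

lemma mult2_nth: "(M *v v) $ i = M $ i $ 1 * v $ 1 + M $ i $ 2 * v $ 2"
  for M :: "complex ^ 2 ^ 2"
  by (simp add: matrix_vector_mult_def sum_2)

lemma mem_plane: "v \<in> plane K \<longleftrightarrow> v $ 1 \<in> K \<and> v $ 2 \<in> K"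
  by (simp add: plane_def forall_2)

lemma lin_comb_2: "lin_comb sc [a, b] [v, w] = sc a v + sc b w"
  by (simp add: lin_comb_def numeral_2_eq_2 lessThan_Suc add.commute)

context
  fixes K :: "complex set"
  assumes K: "is_subfield K"
begin

lemma plane_closed:
  "0 \<in> plane K" "v \<in> plane K \<Longrightarrow> w \<in> plane K \<Longrightarrow> v + w \<in> plane K"
  "v \<in> plane K \<Longrightarrow> w \<in> plane K \<Longrightarrow> v - w \<in> plane K"
  "v \<in> plane K \<Longrightarrow> - v \<in> plane K"
  "k \<in> K \<Longrightarrow> v \<in> plane K \<Longrightarrow> k *s v \<in> plane K"
  "(\<And>i j. M $ i $ j \<in> K) \<Longrightarrow> v \<in> plane K \<Longrightarrow> M *v v \<in> plane K"
  "axis i 1 \<in> plane K"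
  by (auto simp: mem_plane mult2_nth axis_def intro!: subfield_closed[OF K])

text \<open>
  Dimension is invariant by a trace argument.  Let \<open>V\<close> be the matrix with columns \<open>vs\<close> and let the
  columns of \<open>N\<close> be the coordinates of the two unit vectors.  Existence of coordinates gives
  \<open>V N = 1\<close>, their uniqueness gives \<open>N V = 1\<close>, and the traces of \<open>V N\<close> and \<open>N V\<close> agree.
\<close>

lemma basis_plane_length:
  assumes b: "basis_of K (*s) (plane K) vs"
  shows "length vs = 2"
proof -
  let ?k = "length vs"
  have vs: "set vs \<subseteq> plane K"
    and ex1: "\<And>z. z \<in> plane K \<Longrightarrow>
      \<exists>!ks. length ks = ?k \<and> set ks \<subseteq> K \<and> z - lin_comb (*s) ks vs \<in> {0}"
    using b unfolding basis_modulo_def by blast+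
  have uniq: "ks = ks'"
    if "z \<in> plane K" "length ks = ?k \<and> set ks \<subseteq> K \<and> z - lin_comb (*s) ks vs \<in> {0}"
      "length ks' = ?k \<and> set ks' \<subseteq> K \<and> z - lin_comb (*s) ks' vs \<in> {0}" for z ks ks'
    using ex1[OF that(1)] that(2,3) by blast
  have "\<forall>i. \<exists>ks. length ks = ?k \<and> set ks \<subseteq> K \<and> axis i 1 = lin_comb (*s) ks vs"
  proof
    fix i :: 2
    show "\<exists>ks. length ks = ?k \<and> set ks \<subseteq> K \<and> axis i 1 = lin_comb (*s) ks vs"
      using ex1[OF plane_closed(7)[of i]] by auto
  qed
  then obtain N where N: "\<And>i. length (N i) = ?k" "\<And>i. set (N i) \<subseteq> K"
      "\<And>i. axis i 1 = lin_comb (*s) (N i) vs"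
    by metis
  have NK: "N i ! p \<in> K" if "p < ?k" for i p
    using N(1,2)[of i] that by auto
  \<comment> \<open>The diagonal entries of \<open>N V\<close>: column \<open>j\<close> of \<open>N V\<close> and the unit vector \<open>?d\<close> are both
    coordinates of \<open>vs ! j\<close>.\<close>
  have unit: "(\<Sum>i\<in>UNIV. vs ! j $ i * N i ! j) = 1" if j: "j < ?k" for j
  proof -
    let ?c = "map (\<lambda>p. \<Sum>i\<in>UNIV. vs ! j $ i * N i ! p) [0..<?k]"
    let ?d = "map (\<lambda>p. if p = j then 1 else 0) [0..<?k]"
    have vj: "vs ! j \<in> plane K" using vs j by auto
    then have c: "set ?c \<subseteq> K" and d: "set ?d \<subseteq> K"
      using NK by (auto simp: plane_def intro!: subfield_sum[OF K] subfield_closed[OF K])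
    have "vs ! j = (\<Sum>i\<in>UNIV. (vs ! j $ i) *s axis i 1)"
      by (simp add: basis_expansion)
    also have "\<dots> = (\<Sum>i\<in>UNIV. \<Sum>p<?k. (vs ! j $ i * N i ! p) *s vs ! p)"
      by (simp add: N(3) lin_comb_def vec.scale_sum_right)
    also have "\<dots> = lin_comb (*s) ?c vs"
      by (subst sum.swap) (simp add: lin_comb_def vec.scale_sum_left)
    finally have "vs ! j - lin_comb (*s) ?c vs \<in> {0}" by simp
    moreover have "lin_comb (*s) ?d vs = (\<Sum>p<?k. if p = j then vs ! j else 0)"
      unfolding lin_comb_def by (intro sum.cong) auto
    then have "vs ! j - lin_comb (*s) ?d vs \<in> {0}"
      using j by simp
    moreover have "length ?c = ?k" "length ?d = ?k" by simp_all
    ultimately have "?c = ?d"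
      by (intro uniq[OF vj] conjI c d)
    then show ?thesis using j by auto
  qed
  have "of_nat ?k = (\<Sum>j<?k. \<Sum>i\<in>UNIV. vs ! j $ i * N i ! j)"
    by (simp add: unit)
  also have "\<dots> = (\<Sum>i\<in>UNIV. lin_comb (*s) (N i) vs $ i)"
    by (subst sum.swap) (simp add: lin_comb_def mult.commute)
  also have "\<dots> = (\<Sum>i\<in>(UNIV::2 set). axis i 1 $ i)"
    using N(3) by simp
  finally have "(of_nat ?k :: complex) = of_nat 2"
    by (simp add: sum_2)
  then show ?thesis
    using of_nat_eq_iff by blast
qed

lemma basis_plane_iff:
  "basis_of K (*s) (plane K) vs \<longleftrightarrow>
     (\<exists>v w. vs = [v, w] \<and> v \<in> plane K \<and> w \<in> plane K \<and> det2 v w \<noteq> 0)"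
proof
  assume b: "basis_of K (*s) (plane K) vs"
  then have "length vs = 2" by (rule basis_plane_length)
  then obtain v w where vs: "vs = [v, w]"
    by (auto simp: numeral_2_eq_2 length_Suc_conv)
  have rep: "\<exists>a b. axis i 1 = a *s v + b *s w" for i :: 2
  proof -
    have "\<exists>!ks. length ks = length vs \<and> set ks \<subseteq> K \<and> axis i 1 - lin_comb (*s) ks vs \<in> {0}"
      using b plane_closed(7)[of i] unfolding basis_modulo_def by blast
    then obtain ks where ks: "length ks = length vs" "axis i 1 = lin_comb (*s) ks vs"
      by auto
    then obtain a b where "ks = [a, b]"
      by (auto simp: vs length_Suc_conv)
    then show ?thesis
      using ks by (auto simp: vs lin_comb_2)
  qed
  obtain a b where ab: "axis 1 1 = a *s v + b *s w" using rep by blast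
  obtain c d where cd: "axis 2 1 = c *s v + d *s w" using rep by blast
  have "det2 (axis 1 1) (axis 2 1) = 1"
    by (simp add: det2_def axis_def)
  then have "(a * d - b * c) * det2 v w = 1"
    unfolding ab cd by (simp add: det2_def algebra_simps)
  then show "\<exists>v w. vs = [v, w] \<and> v \<in> plane K \<and> w \<in> plane K \<and> det2 v w \<noteq> 0"
    using b vs by (auto simp: basis_modulo_def)
next
  assume "\<exists>v w. vs = [v, w] \<and> v \<in> plane K \<and> w \<in> plane K \<and> det2 v w \<noteq> 0"
  then obtain v w where vs: "vs = [v, w]" "v \<in> plane K" "w \<in> plane K" and D: "det2 v w \<noteq> 0"
    by blast
  have cramer: "z = a *s v + b *s w \<longleftrightarrow> a = det2 z w / det2 v w \<and> b = det2 v z / det2 v w"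
    for z a b
  proof
    assume "z = a *s v + b *s w"
    then have "det2 z w = a * det2 v w" "det2 v z = b * det2 v w"
      by (simp_all add: det2_def algebra_simps)
    then show "a = det2 z w / det2 v w \<and> b = det2 v z / det2 v w"
      using D by simp
  next
    assume "a = det2 z w / det2 v w \<and> b = det2 v z / det2 v w"
    then have ab: "a * det2 v w = det2 z w" "b * det2 v w = det2 v z"
      using D by simp_all
    have "det2 v w *s z = det2 z w *s v + det2 v z *s w"
      unfolding vec2_eq_iff by (simp add: det2_def algebra_simps)
    also have "\<dots> = det2 v w *s (a *s v + b *s w)"
      unfolding ab[symmetric] by (simp add: vec.scale_right_distrib mult.commute)
    finally have "det2 v w *s z = det2 v w *s (a *s v + b *s w)" .
    then show "z = a *s v + b *s w"
      using D by (simp only: vec.scale_cancel_left simp_thms)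
  qed
  have "\<exists>!ks. length ks = length vs \<and> set ks \<subseteq> K \<and> z - lin_comb (*s) ks vs \<in> {0}"
    if z: "z \<in> plane K" for z
  proof (intro ex1I[of _ "[det2 z w / det2 v w, det2 v z / det2 v w]"])
    have "det2 z w / det2 v w \<in> K" "det2 v z / det2 v w \<in> K"
      using vs z unfolding det2_def mem_plane by (auto intro!: subfield_closed[OF K])
    then show "length [det2 z w / det2 v w, det2 v z / det2 v w] = length vs \<and>
        set [det2 z w / det2 v w, det2 v z / det2 v w] \<subseteq> K \<and>
        z - lin_comb (*s) [det2 z w / det2 v w, det2 v z / det2 v w] vs \<in> {0}"
      using cramer[of z] by (simp add: vs lin_comb_2)
  next
    fix ks assume ks: "length ks = length vs \<and> set ks \<subseteq> K \<and> z - lin_comb (*s) ks vs \<in> {0}"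
    then obtain a b where "ks = [a, b]"
      by (auto simp: vs(1) length_Suc_conv)
    then show "ks = [det2 z w / det2 v w, det2 v z / det2 v w]"
      using ks cramer[of z a b] by (simp add: vs(1) lin_comb_2)
  qed
  then show "basis_of K (*s) (plane K) vs"
    using vs unfolding basis_modulo_def by simp
qed

end

section \<open>Determinants of block matrices\<close>

lemma det_mat_Suc:
  "Determinant.det (mat (Suc k) (Suc k) f) = (\<Sum>i<Suc k. f (i, 0) * ((-1) ^ i *
     Determinant.det (mat k k (\<lambda>(i', j). f (if i' < i then i' else Suc i', Suc j)))))"
proof -
  have "Determinant.det (mat (Suc k) (Suc k) f) = (\<Sum>i<Suc k. f (i, 0) * cofactor (mat (Suc k) (Suc k) f) i 0)"
    by (subst laplace_expansion_column[of _ "Suc k" 0]) auto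
  also have "\<dots> = (\<Sum>i<Suc k. f (i, 0) * ((-1) ^ i *
     Determinant.det (mat k k (\<lambda>(i', j). f (if i' < i then i' else Suc i', Suc j)))))"
  proof (rule sum.cong[OF HOL.refl])
    fix i assume "i \<in> {..<Suc k}"
    then have "mat_delete (mat (Suc k) (Suc k) f) i 0
        = mat k k (\<lambda>(i', j). f (if i' < i then i' else Suc i', Suc j))"
      by (intro eq_matI) (auto simp: mat_delete_def)
    then show "f (i, 0) * cofactor (mat (Suc k) (Suc k) f) i 0 = f (i, 0) * ((-1) ^ i *
        Determinant.det (mat k k (\<lambda>(i', j). f (if i' < i then i' else Suc i', Suc j))))"
      by (simp add: cofactor_def)
  qed
  finally show ?thesis .
qed

lemma det_mat_0: "Determinant.det (mat 0 0 f) = 1"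
  by (simp add: det_dim_zero)

lemma det_mat_2: "Determinant.det (mat 2 2 f) = f (0, 0) * f (1, 1) - f (0, 1) * f (1, 0)"
  by (simp add: numeral_2_eq_2 det_mat_Suc det_mat_0 lessThan_Suc algebra_simps)

text \<open>
  A cochain on two cells with values in the plane is a column of height four.  The determinant
  takes such columns as pairs of vectors.
\<close>

definition block_det :: "((complex ^ 2) \<times> (complex ^ 2)) list \<Rightarrow> complex" where
  "block_det cs = Determinant.det (mat 4 4 (\<lambda>(j, i).
     [fst (cs ! i) $ 1, fst (cs ! i) $ 2, snd (cs ! i) $ 1, snd (cs ! i) $ 2] ! j))"

text \<open>
  Laplace expansion along the two upper rows, with complementary minors in the two lower rows.
\<close>

lemma block_det_expand:
  "block_det [(x1, y1), (x2, y2), (x3, y3), (x4, y4)] =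
     det2 x1 x2 * det2 y3 y4 - det2 x1 x3 * det2 y2 y4 + det2 x1 x4 * det2 y2 y3
   + det2 x2 x3 * det2 y1 y4 - det2 x2 x4 * det2 y1 y3 + det2 x3 x4 * det2 y1 y2"
  unfolding block_det_def
  by (simp add: eval_nat_numeral det_mat_Suc det_mat_0 lessThan_Suc det2_def[unfolded eval_nat_numeral])
     (simp add: det2_def algebra_simps)

lemma det2_mult: "det2 (P *v v) (P *v w) = Determinants.det P * det2 v w"
  by (simp add: det2_def mult2_nth Determinants.det_2 algebra_simps)

text \<open>
  The matrix is the product of the block triangular matrices with rows \<open>P, 0 | Q, 1\<close> and
  \<open>(t1 t2), (v1 v2) | 0, (w1 w2)\<close>.
\<close>

lemma block_det_column_op:
  "block_det [(P *v t1, Q *v t1), (P *v t2, Q *v t2), (P *v v1, Q *v v1 + w1), (P *v v2, Q *v v2 + w2)]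
     = Determinants.det P * (det2 t1 t2 * det2 w1 w2)"
  unfolding block_det_expand det2_mult
  by (simp add: det2_def mult2_nth Determinants.det_2 algebra_simps)

text \<open>
  Multiplication from the left by the block matrix with rows \<open>1, 0 | Q, P\<close> leaves a block upper
  triangular matrix.
\<close>

lemma block_det_row_op:
  assumes "Q *v x1 + P *v y1 = 0" "Q *v x2 + P *v y2 = 0"
  shows "Determinants.det P * block_det [(x1, y1), (x2, y2), (x3, y3), (x4, y4)]
     = det2 x1 x2 * det2 (Q *v x3 + P *v y3) (Q *v x4 + P *v y4)"
proof -
  have "Determinants.det P * block_det [(x1, y1), (x2, y2), (x3, y3), (x4, y4)]
     = block_det [(x1, Q *v x1 + P *v y1), (x2, Q *v x2 + P *v y2),
         (x3, Q *v x3 + P *v y3), (x4, Q *v x4 + P *v y4)]"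
  proof -
    have "Determinants.det P * block_det [(x1, y1), (x2, y2), (x3, y3), (x4, y4)]
       = block_det [(x1, P *v y1), (x2, P *v y2), (x3, P *v y3), (x4, P *v y4)]"
      unfolding block_det_expand det2_mult by (simp add: algebra_simps)
    also have "\<dots> = block_det [(x1, Q *v x1 + P *v y1), (x2, Q *v x2 + P *v y2),
         (x3, Q *v x3 + P *v y3), (x4, Q *v x4 + P *v y4)]"
      unfolding block_det_expand
      by (simp add: det2_def mult2_nth[of Q] algebra_simps)
    finally show ?thesis .
  qed
  then show ?thesis
    unfolding assms by (simp add: block_det_expand det2_def)
qed

section \<open>Special unitary matrices\<close>

lemma mat2_eq_iff:
  "M = N \<longleftrightarrow> M $ 1 $ 1 = N $ 1 $ 1 \<and> M $ 1 $ 2 = N $ 1 $ 2 \<and> M $ 2 $ 1 = N $ 2 $ 1 \<and> M $ 2 $ 2 = N $ 2 $ 2"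
  for M N :: "complex ^ 2 ^ 2"
  by (simp add: Finite_Cartesian_Product.vec_eq_iff forall_2 conj_assoc)

lemma mat2_mult_nth: "(M ** N) $ i $ j = M $ i $ 1 * N $ 1 $ j + M $ i $ 2 * N $ 2 $ j"
  for M N :: "complex ^ 2 ^ 2"
  by (simp add: matrix_matrix_mult_def sum_2)

lemma mat2_one_nth:
  "(Finite_Cartesian_Product.mat 1 :: complex ^ 2 ^ 2) $ i $ j = (if i = j then 1 else 0)"
  by (simp add: Finite_Cartesian_Product.mat_def)

lemma linear_mult2: "linear ((*v) M)" for M :: "complex ^ 2 ^ 2"
  by (rule linearI) (simp_all add: vec2_eq_iff mult2_nth algebra_simps)

lemma SU2_entries:
  assumes "M \<in> carrier SU2"
  shows "M $ 2 $ 2 = cnj (M $ 1 $ 1)" "M $ 1 $ 2 = - cnj (M $ 2 $ 1)"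
    "M $ 1 $ 1 * cnj (M $ 1 $ 1) + M $ 2 $ 1 * cnj (M $ 2 $ 1) = 1"
proof -
  obtain a b c d where e: "a = M $ 1 $ 1" "b = M $ 1 $ 2" "c = M $ 2 $ 1" "d = M $ 2 $ 2"
    by simp
  have u: "adjoint_mat M ** M = Finite_Cartesian_Product.mat 1" and det: "a * d - b * c = 1"
    using assms by (simp_all add: SU2_def e Determinants.det_2)
  have 1: "cnj a * a + cnj c * c = 1"
    using u[unfolded mat2_eq_iff] by (simp add: mat2_mult_nth mat2_one_nth adjoint_mat_def e)
  have 2: "cnj a * b + cnj c * d = 0"
    using u[unfolded mat2_eq_iff] by (simp add: mat2_mult_nth mat2_one_nth adjoint_mat_def e)
  \<comment> \<open>Insert the squared norm 1 of the first column, then use the orthogonality of the columns.\<close>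
  have "d = (cnj a * a + cnj c * c) * d"
    by (simp add: 1)
  also have "\<dots> = cnj a * (a * d - b * c) + c * (cnj a * b + cnj c * d)"
    by (simp add: algebra_simps)
  finally have "d = cnj a"
    by (simp add: det 2)
  have "b = (cnj a * a + cnj c * c) * b"
    by (simp add: 1)
  also have "\<dots> = a * (cnj a * b + cnj c * d) - cnj c * (a * d - b * c)"
    by (simp add: algebra_simps)
  finally have "b = - cnj c"
    by (simp add: det 2)
  show "M $ 2 $ 2 = cnj (M $ 1 $ 1)" "M $ 1 $ 2 = - cnj (M $ 2 $ 1)"
    "M $ 1 $ 1 * cnj (M $ 1 $ 1) + M $ 2 $ 1 * cnj (M $ 2 $ 1) = 1"
    using \<open>d = cnj a\<close> \<open>b = - cnj c\<close> 1 by (simp_all add: e mult.commute)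
qed

lemma SU2_psi:
  assumes "M \<in> carrier SU2"
  shows "psi (M *v v) (M *v w) = psi v w"
proof -
  note e = SU2_entries[OF assms]
  have "psi (M *v v) (M *v w) =
    (M $ 1 $ 1 * cnj (M $ 1 $ 1) + M $ 2 $ 1 * cnj (M $ 2 $ 1)) * psi v w"
    by (simp add: psi_def sum_2 mult2_nth e(1,2) algebra_simps)
  then show ?thesis by (simp add: e(3))
qed

text \<open>
  The determinant of \<open>1 - M\<close> vanishes, so the trace of \<open>M\<close> is 2.  As the diagonal entries are
  conjugate to each other, their real part is 1, and a column of norm 1 has no room for anything
  else.
\<close>

lemma SU2_fixed_vector:
  assumes M: "M \<in> carrier SU2" and v: "M *v v = v" "v \<noteq> 0"
  shows "M = Finite_Cartesian_Product.mat 1"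
proof -
  obtain a c where e: "a = M $ 1 $ 1" "c = M $ 2 $ 1" by simp
  note M' = SU2_entries[OF M, folded e]
  have 1: "(a - 1) * v $ 1 = cnj c * v $ 2" and 2: "(cnj a - 1) * v $ 2 = - c * v $ 1"
    using v(1) M' by (simp_all add: vec2_eq_iff mult2_nth e[symmetric] algebra_simps)
  have "((a - 1) * (cnj a - 1) + cnj c * c) * v $ 1 = (cnj a - 1) * (a - 1) * v $ 1 + cnj c * (c * v $ 1)"
    by (simp add: algebra_simps)
  also have "\<dots> = (cnj a - 1) * ((a - 1) * v $ 1) - cnj c * ((cnj a - 1) * v $ 2)"
    by (simp only: 2) (simp add: algebra_simps)
  also have "\<dots> = 0"
    by (simp only: 1) (simp add: algebra_simps)
  finally have d1: "((a - 1) * (cnj a - 1) + cnj c * c) * v $ 1 = 0" .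
  have "((a - 1) * (cnj a - 1) + cnj c * c) * v $ 2 = (a - 1) * ((cnj a - 1) * v $ 2) + c * (cnj c * v $ 2)"
    by (simp add: algebra_simps)
  also have "\<dots> = 0"
    by (simp only: 2 1[symmetric]) (simp add: algebra_simps)
  finally have d2: "((a - 1) * (cnj a - 1) + cnj c * c) * v $ 2 = 0" .
  have "v $ 1 \<noteq> 0 \<or> v $ 2 \<noteq> 0"
    using v(2) by (auto simp: vec2_eq_iff)
  then have "(a - 1) * (cnj a - 1) + cnj c * c = 0"
    using d1 d2 by auto
  then have "a + cnj a = 2"
    using M'(3) by (simp add: algebra_simps)
  then have re: "Re a = 1"
    by (simp add: complex_eq_iff)
  have "(Re a)\<^sup>2 + (Im a)\<^sup>2 + (Re c)\<^sup>2 + (Im c)\<^sup>2 = 1"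
    using M'(3) by (simp add: complex_eq_iff power2_eq_square)
  then have "(Im a)\<^sup>2 + (Re c)\<^sup>2 + (Im c)\<^sup>2 = 0"
    by (simp add: re)
  then have "Im a = 0 \<and> Re c = 0 \<and> Im c = 0"
    by (smt (verit) power2_less_0 zero_eq_power2)
  then have "a = 1" "c = 0"
    using re by (simp_all add: complex_eq_iff)
  then show ?thesis
    using M' by (simp add: mat2_eq_iff mat2_one_nth e[symmetric])
qed

lemma psi_add_left: "psi (u + v) w = psi u w + psi v w"
  and psi_add_right: "psi u (v + w) = psi u v + psi u w"
  and psi_minus_left: "psi (- u) w = - psi u w"
  and psi_diff_left: "psi (u - v) w = psi u w - psi v w"
  and psi_diff_right: "psi u (v - w) = psi u v - psi u w"
  and psi_zero_left: "psi 0 w = 0"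
  and psi_zero_right: "psi u 0 = 0"
  by (simp_all add: psi_def sum_2 algebra_simps)

lemma linear_psi_left: "linear (\<lambda>u. psi u w)" and linear_psi_right: "linear (psi u)"
  by (rule linearI; simp add: psi_def sum_2 algebra_simps)+

section \<open>Crossed homomorphisms and Fox derivatives\<close>

text \<open>
  Closure of \<open>F\<close> under conjugation enters through the sesquilinear form: the coordinates of a dual
  basis involve conjugates.
\<close>

locale twisted_coefficients =
  fixes l m n :: nat and F :: "complex set" and \<rho> :: "word set \<Rightarrow> complex ^ 2 ^ 2"
  assumes subfield: "is_subfield F"
    and cnj_closed: "\<And>x. x \<in> F \<Longrightarrow> cnj x \<in> F"
    and hom_SU2: "\<rho> \<in> hom (pi1 l m n) SU2"
    and hom_SL2: "\<rho> \<in> hom (pi1 l m n) (SL2 F)"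
    and irreducible: "irreducible_rep (pi1 l m n) \<rho>"
    and diagonal: "\<rho> (word_class l m n [(Gen_g, True)]) $ 1 $ 2 = 0"
      "\<rho> (word_class l m n [(Gen_g, True)]) $ 2 $ 1 = 0"
    and not_one: "\<rho> (word_class l m n [(Gen_g, True)]) $ 1 $ 1 \<noteq> 1"
    and power_one: "(\<rho> (word_class l m n [(Gen_g, True)]) $ 1 $ 1) ^ l = 1"
begin

abbreviation G where "G \<equiv> pi1 l m n"
abbreviation rep :: "word \<Rightarrow> complex ^ 2 ^ 2" where "rep w \<equiv> \<rho> (word_class l m n w)"
abbreviation A where "A \<equiv> rep [(Gen_g, True)]"
abbreviation B where "B \<equiv> rep [(Gen_h, True)]"
abbreviation one_mat :: "complex ^ 2 ^ 2" where "one_mat \<equiv> Finite_Cartesian_Product.mat 1"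

lemma rep_SU2: "x \<in> carrier G \<Longrightarrow> \<rho> x \<in> carrier SU2"
  using hom_SU2 by (auto simp: hom_def)

lemma rep_entry: "x \<in> carrier G \<Longrightarrow> \<rho> x $ i $ j \<in> F"
  using hom_SL2 by (auto simp: hom_def SL2_def)

lemma rep_det: "x \<in> carrier G \<Longrightarrow> Determinants.det (\<rho> x) = 1"
  using rep_SU2 by (auto simp: SU2_def)

lemma rep_mult: "x \<in> carrier G \<Longrightarrow> y \<in> carrier G \<Longrightarrow> \<rho> (x \<otimes>\<^bsub>G\<^esub> y) = \<rho> x ** \<rho> y"
  using hom_SU2 by (auto simp: hom_def SU2_def)

lemma rep_append: "rep (u @ v) = rep u ** rep v"
  using rep_mult[of "word_class l m n u" "word_class l m n v"] by simp

lemma rep_Cons: "rep (x # v) = rep [x] ** rep v"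
  using rep_append[of "[x]" v] by simp

lemma rep_inj: "rep w *v v = rep w *v v' \<Longrightarrow> v = v'"
proof -
  assume "rep w *v v = rep w *v v'"
  moreover have "invertible (rep w)"
    by (simp add: invertible_det_nz rep_det)
  ultimately show ?thesis
    by (metis invertible_def matrix_vector_mul_assoc matrix_vector_mul_lid)
qed

lemma rep_Nil: "rep [] = one_mat"
proof -
  have "rep [] *v (rep [] *v v) = rep [] *v v" for v
    using rep_append[of "[]" "[]"] by (simp add: matrix_vector_mul_assoc)
  then have "rep [] *v v = v" for v
    using rep_inj by blast
  then show ?thesis
    by (simp add: matrix_eq)
qed

lemma rep_one: "\<rho> \<one>\<^bsub>G\<^esub> = one_mat"
  by (simp add: pi1_one rep_Nil)

lemma rep_word_eq: "word_eq l m n u v \<Longrightarrow> rep u = rep v"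
  by (simp add: word_class_eq_iff[symmetric])

lemma rep_inverse: "rep [(a, b)] ** rep [(a, \<not> b)] = one_mat"
  using rep_mult[of "word_class l m n [(a, b)]" "word_class l m n [(a, \<not> b)]"]
  by (simp add: word_class_inverse rep_one del: pi1_mult)

lemma rep_inverse_fixed:
  assumes "rep [(a, False)] *v v = v"
  shows "rep [(a, True)] *v v = v"
proof -
  have "rep [(a, True)] *v (rep [(a, False)] *v v) = v"
    using rep_inverse[of a True] by (simp add: matrix_vector_mul_assoc)
  then show ?thesis by (simp add: assms)
qed

lemma A_nth: "A $ 1 $ 2 = 0" "A $ 2 $ 1 = 0" "A $ 1 $ 1 * A $ 2 $ 2 = 1"
  using diagonal rep_det[of "word_class l m n [(Gen_g, True)]"]
  by (simp_all add: Determinants.det_2)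

lemma A_fixed: "A *v v = v \<Longrightarrow> v = 0"
proof -
  assume v: "A *v v = v"
  have "A \<noteq> one_mat"
    using not_one by (auto simp: mat2_eq_iff mat2_one_nth)
  then show "v = 0"
    using SU2_fixed_vector[OF rep_SU2[OF word_class_in_pi1] v] by blast
qed

text \<open>
  Otherwise both generators, and with them all of the image of \<open>\<rho>\<close>, are upper triangular and
  preserve the line through the first unit vector.
\<close>

lemma B_not_triangular: "B $ 2 $ 1 \<noteq> 0"
proof
  assume B: "B $ 2 $ 1 = 0"
  have T: "rep [(a, True)] $ 2 $ 1 = 0" for a
    using B A_nth by (cases a) auto
  have "rep [(a, False)] $ 2 $ 1 = 0" for a
  proof -
    have "Determinants.det (rep [(a, True)]) = 1"
      by (simp add: rep_det)
    then have "rep [(a, True)] $ 2 $ 2 \<noteq> 0"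
      using T[of a] by (auto simp: Determinants.det_2)
    moreover have "rep [(a, True)] $ 2 $ 2 * rep [(a, False)] $ 2 $ 1 = 0"
      using rep_inverse[of a True, unfolded mat2_eq_iff] T[of a]
      by (simp add: mat2_mult_nth mat2_one_nth)
    ultimately show ?thesis by simp
  qed
  then have letter: "rep [(a, b)] $ 2 $ 1 = 0" for a b
    using T by (cases b) auto
  have word: "rep w $ 2 $ 1 = 0" for w
  proof (induction w)
    case Nil
    then show ?case by (simp add: rep_Nil mat2_one_nth)
  next
    case (Cons x w)
    then show ?case
      using letter[of "fst x" "snd x"] by (simp add: rep_Cons[of x w] mat2_mult_nth)
  qed
  let ?W = "{v :: complex ^ 2. v $ 2 = 0}"
  have "vec.subspace ?W"
    by (simp add: vec.subspace_def)
  moreover have "\<forall>x\<in>carrier G. \<forall>w\<in>?W. \<rho> x *v w \<in> ?W"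
    using word by (auto elim!: pi1_cases simp: mult2_nth)
  ultimately have "?W = {0} \<or> ?W = UNIV"
    using irreducible unfolding irreducible_rep_def by blast
  moreover have "axis 1 1 \<in> ?W" "(axis 1 1 :: complex ^ 2) \<noteq> 0" "(axis 2 1 :: complex ^ 2) \<notin> ?W"
    by (simp_all add: axis_def vec2_eq_iff)
  ultimately show False by blast
qed

text \<open>
  A unitary matrix of determinant one with a fixed vector is trivial.  If one of these words had
  trivial image, then \<open>B\<close> would be trivial or inverse to the diagonal matrix \<open>A\<close>, hence diagonal.
\<close>

lemma no_fixed_vector:
  assumes "w \<in> {[(Gen_g, False)], [(Gen_h, True)], [(Gen_h, False)],
      [(Gen_g, True), (Gen_h, True)], [(Gen_h, True), (Gen_g, True)]}"
    and v: "rep w *v v = v"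
  shows "v = 0"
proof (rule ccontr)
  assume "v \<noteq> 0"
  note one = SU2_fixed_vector[OF rep_SU2[OF word_class_in_pi1] _ this]
  have "(B $ 2 $ 1 = 0)"
  proof -
    consider "A *v v = v" | "B *v v = v" | "A ** B = one_mat" | "B ** A = one_mat"
      using assms one[of w] rep_inverse_fixed rep_append[of "[(Gen_g, True)]" "[(Gen_h, True)]"]
        rep_append[of "[(Gen_h, True)]" "[(Gen_g, True)]"] by auto
    then show ?thesis
    proof cases
      case 1
      then show ?thesis using A_fixed \<open>v \<noteq> 0\<close> by blast
    next
      case 2
      then show ?thesis
        using one[of "[(Gen_h, True)]"] by (simp add: mat2_one_nth)
    next
      case 3
      then have "(A ** B) $ 2 $ 1 = 0"
        by (simp add: mat2_one_nth)
      then show ?thesis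
        using A_nth by (auto simp: mat2_mult_nth)
    next
      case 4
      then have "(B ** A) $ 2 $ 1 = 0"
        by (simp add: mat2_one_nth)
      then show ?thesis
        using A_nth by (auto simp: mat2_mult_nth)
    qed
  qed
  then show False
    using B_not_triangular by blast
qed

lemma rep_power_g: "rep (word_power [(Gen_g, True)] l) = one_mat"
proof -
  have "rep (word_power [(Gen_g, True)] k) $ 1 $ 1 = (A $ 1 $ 1) ^ k \<and>
     rep (word_power [(Gen_g, True)] k) $ 1 $ 2 = 0 \<and>
     rep (word_power [(Gen_g, True)] k) $ 2 $ 1 = 0" for k
  proof (induction k)
    case 0
    then show ?case by (simp add: rep_Nil mat2_one_nth)
  next
    case (Suc k)
    then show ?case
      by (simp add: word_power_Suc rep_Cons[of _ "word_power _ _"] mat2_mult_nth A_nth)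
  qed
  moreover have "Determinants.det (rep (word_power [(Gen_g, True)] l)) = 1"
    by (simp add: rep_det)
  ultimately show ?thesis
    using power_one by (simp add: mat2_eq_iff mat2_one_nth Determinants.det_2)
qed

lemma rep_relator: "rep (relator l m n R) = one_mat"
  using rep_word_eq[OF word_eq.relator[of l m n "[]" R "[]"]] by (simp add: rep_Nil)

text \<open>
  The relations propagate the equation \<open>A\<^sup>l = 1\<close>: the relator \<open>s\<close> turns it into \<open>(BA)\<^sup>n = 1\<close>,
  conjugation by \<open>A\<close> gives \<open>(AB)\<^sup>n = 1\<close>, and the relator \<open>r\<close> gives \<open>B\<^sup>m = 1\<close>.
\<close>

lemma rep_powers:
  "rep (word_power [(Gen_g, False)] l) = one_mat"
  "rep (word_power [(Gen_h, True), (Gen_g, True)] n) = one_mat"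
  "rep (word_power [(Gen_g, True), (Gen_h, True)] n) = one_mat"
  "rep (word_power [(Gen_h, False)] m) = one_mat"
proof -
  show g: "rep (word_power [(Gen_g, False)] l) = one_mat"
    using rep_word_eq[OF word_power_inverse[of l m n Gen_g True l]]
    by (simp add: rep_append rep_Nil rep_power_g)
  show hg: "rep (word_power [(Gen_h, True), (Gen_g, True)] n) = one_mat"
    using rep_relator[of Rel_s] by (simp add: rep_append g)
  let ?gh = "rep (word_power [(Gen_g, True), (Gen_h, True)] n)"
  have "?gh ** A = A ** rep (word_power [(Gen_h, True), (Gen_g, True)] n)"
    using arg_cong[OF word_power_conjugate[of "[(Gen_g, True)]" "[(Gen_h, True)]" n], of rep]
    unfolding rep_append by simp
  then have "?gh ** (A ** rep [(Gen_g, False)]) = A ** rep [(Gen_g, False)]"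
    by (simp add: hg matrix_mul_assoc)
  then show gh: "?gh = one_mat"
    using rep_inverse[of Gen_g True] by simp
  show "rep (word_power [(Gen_h, False)] m) = one_mat"
    using rep_relator[of Rel_r] by (simp add: rep_append gh)
qed

text \<open>
  This forgets the degree and the field of values of a cochain, so that it also applies to the
  composite of a cocycle with a chain homotopy, where nothing is known about the values.
\<close>

definition equivariant :: "cochain \<Rightarrow> bool" where
  "equivariant \<phi> \<longleftrightarrow> (\<forall>x\<in>carrier G. \<forall>y\<in>carrier G. \<forall>c. \<phi> (x \<otimes>\<^bsub>G\<^esub> y, c) = \<rho> x *v \<phi> (y, c))"

lemma equivariant_at:
  assumes "equivariant \<phi>" "x \<in> carrier G"
  shows "\<phi> (x, c) = \<rho> x *v \<phi> (\<one>\<^bsub>G\<^esub>, c)"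
  using assms pi1_mult_one(1)[OF assms(2)] unfolding equivariant_def
  by (metis pi1_one_closed)

lemma keys_translate:
  assumes "x \<in> carrier G" "Poly_Mapping.keys u \<subseteq> carrier G \<times> T"
  shows "Poly_Mapping.keys (translate l m n x u) \<subseteq> carrier G \<times> T"
  using keys_frag_extend[of "\<lambda>(y, c). frag_of (x \<otimes>\<^bsub>G\<^esub> y, c)" u] assms pi1_mult_closed
  unfolding translate_def by (fastforce simp: keys_frag_of)

lemma value_translate:
  assumes "equivariant \<phi>" "x \<in> carrier G" "Poly_Mapping.keys u \<subseteq> carrier G \<times> UNIV"
  shows "chain_value \<phi> (translate l m n x u) = \<rho> x *v chain_value \<phi> u"
proof -
  have "chain_value \<phi> (translate l m n x u) = chain_value (\<lambda>p. \<rho> x *v \<phi> p) u"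
    unfolding translate_def chain_value_extend
    using assms by (intro chain_value_cong) (auto simp: equivariant_def)
  then show ?thesis
    by (simp add: chain_value_linear[OF linear_mult2])
qed

lemma keys_fox: "Poly_Mapping.keys (fox l m n w) \<subseteq> carrier G \<times> range Cell1"
proof (induction w)
  case (Cons x w)
  obtain a b where x: "x = (a, b)" by fastforce
  have 1: "Poly_Mapping.keys (frag_of (\<one>\<^bsub>G\<^esub>, Cell1 a)) \<subseteq> carrier G \<times> range Cell1"
    by (simp add: keys_frag_of)
  show ?case
  proof (cases b)
    case True
    then show ?thesis
      using subset_trans[OF Poly_Mapping.keys_add
          Un_least[OF 1 keys_translate[OF word_class_in_pi1 Cons.IH]]]
      by (simp add: x)
  next
    case False
    have "Poly_Mapping.keys (fox l m n w - frag_of (\<one>\<^bsub>G\<^esub>, Cell1 a)) \<subseteq> carrier G \<times> range Cell1"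
      using subset_trans[OF keys_diff Un_least[OF Cons.IH 1]] .
    then show ?thesis
      using False keys_translate by (simp add: x)
  qed
qed simp

context
  fixes \<phi> :: cochain
  assumes equi: "equivariant \<phi>"
begin

lemma value_fox_Cons:
  "chain_value \<phi> (fox l m n ((a, True) # w))
     = \<phi> (\<one>\<^bsub>G\<^esub>, Cell1 a) + rep [(a, True)] *v chain_value \<phi> (fox l m n w)"
  "chain_value \<phi> (fox l m n ((a, False) # w))
     = rep [(a, False)] *v (chain_value \<phi> (fox l m n w) - \<phi> (\<one>\<^bsub>G\<^esub>, Cell1 a))"
proof -
  have k: "Poly_Mapping.keys (fox l m n w) \<subseteq> carrier G \<times> UNIV"
    using keys_fox[of w] by auto
  then have "Poly_Mapping.keys (fox l m n w - frag_of (\<one>\<^bsub>G\<^esub>, Cell1 a)) \<subseteq> carrier G \<times> UNIV"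
    by (intro subset_trans[OF keys_diff]) (simp add: keys_frag_of)
  then show "chain_value \<phi> (fox l m n ((a, True) # w))
     = \<phi> (\<one>\<^bsub>G\<^esub>, Cell1 a) + rep [(a, True)] *v chain_value \<phi> (fox l m n w)"
    and "chain_value \<phi> (fox l m n ((a, False) # w))
     = rep [(a, False)] *v (chain_value \<phi> (fox l m n w) - \<phi> (\<one>\<^bsub>G\<^esub>, Cell1 a))"
    using k by (simp_all add: chain_value_add chain_value_diff value_translate[OF equi])
qed

text \<open>
  The Fox derivatives are the universal crossed homomorphism on words; applying an equivariant
  function yields a crossed homomorphism with coefficients in \<open>\<rho>\<close>.
\<close>

lemma value_fox_append:
  "chain_value \<phi> (fox l m n (u @ v))
     = chain_value \<phi> (fox l m n u) + rep u *v chain_value \<phi> (fox l m n v)"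
proof (induction u)
  case Nil
  then show ?case by (simp add: rep_Nil)
next
  case (Cons x u)
  obtain a b where "x = (a, b)" by fastforce
  with Cons show ?case
    by (cases b)
       (simp_all add: value_fox_Cons rep_Cons[of "(a, _)" u] matrix_vector_mul_assoc[symmetric]
          matrix_vector_right_distrib matrix_vector_mult_diff_distrib del: fox.simps)
qed

text \<open>
  Write \<open>z\<close> for the value on \<open>w ^ k\<close>.  Expanding the crossed homomorphism on the two
  factorizations of \<open>w ^ (k + 1)\<close>, as \<open>w\<close> times \<open>w ^ k\<close> and the other way round, shows that the image
  of \<open>w\<close> fixes \<open>z\<close>.  This replaces the geometric sum of Fox calculus.
\<close>

lemma value_fox_power:
  assumes "rep (word_power w k) = one_mat" and "\<And>v. rep w *v v = v \<Longrightarrow> v = 0"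
  shows "chain_value \<phi> (fox l m n (word_power w k)) = 0"
proof (rule assms(2))
  let ?z = "\<lambda>w. chain_value \<phi> (fox l m n w)"
  have "?z w + rep w *v ?z (word_power w k) = ?z (word_power w k) + ?z w"
    using arg_cong[OF word_power_commutes[of w k], of ?z]
    unfolding value_fox_append by (simp add: assms(1))
  then show "rep w *v ?z (word_power w k) = ?z (word_power w k)"
    by (simp add: add.commute)
qed

text \<open>
  A relator is a product of two powers on which the crossed homomorphism vanishes.  This is
  why the coboundary from degree 1 to degree 2 is zero, and why every equivariant function defines a
  crossed homomorphism on the fundamental group itself.
\<close>

lemma value_fox_relator: "chain_value \<phi> (fox l m n (relator l m n R)) = 0"
proof -
  let ?z = "\<lambda>w. chain_value \<phi> (fox l m n w)"
  have "?z (word_power [(Gen_g, False)] l) = 0"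
    by (rule value_fox_power[OF rep_powers(1)]) (erule no_fixed_vector[rotated], simp)
  moreover have "?z (word_power [(Gen_h, False)] m) = 0"
    by (rule value_fox_power[OF rep_powers(4)]) (erule no_fixed_vector[rotated], simp)
  moreover have "?z (word_power [(Gen_g, True), (Gen_h, True)] n) = 0"
    by (rule value_fox_power[OF rep_powers(3)]) (erule no_fixed_vector[rotated], simp)
  moreover have "?z (word_power [(Gen_h, True), (Gen_g, True)] n) = 0"
    by (rule value_fox_power[OF rep_powers(2)]) (erule no_fixed_vector[rotated], simp)
  ultimately show ?thesis
    by (cases R) (simp_all add: value_fox_append)
qed

lemma value_fox_word_eq:
  "word_eq l m n u v \<Longrightarrow> chain_value \<phi> (fox l m n u) = chain_value \<phi> (fox l m n v)"
proof (induction rule: word_eq.induct)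
  case (cancel u a b v)
  let ?z = "\<lambda>w. chain_value \<phi> (fox l m n w)"
  have "?z ([(a, b), (a, \<not> b)] @ v) = ?z v"
    using rep_inverse[of a b]
    by (cases b) (simp_all add: value_fox_Cons matrix_vector_mul_assoc
        matrix_vector_mult_diff_distrib matrix_vector_right_distrib del: fox.simps)
  then show ?case
    by (simp only: value_fox_append[of u])
next
  case (relator u R v)
  then show ?case
    by (simp only: value_fox_append value_fox_relator rep_relator matrix_vector_mul_lid add_0_left)
qed simp_all

end

end

section \<open>The twisted cochain complex\<close>

lemma cell_dim_iff:
  "cell_dim c = 0 \<longleftrightarrow> c = Cell0"
  "cell_dim c = Suc 0 \<longleftrightarrow> c = Cell1 Gen_g \<or> c = Cell1 Gen_h"
  "cell_dim c = Suc (Suc 0) \<longleftrightarrow> c = Cell2 Rel_r \<or> c = Cell2 Rel_s"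
  "cell_dim c = Suc (Suc (Suc 0)) \<longleftrightarrow> c = Cell3"
  "cell_dim c = 2 \<longleftrightarrow> c = Cell2 Rel_r \<or> c = Cell2 Rel_s"
  "cell_dim c = 3 \<longleftrightarrow> c = Cell3"
  "cell_dim c \<noteq> 4"
  by (cases c; use gen.exhaust rel.exhaust in auto)+

lemma lin_comb_4:
  "lin_comb sc [k1, k2, k3, k4] [v1, v2, v3, v4] = sc k1 v1 + sc k2 v2 + sc k3 v3 + sc k4 v4"
  by (simp add: lin_comb_def eval_nat_numeral lessThan_Suc ac_simps)


lemma scale_cochain_zero: "scale_cochain k 0 = 0"
  by (simp add: scale_cochain_def fun_eq_iff)

lemma basis_of_zero_iff:
  assumes K: "is_subfield K"
  shows "basis_of K scale_cochain {0} vs \<longleftrightarrow> vs = []"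
proof
  assume b: "basis_of K scale_cochain {0} vs"
  then have v: "set vs \<subseteq> {0}"
    by (simp add: basis_modulo_def)
  have zero: "0 - lin_comb scale_cochain ks vs \<in> {0}" for ks
  proof -
    have "scale_cochain (ks ! i) (vs ! i) = 0" if "i < length vs" for i
      using v nth_mem[OF that] by (auto simp: scale_cochain_zero)
    then show ?thesis
      by (simp add: lin_comb_def)
  qed
  have "\<exists>!ks. length ks = length vs \<and> set ks \<subseteq> K \<and> 0 - lin_comb scale_cochain ks vs \<in> {0}"
    using b by (simp add: basis_modulo_def)
  then have "\<exists>!ks. length ks = length vs \<and> set ks \<subseteq> K"
    by (simp only: zero simp_thms)
  moreover have "length (replicate (length vs) k) = length vs \<and> set (replicate (length vs) k) \<subseteq> K"
    if "k \<in> K" for k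
    using that by auto
  ultimately have "replicate (length vs) 0 = replicate (length vs) (1 :: complex)"
    using subfield_0[OF K] subfield_1[OF K] by blast
  then show "vs = []"
    by (cases vs) auto
next
  assume "vs = []"
  then show "basis_of K scale_cochain {0} vs"
    by (auto simp: basis_modulo_def lin_comb_def)
qed

context twisted_coefficients
begin

abbreviation C where "C \<equiv> tw_cochains l m n F \<rho>"
abbreviation \<delta> where "\<delta> \<equiv> tw_coboundary l m n"

lemma C_outside: "\<phi> \<in> C i \<Longrightarrow> p \<notin> lifted_cells l m n i \<Longrightarrow> \<phi> p = 0"
  unfolding tw_cochains_def by blast

lemma C_at_zero: "\<phi> \<in> C i \<Longrightarrow> cell_dim c \<noteq> i \<Longrightarrow> \<phi> (x, c) = 0"
  by (rule C_outside) (auto simp: lifted_cells_def)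

lemma C_equivariant: "\<phi> \<in> C i \<Longrightarrow> equivariant \<phi>"
  unfolding equivariant_def
proof (intro ballI allI)
  fix x y c assume \<phi>: "\<phi> \<in> C i" and xy: "x \<in> carrier G" "y \<in> carrier G"
  show "\<phi> (x \<otimes>\<^bsub>G\<^esub> y, c) = \<rho> x *v \<phi> (y, c)"
  proof (cases "cell_dim c = i")
    case True
    then have "(y, c) \<in> lifted_cells l m n i"
      using xy by (simp add: lifted_cells_def)
    then show ?thesis
      using \<phi> xy unfolding tw_cochains_def by blast
  next
    case False
    then show ?thesis
      by (simp add: C_at_zero[OF \<phi>])
  qed
qed

lemma C_plane: "\<phi> \<in> C i \<Longrightarrow> x \<in> carrier G \<Longrightarrow> \<phi> (x, c) \<in> plane F"
proof (cases "cell_dim c = i")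
  case True
  assume "\<phi> \<in> C i" "x \<in> carrier G"
  then have "(x, c) \<in> lifted_cells l m n i"
    using True by (simp add: lifted_cells_def)
  then show ?thesis
    using \<open>\<phi> \<in> C i\<close> unfolding tw_cochains_def by blast
qed (simp add: C_at_zero plane_closed(1)[OF subfield])

lemma C_ext:
  assumes "\<phi> \<in> C i" "\<theta> \<in> C i" "\<And>c. cell_dim c = i \<Longrightarrow> \<phi> (\<one>\<^bsub>G\<^esub>, c) = \<theta> (\<one>\<^bsub>G\<^esub>, c)"
  shows "\<phi> = \<theta>"
proof (rule ext, clarify)
  fix x c
  show "\<phi> (x, c) = \<theta> (x, c)"
  proof (cases "x \<in> carrier G \<and> cell_dim c = i")
    case True
    then show ?thesis
      using equivariant_at[OF C_equivariant[OF assms(1)], of x c]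
        equivariant_at[OF C_equivariant[OF assms(2)], of x c] assms(3) by metis
  next
    case False
    then have "(x, c) \<notin> lifted_cells l m n i"
      by (auto simp: lifted_cells_def)
    then show ?thesis
      by (simp add: C_outside[OF assms(1)] C_outside[OF assms(2)])
  qed
qed

lemma C_intro:
  assumes "\<And>p. p \<notin> lifted_cells l m n i \<Longrightarrow> \<phi> p = 0"
    and "\<And>p. p \<in> lifted_cells l m n i \<Longrightarrow> \<phi> p \<in> plane F" and "equivariant \<phi>"
  shows "\<phi> \<in> C i"
proof -
  have "\<phi> (x \<otimes>\<^bsub>G\<^esub> y, c) = \<rho> x *v \<phi> (y, c)" if "x \<in> carrier G" "(y, c) \<in> lifted_cells l m n i" for x y c
    using that assms(3) unfolding equivariant_def lifted_cells_def by blast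
  then show ?thesis
    using assms(1,2) unfolding tw_cochains_def by blast
qed

lemma C_plane_lifted: "\<phi> \<in> C i \<Longrightarrow> p \<in> lifted_cells l m n i \<Longrightarrow> \<phi> p \<in> plane F"
  unfolding tw_cochains_def by blast

lemma equivariant_closed:
  "equivariant 0"
  "equivariant \<phi> \<Longrightarrow> equivariant \<theta> \<Longrightarrow> equivariant (\<phi> + \<theta>)"
  "equivariant \<phi> \<Longrightarrow> equivariant \<theta> \<Longrightarrow> equivariant (\<phi> - \<theta>)"
  "equivariant \<phi> \<Longrightarrow> equivariant (scale_cochain k \<phi>)"
  by (simp_all add: equivariant_def scale_cochain_def matrix_vector_right_distrib
      matrix_vector_mult_diff_distrib vector_scalar_commute)

lemma C_closed:
  "0 \<in> C i" "\<phi> \<in> C i \<Longrightarrow> \<theta> \<in> C i \<Longrightarrow> \<phi> + \<theta> \<in> C i" "\<phi> \<in> C i \<Longrightarrow> \<theta> \<in> C i \<Longrightarrow> \<phi> - \<theta> \<in> C i"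
  "k \<in> F \<Longrightarrow> \<phi> \<in> C i \<Longrightarrow> scale_cochain k \<phi> \<in> C i"
  by (rule C_intro; auto simp: scale_cochain_def C_outside C_plane_lifted C_equivariant
      intro!: plane_closed[OF subfield] equivariant_closed
        equivariant_closed(4)[unfolded scale_cochain_def])+

text \<open>
  An equivariant cochain is determined by its values on the preferred lifts, and these can be
  prescribed freely.
\<close>

definition cochain_of :: "nat \<Rightarrow> (cell \<Rightarrow> complex ^ 2) \<Rightarrow> cochain" where
  "cochain_of i f = (\<lambda>(x, c). if x \<in> carrier G \<and> cell_dim c = i then \<rho> x *v f c else 0)"

lemma cochain_of_at [simp]: "cochain_of i f (\<one>\<^bsub>G\<^esub>, c) = (if cell_dim c = i then f c else 0)"
  by (simp add: cochain_of_def rep_one)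

lemma cochain_of_in_C:
  assumes "\<And>c. cell_dim c = i \<Longrightarrow> f c \<in> plane F"
  shows "cochain_of i f \<in> C i"
proof (rule C_intro)
  show "equivariant (cochain_of i f)"
    by (simp add: equivariant_def cochain_of_def pi1_mult_closed rep_mult matrix_vector_mul_assoc)
qed (auto simp: cochain_of_def lifted_cells_def split: if_splits
    intro!: plane_closed(6)[OF subfield rep_entry] assms)

lemma C_zero_iff: "\<phi> \<in> C i \<Longrightarrow> \<phi> = 0 \<longleftrightarrow> (\<forall>c. cell_dim c = i \<longrightarrow> \<phi> (\<one>\<^bsub>G\<^esub>, c) = 0)"
  using C_ext[OF _ C_closed(1), of \<phi> i] by auto

lemma keys_cell_boundary:
  "Poly_Mapping.keys (cell_boundary l m n c) \<subseteq> carrier G \<times> {c'. Suc (cell_dim c') = cell_dim c}"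
proof (cases c)
  case (Cell1 a)
  then show ?thesis
    by (auto simp: keys_frag_of dest!: subsetD[OF keys_diff])
next
  case (Cell2 R)
  then show ?thesis
    using keys_fox[of "relator l m n R"] by auto
next
  case Cell3
  then show ?thesis
    by (auto simp: keys_frag_of dest!: subsetD[OF keys_diff] subsetD[OF Poly_Mapping.keys_add])
qed simp

lemma keys_boundary:
  "x \<in> carrier G \<Longrightarrow> Poly_Mapping.keys (boundary l m n (x, c)) \<subseteq> carrier G \<times> {c'. Suc (cell_dim c') = cell_dim c}"
  unfolding boundary_def using keys_translate[OF _ keys_cell_boundary] by simp

lemma value_boundary:
  assumes "equivariant \<phi>" "x \<in> carrier G"
  shows "chain_value \<phi> (boundary l m n (x, c)) = \<rho> x *v chain_value \<phi> (cell_boundary l m n c)"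
  using keys_cell_boundary[of c] unfolding boundary_def
  by (auto intro!: value_translate assms)

lemma value_cell_boundary:
  assumes "equivariant \<phi>"
  shows "chain_value \<phi> (cell_boundary l m n Cell0) = 0"
    "chain_value \<phi> (cell_boundary l m n (Cell1 a))
       = (one_mat - rep [(a, True)]) *v \<phi> (\<one>\<^bsub>G\<^esub>, Cell0)"
    "chain_value \<phi> (cell_boundary l m n (Cell2 R)) = 0"
    "chain_value \<phi> (cell_boundary l m n Cell3)
       = (one_mat - B) *v \<phi> (\<one>\<^bsub>G\<^esub>, Cell2 Rel_r) + (one_mat - A) *v \<phi> (\<one>\<^bsub>G\<^esub>, Cell2 Rel_s)"
  using value_fox_relator[OF assms]
  by (simp_all add: chain_value_add chain_value_diff matrix_vector_mult_diff_rdistrib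
      equivariant_at[OF assms word_class_in_pi1[of l m n "[_]"]])

lemma coboundary_at:
  "\<phi> \<in> C i \<Longrightarrow> x \<in> carrier G \<Longrightarrow> \<delta> \<phi> (x, c) = \<rho> x *v chain_value \<phi> (cell_boundary l m n c)"
  by (simp add: tw_coboundary_def eval_cochain_chain_value value_boundary[OF C_equivariant])

lemma coboundary_eq_cochain_of:
  assumes \<phi>: "\<phi> \<in> C i"
  shows "\<delta> \<phi> = cochain_of (Suc i) (\<lambda>c. chain_value \<phi> (cell_boundary l m n c))"
proof (rule ext, clarify)
  fix x c
  have "chain_value \<phi> (cell_boundary l m n c) = 0" if "cell_dim c \<noteq> Suc i"
  proof -
    have "chain_value \<phi> (cell_boundary l m n c) = chain_value (\<lambda>p. 0) (cell_boundary l m n c)"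
      using keys_cell_boundary[of c] that
      by (intro chain_value_cong) (auto intro!: C_at_zero[OF \<phi>])
    then show ?thesis by simp
  qed
  then show "\<delta> \<phi> (x, c) = cochain_of (Suc i) (\<lambda>c. chain_value \<phi> (cell_boundary l m n c)) (x, c)"
    using coboundary_at[OF \<phi>, of x c]
    by (cases "x \<in> carrier G") (auto simp: cochain_of_def tw_coboundary_def)
qed

definition inv_one_minus_A :: "complex ^ 2 ^ 2" where
  "inv_one_minus_A = (\<chi> i j. if i = j then inverse (1 - A $ i $ i) else 0)"

lemma A22_not_one: "A $ 2 $ 2 \<noteq> 1"
  using A_nth(3) not_one by auto

lemma inv_one_minus_A:
  "(one_mat - A) *v (inv_one_minus_A *v v) = v" "inv_one_minus_A *v ((one_mat - A) *v v) = v"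
  using A_nth not_one A22_not_one
  by (simp_all add: vec2_eq_iff mult2_nth mat2_one_nth inv_one_minus_A_def)


lemma one_minus_plane:
  "x \<in> carrier G \<Longrightarrow> v \<in> plane F \<Longrightarrow> (one_mat - \<rho> x) *v v \<in> plane F"
  by (intro plane_closed(6)[OF subfield])
     (auto simp: mat2_one_nth intro!: subfield_closed[OF subfield] rep_entry)

lemma inv_one_minus_A_plane: "v \<in> plane F \<Longrightarrow> inv_one_minus_A *v v \<in> plane F"
  by (intro plane_closed(6)[OF subfield])
     (auto simp: inv_one_minus_A_def intro!: subfield_closed[OF subfield] rep_entry)

lemma cochain_of_cong: "(\<And>c. cell_dim c = i \<Longrightarrow> f c = g c) \<Longrightarrow> cochain_of i f = cochain_of i g"
  by (auto simp: cochain_of_def fun_eq_iff)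

lemma cochain_of_zero: "(\<And>c. cell_dim c = i \<Longrightarrow> f c = 0) \<Longrightarrow> cochain_of i f = 0"
  by (auto simp: cochain_of_def fun_eq_iff)

lemma coboundary_0:
  assumes "\<phi> \<in> C 0"
  shows "\<delta> \<phi> = cochain_of 1 (\<lambda>c. if c = Cell1 Gen_g then (one_mat - A) *v \<phi> (\<one>\<^bsub>G\<^esub>, Cell0)
     else (one_mat - B) *v \<phi> (\<one>\<^bsub>G\<^esub>, Cell0))"
  unfolding coboundary_eq_cochain_of[OF assms] One_nat_def
  using value_cell_boundary(2)[OF C_equivariant[OF assms]]
  by (intro cochain_of_cong) (auto simp: cell_dim_iff)

lemma coboundary_1: "\<phi> \<in> C 1 \<Longrightarrow> \<delta> \<phi> = 0"
  unfolding coboundary_eq_cochain_of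
  using value_cell_boundary(3)[OF C_equivariant[of \<phi> 1]]
  by (intro cochain_of_zero) (auto simp: cell_dim_iff simp del: cell_boundary.simps)

lemma coboundary_2:
  assumes "\<phi> \<in> C 2"
  shows "\<delta> \<phi> = cochain_of 3 (\<lambda>c. (one_mat - B) *v \<phi> (\<one>\<^bsub>G\<^esub>, Cell2 Rel_r)
     + (one_mat - A) *v \<phi> (\<one>\<^bsub>G\<^esub>, Cell2 Rel_s))"
  unfolding coboundary_eq_cochain_of[OF assms] eval_nat_numeral
  using value_cell_boundary(4)[OF C_equivariant[OF assms]]
  by (intro cochain_of_cong) (auto simp: cell_dim_iff)

lemma coboundary_3: "\<phi> \<in> C 3 \<Longrightarrow> \<delta> \<phi> = 0"
  unfolding coboundary_eq_cochain_of
  by (intro cochain_of_zero) (auto simp: cell_dim_iff)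

end

section \<open>Cohomology\<close>

context twisted_coefficients
begin

lemma cocycles_0: "cocycles C \<delta> 0 = {0}"
proof (intro equalityI subsetI)
  fix \<phi> assume "\<phi> \<in> cocycles C \<delta> 0"
  then have \<phi>: "\<phi> \<in> C 0" "\<delta> \<phi> = 0"
    by (simp_all add: cocycles_def)
  then have "(one_mat - A) *v \<phi> (\<one>\<^bsub>G\<^esub>, Cell0) = 0"
    using fun_cong[OF coboundary_0[OF \<phi>(1)], of "(\<one>\<^bsub>G\<^esub>, Cell1 Gen_g)"] by simp
  then have "\<phi> (\<one>\<^bsub>G\<^esub>, Cell0) = 0"
    using inv_one_minus_A(2)[of "\<phi> (\<one>\<^bsub>G\<^esub>, Cell0)"] by simp
  then show "\<phi> \<in> {0}"
    using C_zero_iff[OF \<phi>(1)] by (simp add: cell_dim_iff)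
next
  fix \<phi> :: cochain assume "\<phi> \<in> {0}"
  then show "\<phi> \<in> cocycles C \<delta> 0"
    using C_closed(1)[of 0] coboundary_0[OF C_closed(1)]
    by (auto simp: cocycles_def intro!: cochain_of_zero)
qed

lemma cocycles_1: "cocycles C \<delta> 1 = C 1"
  using coboundary_1 by (auto simp: cocycles_def)

lemma cocycles_2:
  "cocycles C \<delta> 2 = {\<theta> \<in> C 2. (one_mat - B) *v \<theta> (\<one>\<^bsub>G\<^esub>, Cell2 Rel_r)
     + (one_mat - A) *v \<theta> (\<one>\<^bsub>G\<^esub>, Cell2 Rel_s) = 0}"
proof -
  have "\<delta> \<theta> = 0 \<longleftrightarrow> (one_mat - B) *v \<theta> (\<one>\<^bsub>G\<^esub>, Cell2 Rel_r)
     + (one_mat - A) *v \<theta> (\<one>\<^bsub>G\<^esub>, Cell2 Rel_s) = 0" (is "_ \<longleftrightarrow> ?z = 0") if "\<theta> \<in> C 2" for \<theta>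
  proof
    assume "\<delta> \<theta> = 0"
    then show "?z = 0"
      using fun_cong[OF coboundary_2[OF that], of "(\<one>\<^bsub>G\<^esub>, Cell3)"] by simp
  next
    assume "?z = 0"
    then show "\<delta> \<theta> = 0"
      unfolding coboundary_2[OF that] by (intro cochain_of_zero)
  qed
  then show ?thesis
    by (auto simp: cocycles_def)
qed

lemma cocycles_3: "cocycles C \<delta> 3 = C 3"
  using coboundary_3 by (auto simp: cocycles_def)

lemma coboundary_0_in_C: "\<phi> \<in> C 0 \<Longrightarrow> \<delta> \<phi> \<in> C 1"
  using C_plane[of \<phi> 0]
  by (simp only: coboundary_0) (auto intro!: cochain_of_in_C one_minus_plane)

lemma coboundary_2_in_C: "\<phi> \<in> C 2 \<Longrightarrow> \<delta> \<phi> \<in> C 3"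
  using C_plane[of \<phi> 2]
  by (simp only: coboundary_2)
     (auto intro!: cochain_of_in_C one_minus_plane plane_closed(2)[OF subfield])

text \<open>
  There is exactly one coboundary that agrees with \<open>\<phi>\<close> on \<open>g\<close>, because \<open>1 - A\<close> is invertible.
  After it has been subtracted from \<open>\<phi>\<close>, the value on \<open>h\<close> remains.
\<close>

definition H1_coord :: "cochain \<Rightarrow> complex ^ 2" where
  "H1_coord \<phi> = \<phi> (\<one>\<^bsub>G\<^esub>, Cell1 Gen_h)
     - (one_mat - B) *v (inv_one_minus_A *v \<phi> (\<one>\<^bsub>G\<^esub>, Cell1 Gen_g))"

lemma coboundaries_1: "coboundaries C \<delta> 1 = {\<phi> \<in> C 1. H1_coord \<phi> = 0}"
proof (intro equalityI subsetI)
  fix \<phi> assume "\<phi> \<in> coboundaries C \<delta> 1"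
  then obtain \<psi> where \<psi>: "\<psi> \<in> C 0" "\<phi> = \<delta> \<psi>"
    by (auto simp: coboundaries_def)
  show "\<phi> \<in> {\<phi> \<in> C 1. H1_coord \<phi> = 0}"
    using coboundary_0_in_C[OF \<psi>(1)] unfolding \<psi>(2) coboundary_0[OF \<psi>(1)]
    by (auto simp: H1_coord_def inv_one_minus_A)
next
  fix \<phi> assume "\<phi> \<in> {\<phi> \<in> C 1. H1_coord \<phi> = 0}"
  then have \<phi>: "\<phi> \<in> C 1" and h: "H1_coord \<phi> = 0" by auto
  let ?\<psi> = "cochain_of 0 (\<lambda>_. inv_one_minus_A *v \<phi> (\<one>\<^bsub>G\<^esub>, Cell1 Gen_g))"
  have \<psi>: "?\<psi> \<in> C 0"
    using C_plane[OF \<phi>] by (intro cochain_of_in_C inv_one_minus_A_plane) simp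
  have "\<phi> = \<delta> ?\<psi>"
  proof (rule C_ext[OF \<phi>])
    show "\<delta> ?\<psi> \<in> C 1"
      by (rule coboundary_0_in_C[OF \<psi>])
    show "\<phi> (\<one>\<^bsub>G\<^esub>, c) = \<delta> ?\<psi> (\<one>\<^bsub>G\<^esub>, c)" if "cell_dim c = 1" for c
      using that h unfolding coboundary_0[OF \<psi>]
      by (auto simp: cell_dim_iff H1_coord_def inv_one_minus_A)
  qed
  then show "\<phi> \<in> coboundaries C \<delta> 1"
    using \<psi> by (auto simp: coboundaries_def)
qed

lemma coboundaries_2: "coboundaries C \<delta> 2 = {0}"
  using coboundary_1 C_closed(1)[of 1] by (force simp: coboundaries_def)

lemma coboundaries_3: "coboundaries C \<delta> 3 = C 3"
proof (intro equalityI subsetI)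
  fix \<phi> assume "\<phi> \<in> coboundaries C \<delta> 3"
  then show "\<phi> \<in> C 3"
    using coboundary_2_in_C by (auto simp: coboundaries_def)
next
  fix \<phi> assume \<phi>: "\<phi> \<in> C 3"
  let ?\<psi> = "cochain_of 2 (\<lambda>c. if c = Cell2 Rel_r then 0 else inv_one_minus_A *v \<phi> (\<one>\<^bsub>G\<^esub>, Cell3))"
  have \<psi>: "?\<psi> \<in> C 2"
    using C_plane[OF \<phi>] plane_closed[OF subfield]
    by (intro cochain_of_in_C) (auto intro: inv_one_minus_A_plane)
  have "\<phi> = \<delta> ?\<psi>"
  proof (rule C_ext[OF \<phi>])
    show "\<delta> ?\<psi> \<in> C 3"
      by (rule coboundary_2_in_C[OF \<psi>])
    show "\<phi> (\<one>\<^bsub>G\<^esub>, c) = \<delta> ?\<psi> (\<one>\<^bsub>G\<^esub>, c)" if "cell_dim c = 3" for c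
      using that unfolding coboundary_2[OF \<psi>]
      by (auto simp: cell_dim_iff inv_one_minus_A)
  qed
  then show "\<phi> \<in> coboundaries C \<delta> 3"
    using \<psi> by (auto simp: coboundaries_def)
qed

lemma coboundaries_4: "coboundaries C \<delta> (Suc 3) = {0}"
  using coboundary_3 C_closed(1)[of 3] by (force simp: coboundaries_def)

lemma cohomology_0: "cohomology C \<delta> 0 = {coh_class C \<delta> 0 0}"
  by (simp add: cohomology_def cocycles_0)

lemma cohomology_3: "cohomology C \<delta> 3 = {coh_class C \<delta> 3 0}"
proof -
  have "coh_class C \<delta> 3 z = C 3" if "z \<in> C 3" for z
  proof -
    have "y \<in> (\<lambda>b. z + b) ` C 3" if "y \<in> C 3" for y
      using C_closed(3)[OF that \<open>z \<in> C 3\<close>] by (intro image_eqI[of _ _ "y - z"]) simp_all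
    then show ?thesis
      using C_closed(2)[OF that] by (auto simp: coh_class_def coboundaries_3)
  qed
  then show ?thesis
    using C_closed(1)[of 3] unfolding cohomology_def cocycles_3 by auto
qed

lemma quotient_H1:
  "linear_quotient F scale_cochain (coboundaries C \<delta> 1) (cocycles C \<delta> 1) (*s) (plane F) H1_coord"
  unfolding linear_quotient_def
proof (intro conjI ballI)
  show "0 \<in> cocycles C \<delta> 1" "coboundaries C \<delta> 1 = {z \<in> cocycles C \<delta> 1. H1_coord z = 0}"
    by (simp_all add: cocycles_1[simplified] coboundaries_1[simplified] C_closed)
  show "H1_coord ` cocycles C \<delta> 1 = plane F"
  proof (intro equalityI subsetI)
    fix v assume "v \<in> H1_coord ` cocycles C \<delta> 1"
    then obtain \<phi> where \<phi>: "\<phi> \<in> C 1" "v = H1_coord \<phi>"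
      unfolding cocycles_1 by blast
    show "v \<in> plane F"
      unfolding \<phi>(2) H1_coord_def using C_plane[OF \<phi>(1)]
      by (auto intro!: plane_closed(3)[OF subfield] one_minus_plane inv_one_minus_A_plane)
  next
    fix v assume v: "v \<in> plane F"
    let ?\<phi> = "cochain_of 1 (\<lambda>c. if c = Cell1 Gen_g then 0 else v)"
    have "?\<phi> \<in> C 1" "H1_coord ?\<phi> = v"
      using v plane_closed[OF subfield] by (auto simp: H1_coord_def intro!: cochain_of_in_C)
    then show "v \<in> H1_coord ` cocycles C \<delta> 1"
      unfolding cocycles_1 by force
  qed
next
  fix \<phi> \<theta> assume "\<phi> \<in> cocycles C \<delta> 1" "\<theta> \<in> cocycles C \<delta> 1"
  then show "\<phi> + \<theta> \<in> cocycles C \<delta> 1" "\<phi> - \<theta> \<in> cocycles C \<delta> 1"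
    "H1_coord (\<phi> + \<theta>) = H1_coord \<phi> + H1_coord \<theta>"
    unfolding cocycles_1
    by (simp_all add: C_closed H1_coord_def matrix_vector_right_distrib)
next
  fix k \<phi> assume "k \<in> F" "\<phi> \<in> cocycles C \<delta> 1"
  then show "scale_cochain k \<phi> \<in> cocycles C \<delta> 1" "H1_coord (scale_cochain k \<phi>) = k *s H1_coord \<phi>"
    unfolding cocycles_1
    by (simp_all add: C_closed H1_coord_def) (simp add: scale_cochain_def vector_scalar_commute vec.scale_right_diff_distrib)
qed

text \<open>
  A 2-cocycle is determined by its value on \<open>r\<close>, since the cocycle equation can be solved for the
  value on \<open>s\<close>.
\<close>

lemma quotient_H2:
  "linear_quotient F scale_cochain (coboundaries C \<delta> 2) (cocycles C \<delta> 2) (*s) (plane F)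
     (\<lambda>\<theta>. \<theta> (\<one>\<^bsub>G\<^esub>, Cell2 Rel_r))"
  unfolding linear_quotient_def coboundaries_2 cocycles_2
proof (intro conjI ballI)
  let ?Z = "{\<theta> \<in> C 2. (one_mat - B) *v \<theta> (\<one>\<^bsub>G\<^esub>, Cell2 Rel_r)
     + (one_mat - A) *v \<theta> (\<one>\<^bsub>G\<^esub>, Cell2 Rel_s) = 0}"
  show "0 \<in> ?Z" by (simp add: C_closed)
  show "(\<lambda>\<theta>. \<theta> (\<one>\<^bsub>G\<^esub>, Cell2 Rel_r)) ` ?Z = plane F"
  proof (intro equalityI subsetI)
    fix v assume "v \<in> (\<lambda>\<theta>. \<theta> (\<one>\<^bsub>G\<^esub>, Cell2 Rel_r)) ` ?Z"
    then show "v \<in> plane F" by (auto intro: C_plane)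
  next
    fix v assume v: "v \<in> plane F"
    let ?\<theta> = "cochain_of 2 (\<lambda>c. if c = Cell2 Rel_r then v
      else - (inv_one_minus_A *v ((one_mat - B) *v v)))"
    have "?\<theta> \<in> ?Z"
      using v by (auto intro!: cochain_of_in_C plane_closed[OF subfield] inv_one_minus_A_plane
          one_minus_plane simp: inv_one_minus_A vec.neg)
    then show "v \<in> (\<lambda>\<theta>. \<theta> (\<one>\<^bsub>G\<^esub>, Cell2 Rel_r)) ` ?Z"
      by (rule rev_image_eqI) simp
  qed
  show "{0} = {\<theta> \<in> ?Z. \<theta> (\<one>\<^bsub>G\<^esub>, Cell2 Rel_r) = 0}"
  proof -
    have "\<theta> = 0" if \<theta>: "\<theta> \<in> ?Z" "\<theta> (\<one>\<^bsub>G\<^esub>, Cell2 Rel_r) = 0" for \<theta>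
    proof -
      have "\<theta> (\<one>\<^bsub>G\<^esub>, Cell2 Rel_s) = 0"
        using \<theta> inv_one_minus_A(2)[of "\<theta> (\<one>\<^bsub>G\<^esub>, Cell2 Rel_s)"] by simp
      then show ?thesis
        using \<theta> C_zero_iff[of \<theta> 2] by (auto simp: cell_dim_iff)
    qed
    then show ?thesis
      using C_closed(1) by auto
  qed
next
  fix \<phi> \<theta>
  let ?Z = "{\<theta> \<in> C 2. (one_mat - B) *v \<theta> (\<one>\<^bsub>G\<^esub>, Cell2 Rel_r)
     + (one_mat - A) *v \<theta> (\<one>\<^bsub>G\<^esub>, Cell2 Rel_s) = 0}"
  assume z: "\<phi> \<in> ?Z" "\<theta> \<in> ?Z"
  have *: "Q *v (x + x') + P *v (y + y') = (Q *v x + P *v y) + (Q *v x' + P *v y')"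
    "Q *v (x - x') + P *v (y - y') = (Q *v x + P *v y) - (Q *v x' + P *v y')"
    for Q P :: "complex ^ 2 ^ 2" and x x' y y'
    by (simp_all add: matrix_vector_right_distrib matrix_vector_mult_diff_distrib)
  show "\<phi> + \<theta> \<in> ?Z" "\<phi> - \<theta> \<in> ?Z"
    using z by (simp_all add: C_closed * del: matrix_vector_mult_diff_rdistrib)
  show "(\<phi> + \<theta>) (\<one>\<^bsub>G\<^esub>, Cell2 Rel_r) = \<phi> (\<one>\<^bsub>G\<^esub>, Cell2 Rel_r) + \<theta> (\<one>\<^bsub>G\<^esub>, Cell2 Rel_r)"
    by simp
next
  fix k \<phi>
  let ?Z = "{\<theta> \<in> C 2. (one_mat - B) *v \<theta> (\<one>\<^bsub>G\<^esub>, Cell2 Rel_r)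
     + (one_mat - A) *v \<theta> (\<one>\<^bsub>G\<^esub>, Cell2 Rel_s) = 0}"
  assume z: "k \<in> F" "\<phi> \<in> ?Z"
  have "Q *v (k *s x) + P *v (k *s y) = k *s (Q *v x + P *v y)" for Q P :: "complex ^ 2 ^ 2" and x y
    by (simp add: vector_scalar_commute vec.scale_right_distrib)
  from this[of "one_mat - B" _ "one_mat - A"] show "scale_cochain k \<phi> \<in> ?Z"
    using z C_closed(4)[OF z(1), of \<phi> 2] by (simp only: mem_Collect_eq scale_cochain_def vec.scale_zero_right simp_thms)
  show "scale_cochain k \<phi> (\<one>\<^bsub>G\<^esub>, Cell2 Rel_r) = k *s \<phi> (\<one>\<^bsub>G\<^esub>, Cell2 Rel_r)"
    by (simp add: scale_cochain_def)
qed

text \<open>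
  The coordinate of a coboundary of \<open>\<psi>\<close> is the value of \<open>\<psi>\<close> on the 0-cell.
\<close>

lemma quotient_coboundaries_1:
  "linear_quotient F scale_cochain {0} (coboundaries C \<delta> 1) (*s) (plane F)
     (\<lambda>\<phi>. inv_one_minus_A *v \<phi> (\<one>\<^bsub>G\<^esub>, Cell1 Gen_g))"
proof -
  have q: "0 \<in> coboundaries C \<delta> 1"
    "\<And>\<phi> \<theta>. \<phi> \<in> coboundaries C \<delta> 1 \<Longrightarrow> \<theta> \<in> coboundaries C \<delta> 1 \<Longrightarrow>
       \<phi> + \<theta> \<in> coboundaries C \<delta> 1 \<and> \<phi> - \<theta> \<in> coboundaries C \<delta> 1"
    "\<And>k \<phi>. k \<in> F \<Longrightarrow> \<phi> \<in> coboundaries C \<delta> 1 \<Longrightarrow> scale_cochain k \<phi> \<in> coboundaries C \<delta> 1"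
    using quotient_H1 linear_quotient_diff[OF quotient_H1] linear_quotient_diff[OF quotient_H1, of 0 0]
    unfolding linear_quotient_def by (auto simp: vec.scale_right_diff_distrib)
  let ?w = "\<lambda>\<phi>::cochain. inv_one_minus_A *v \<phi> (\<one>\<^bsub>G\<^esub>, Cell1 Gen_g)"
  have "?w ` coboundaries C \<delta> 1 = plane F"
  proof (intro equalityI subsetI)
    fix v assume "v \<in> ?w ` coboundaries C \<delta> 1"
    then show "v \<in> plane F"
      by (auto simp: coboundaries_1[simplified] intro!: inv_one_minus_A_plane C_plane)
  next
    fix v assume v: "v \<in> plane F"
    then have "cochain_of 0 (\<lambda>_. v) \<in> C 0"
      by (intro cochain_of_in_C)
    moreover from coboundary_0[OF this] have "?w (\<delta> (cochain_of 0 (\<lambda>_. v))) = v"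
      by (simp add: inv_one_minus_A)
    ultimately show "v \<in> ?w ` coboundaries C \<delta> 1"
      unfolding coboundaries_def by (intro rev_image_eqI[of "\<delta> (cochain_of 0 (\<lambda>_. v))"]) auto
  qed
  moreover have "\<phi> = 0" if \<phi>: "\<phi> \<in> coboundaries C \<delta> 1" "?w \<phi> = 0" for \<phi>
  proof -
    have "\<phi> (\<one>\<^bsub>G\<^esub>, Cell1 Gen_g) = 0"
      using \<phi>(2) inv_one_minus_A(1)[of "\<phi> (\<one>\<^bsub>G\<^esub>, Cell1 Gen_g)"] by simp
    then show ?thesis
      using \<phi>(1) C_zero_iff[of \<phi> 1] unfolding coboundaries_1
      by (auto simp: cell_dim_iff H1_coord_def)
  qed
  ultimately show ?thesis
    unfolding linear_quotient_def using q
    by (auto simp: matrix_vector_right_distrib scale_cochain_def vector_scalar_commute)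
qed

lemma quotient_coboundaries_3:
  "linear_quotient F scale_cochain {0} (coboundaries C \<delta> 3) (*s) (plane F) (\<lambda>\<phi>. \<phi> (\<one>\<^bsub>G\<^esub>, Cell3))"
proof -
  let ?w = "\<lambda>\<phi>::cochain. \<phi> (\<one>\<^bsub>G\<^esub>, Cell3)"
  have "?w ` C 3 = plane F"
  proof (intro equalityI subsetI)
    fix v assume v: "v \<in> plane F"
    then have "cochain_of 3 (\<lambda>_. v) \<in> C 3"
      by (intro cochain_of_in_C)
    then show "v \<in> ?w ` C 3"
      by (rule rev_image_eqI) simp
  qed (auto intro: C_plane)
  moreover have "\<phi> = 0" if "\<phi> \<in> C 3" "?w \<phi> = 0" for \<phi>
    using that C_zero_iff[of \<phi> 3] by (simp add: cell_dim_iff)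
  ultimately show ?thesis
    unfolding linear_quotient_def coboundaries_3
    by (auto simp: C_closed) (simp_all add: scale_cochain_def)
qed

section \<open>Determinants of base changes\<close>

lemma dual_cochain_eq:
  "dual_cochain l m n \<rho> c k = cochain_of (cell_dim c) (\<lambda>c'. if c' = c then axis k 1 else 0)"
  by (auto simp: dual_cochain_def cochain_of_def fun_eq_iff)

lemma dual_cochain_in_C: "cell_dim c = i \<Longrightarrow> dual_cochain l m n \<rho> c k \<in> C i"
  unfolding dual_cochain_eq using plane_closed[OF subfield] by (auto intro!: cochain_of_in_C)

lemma coords_one_cell:
  assumes \<phi>: "\<phi> \<in> C i" and c: "cells i = [c]" "\<And>c'. cell_dim c' = i \<longleftrightarrow> c' = c"
  shows "coords F scale_cochain (tw_basis l m n \<rho> i) \<phi> = [\<phi> (\<one>\<^bsub>G\<^esub>, c) $ 1, \<phi> (\<one>\<^bsub>G\<^esub>, c) $ 2]"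
proof -
  let ?e = "dual_cochain l m n \<rho>"
  have basis: "tw_basis l m n \<rho> i = [?e c 1, ?e c 2]"
    using c(1) by (simp add: tw_basis_def)
  have eq: "\<phi> = lin_comb scale_cochain [a, b] [?e c 1, ?e c 2] \<longleftrightarrow>
      a = \<phi> (\<one>\<^bsub>G\<^esub>, c) $ 1 \<and> b = \<phi> (\<one>\<^bsub>G\<^esub>, c) $ 2" if ab: "a \<in> F" "b \<in> F" for a b
  proof -
    let ?v = "lin_comb scale_cochain [a, b] [?e c 1, ?e c 2]"
    have v: "?v \<in> C i"
      using ab c(2)[of c] by (auto simp: lin_comb_2 intro!: C_closed dual_cochain_in_C)
    have "?v (\<one>\<^bsub>G\<^esub>, c) = a *s axis 1 1 + b *s axis 2 1"
      by (simp add: lin_comb_2 scale_cochain_def dual_cochain_eq)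
    then have at: "\<phi> (\<one>\<^bsub>G\<^esub>, c) = ?v (\<one>\<^bsub>G\<^esub>, c) \<longleftrightarrow>
        a = \<phi> (\<one>\<^bsub>G\<^esub>, c) $ 1 \<and> b = \<phi> (\<one>\<^bsub>G\<^esub>, c) $ 2"
      by (auto simp: vec2_eq_iff axis_def)
    have "\<phi> = ?v \<longleftrightarrow> \<phi> (\<one>\<^bsub>G\<^esub>, c) = ?v (\<one>\<^bsub>G\<^esub>, c)"
      using C_ext[OF \<phi> v] c(2) by auto
    then show ?thesis using at by simp
  qed
  have F: "\<phi> (\<one>\<^bsub>G\<^esub>, c) $ 1 \<in> F" "\<phi> (\<one>\<^bsub>G\<^esub>, c) $ 2 \<in> F"
    using C_plane[OF \<phi>, of "\<one>\<^bsub>G\<^esub>" c] by (simp_all add: mem_plane)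
  show ?thesis
    unfolding coords_def basis
  proof (rule the_equality)
    fix ks assume ks: "length ks = length [?e c 1, ?e c 2] \<and> set ks \<subseteq> F \<and>
      \<phi> = lin_comb scale_cochain ks [?e c 1, ?e c 2]"
    then obtain a b where "ks = [a, b]"
      by (auto simp: length_Suc_conv)
    then show "ks = [\<phi> (\<one>\<^bsub>G\<^esub>, c) $ 1, \<phi> (\<one>\<^bsub>G\<^esub>, c) $ 2]"
      using ks eq[of a b] by simp
  qed (use F eq in simp)
qed

lemma coords_two_cells:
  assumes \<phi>: "\<phi> \<in> C i" and c: "cells i = [c, d]" "\<And>c'. cell_dim c' = i \<longleftrightarrow> c' = c \<or> c' = d" "c \<noteq> d"
  shows "coords F scale_cochain (tw_basis l m n \<rho> i) \<phi>
    = [\<phi> (\<one>\<^bsub>G\<^esub>, c) $ 1, \<phi> (\<one>\<^bsub>G\<^esub>, c) $ 2, \<phi> (\<one>\<^bsub>G\<^esub>, d) $ 1, \<phi> (\<one>\<^bsub>G\<^esub>, d) $ 2]"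
proof -
  let ?e = "dual_cochain l m n \<rho>"
  let ?b = "[?e c 1, ?e c 2, ?e d 1, ?e d 2]"
  let ?cs = "[\<phi> (\<one>\<^bsub>G\<^esub>, c) $ 1, \<phi> (\<one>\<^bsub>G\<^esub>, c) $ 2, \<phi> (\<one>\<^bsub>G\<^esub>, d) $ 1, \<phi> (\<one>\<^bsub>G\<^esub>, d) $ 2]"
  have basis: "tw_basis l m n \<rho> i = ?b"
    using c(1) by (simp add: tw_basis_def)
  have eq: "\<phi> = lin_comb scale_cochain [k1, k2, k3, k4] ?b \<longleftrightarrow> [k1, k2, k3, k4] = ?cs"
    if k: "k1 \<in> F" "k2 \<in> F" "k3 \<in> F" "k4 \<in> F" for k1 k2 k3 k4
  proof -
    let ?v = "lin_comb scale_cochain [k1, k2, k3, k4] ?b"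
    have v: "?v \<in> C i"
      using k c(2)[of c] c(2)[of d] by (auto simp: lin_comb_4 intro!: C_closed dual_cochain_in_C)
    have "cell_dim c = i" "cell_dim d = i"
      using c(2) by blast+
    then have "?v (\<one>\<^bsub>G\<^esub>, c) = k1 *s axis 1 1 + k2 *s axis 2 1" "?v (\<one>\<^bsub>G\<^esub>, d) = k3 *s axis 1 1 + k4 *s axis 2 1"
      using c(3) by (simp_all add: lin_comb_4 scale_cochain_def dual_cochain_eq)
    then have at: "\<phi> (\<one>\<^bsub>G\<^esub>, c) = ?v (\<one>\<^bsub>G\<^esub>, c) \<and> \<phi> (\<one>\<^bsub>G\<^esub>, d) = ?v (\<one>\<^bsub>G\<^esub>, d) \<longleftrightarrow> [k1, k2, k3, k4] = ?cs"
      by (auto simp: vec2_eq_iff axis_def)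
    have "\<phi> = ?v \<longleftrightarrow> \<phi> (\<one>\<^bsub>G\<^esub>, c) = ?v (\<one>\<^bsub>G\<^esub>, c) \<and> \<phi> (\<one>\<^bsub>G\<^esub>, d) = ?v (\<one>\<^bsub>G\<^esub>, d)"
      using C_ext[OF \<phi> v] c(2) by auto
    then show ?thesis using at by simp
  qed
  have F: "set ?cs \<subseteq> F"
    using C_plane[OF \<phi>, of "\<one>\<^bsub>G\<^esub>"] by (simp add: mem_plane)
  show ?thesis
    unfolding coords_def basis
  proof (rule the_equality)
    fix ks assume ks: "length ks = length ?b \<and> set ks \<subseteq> F \<and> \<phi> = lin_comb scale_cochain ks ?b"
    then obtain k1 k2 k3 k4 where "ks = [k1, k2, k3, k4]"
      by (auto simp: length_Suc_conv)
    then show "ks = ?cs"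
      using ks eq[of k1 k2 k3 k4] by simp
  qed (use F eq in simp)
qed

lemma basis_change_one_cell:
  assumes "\<phi> \<in> C i" "\<theta> \<in> C i" and c: "cells i = [c]" "\<And>c'. cell_dim c' = i \<longleftrightarrow> c' = c"
  shows "basis_change F scale_cochain [\<phi>, \<theta>] (tw_basis l m n \<rho> i)
    = det2 (\<phi> (\<one>\<^bsub>G\<^esub>, c)) (\<theta> (\<one>\<^bsub>G\<^esub>, c))"
proof -
  have "length (tw_basis l m n \<rho> i) = 2"
    using c(1) by (simp add: tw_basis_def)
  then show ?thesis
    unfolding basis_change_def
    by (simp add: det_mat_2 coords_one_cell[OF assms(1) c] coords_one_cell[OF assms(2) c]
        det2_def mult.commute)
qed

lemma basis_change_two_cells:
  assumes bs: "set bs \<subseteq> C i" "length bs = 4"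
    and c: "cells i = [c, d]" "\<And>c'. cell_dim c' = i \<longleftrightarrow> c' = c \<or> c' = d" "c \<noteq> d"
  shows "basis_change F scale_cochain bs (tw_basis l m n \<rho> i)
    = block_det (map (\<lambda>\<phi>. (\<phi> (\<one>\<^bsub>G\<^esub>, c), \<phi> (\<one>\<^bsub>G\<^esub>, d))) bs)"
proof -
  have len: "length (tw_basis l m n \<rho> i) = 4"
    using c(1) by (simp add: tw_basis_def)
  have "mat 4 4 (\<lambda>(j, p). coords F scale_cochain (tw_basis l m n \<rho> i) (bs ! p) ! j)
    = mat 4 4 (\<lambda>(j, p). [fst (map (\<lambda>\<phi>. (\<phi> (\<one>\<^bsub>G\<^esub>, c), \<phi> (\<one>\<^bsub>G\<^esub>, d))) bs ! p) $ 1,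
        fst (map (\<lambda>\<phi>. (\<phi> (\<one>\<^bsub>G\<^esub>, c), \<phi> (\<one>\<^bsub>G\<^esub>, d))) bs ! p) $ 2,
        snd (map (\<lambda>\<phi>. (\<phi> (\<one>\<^bsub>G\<^esub>, c), \<phi> (\<one>\<^bsub>G\<^esub>, d))) bs ! p) $ 1,
        snd (map (\<lambda>\<phi>. (\<phi> (\<one>\<^bsub>G\<^esub>, c), \<phi> (\<one>\<^bsub>G\<^esub>, d))) bs ! p) $ 2] ! j)"
  proof (rule cong_mat)
    fix j p :: nat assume "j < 4" "p < 4"
    then have "bs ! p \<in> C i" "p < length bs"
      using bs by auto
    then show "(case (j, p) of (j, p) \<Rightarrow> coords F scale_cochain (tw_basis l m n \<rho> i) (bs ! p) ! j)
      = (case (j, p) of (j, p) \<Rightarrow> [fst (map (\<lambda>\<phi>. (\<phi> (\<one>\<^bsub>G\<^esub>, c), \<phi> (\<one>\<^bsub>G\<^esub>, d))) bs ! p) $ 1,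
        fst (map (\<lambda>\<phi>. (\<phi> (\<one>\<^bsub>G\<^esub>, c), \<phi> (\<one>\<^bsub>G\<^esub>, d))) bs ! p) $ 2,
        snd (map (\<lambda>\<phi>. (\<phi> (\<one>\<^bsub>G\<^esub>, c), \<phi> (\<one>\<^bsub>G\<^esub>, d))) bs ! p) $ 1,
        snd (map (\<lambda>\<phi>. (\<phi> (\<one>\<^bsub>G\<^esub>, c), \<phi> (\<one>\<^bsub>G\<^esub>, d))) bs ! p) $ 2] ! j)"
      by (simp add: coords_two_cells[OF _ c])
  qed simp_all
  then show ?thesis
    by (simp add: basis_change_def block_det_def len)
qed

end

section \<open>The duality pairing\<close>

context twisted_coefficients
begin

text \<open>
  The crossed homomorphism on the fundamental group with the values of \<open>\<phi>\<close> on the generators.  It does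
  not depend on the word chosen to represent \<open>x\<close>, by the vanishing on relators.
\<close>

definition primitive :: "cochain \<Rightarrow> word set \<Rightarrow> complex ^ 2" where
  "primitive \<phi> x = chain_value \<phi> (fox l m n (SOME w. x = word_class l m n w))"

lemma primitive_word_class:
  assumes "equivariant \<phi>"
  shows "primitive \<phi> (word_class l m n w) = chain_value \<phi> (fox l m n w)"
proof -
  have "word_class l m n w = word_class l m n (SOME v. word_class l m n w = word_class l m n v)"
    by (rule someI) (rule HOL.refl)
  then show ?thesis
    unfolding primitive_def by (metis value_fox_word_eq[OF assms] word_class_eq_iff)
qed

lemma primitive_mult:
  assumes "equivariant \<phi>" "x \<in> carrier G" "y \<in> carrier G"
  shows "primitive \<phi> (x \<otimes>\<^bsub>G\<^esub> y) = primitive \<phi> x + \<rho> x *v primitive \<phi> y"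
  using assms(2,3)
  by (elim pi1_cases) (simp add: primitive_word_class[OF assms(1)] value_fox_append[OF assms(1)])

lemma primitive_gen:
  assumes "equivariant \<phi>"
  shows "primitive \<phi> (word_class l m n [(a, True)]) = \<phi> (\<one>\<^bsub>G\<^esub>, Cell1 a)"
  by (simp add: primitive_word_class[OF assms] value_fox_Cons[OF assms] del: fox.simps(2))

text \<open>
  As a 0-cochain on the universal cover, the crossed homomorphism is not equivariant.  Up to sign
  it is a primitive of \<open>\<phi>\<close>; the universal cover is simply connected, so there has to be one.
\<close>

definition primitive_cochain :: "cochain \<Rightarrow> cochain" where
  "primitive_cochain \<phi> = (\<lambda>(x, c). if cell_dim c = 0 then primitive \<phi> x else 0)"

lemma primitive_boundary:
  assumes \<phi>: "\<phi> \<in> C 1" and x: "x \<in> carrier G"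
  shows "chain_value (primitive_cochain \<phi>) (boundary l m n (x, c)) = - \<phi> (x, c)"
proof (cases "cell_dim c = 1")
  case True
  then obtain a where c: "c = Cell1 a"
    by (auto simp: cell_dim_iff)
  note e = C_equivariant[OF \<phi>]
  have "chain_value (primitive_cochain \<phi>) (boundary l m n (x, c))
    = primitive \<phi> x - primitive \<phi> (x \<otimes>\<^bsub>G\<^esub> word_class l m n [(a, True)])"
    by (simp add: c boundary_def translate_def frag_extend_diff chain_value_diff
        primitive_cochain_def pi1_mult_one(1)[OF x])
  also have "\<dots> = - (\<rho> x *v \<phi> (\<one>\<^bsub>G\<^esub>, Cell1 a))"
    by (simp add: primitive_mult[OF e x] primitive_gen[OF e])
  finally show ?thesis
    using equivariant_at[OF e x, of c] by (simp add: c)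
next
  case False
  then have "chain_value (primitive_cochain \<phi>) (boundary l m n (x, c))
    = chain_value (\<lambda>p. 0) (boundary l m n (x, c))"
    using keys_boundary[OF x, of c] by (intro chain_value_cong) (auto simp: primitive_cochain_def)
  then show ?thesis
    using C_at_zero[OF \<phi> False] by simp
qed

lemma cocycle_boundary:
  assumes "\<theta> \<in> cocycles C \<delta> i" "x \<in> carrier G"
  shows "chain_value \<theta> (boundary l m n (x, c)) = 0"
proof -
  have "\<delta> \<theta> (x, c) = 0"
    using assms(1) by (simp add: cocycles_def)
  then show ?thesis
    using assms(2) by (simp add: tw_coboundary_def eval_cochain_chain_value)
qed

text \<open>
  The chain homotopy from the projection of the diagonal to the identity contributes two terms.
  One vanishes because \<open>\<theta>\<close> is a cocycle.  The other is the coboundary of a 1-cochain, evaluated on a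
  2-cell, and coboundaries of 1-cochains are zero here.
\<close>

lemma value_counit_left_diagonal:
  assumes D: "diagonal_approximation l m n D" and \<theta>: "\<theta> \<in> cocycles C \<delta> 2"
  shows "chain_value \<theta> (counit_left (D (\<one>\<^bsub>G\<^esub>, Cell2 R))) = \<theta> (\<one>\<^bsub>G\<^esub>, Cell2 R)"
proof -
  let ?c = "(\<one>\<^bsub>G\<^esub>, Cell2 R)"
  have e: "equivariant \<theta>"
    using \<theta> by (auto simp: cocycles_def intro: C_equivariant)
  have "homotopic_to_id l m n (\<lambda>p. counit_left (D p))"
    using D by (simp only: diagonal_approximation_def)
  then obtain s where "\<forall>x\<in>carrier G. \<forall>c.
     Poly_Mapping.keys (s (x, c)) \<subseteq> lifted_cells l m n (Suc (cell_dim c)) \<and>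
     (\<forall>y\<in>carrier G. s (y \<otimes>\<^bsub>G\<^esub> x, c) = translate l m n y (s (x, c))) \<and>
     counit_left (D (x, c)) - frag_of (x, c) =
       frag_extend (boundary l m n) (s (x, c)) + frag_extend s (boundary l m n (x, c))"
    unfolding homotopic_to_id_def by (elim exE)
  note s = this[THEN bspec, THEN spec]
  have keys: "Poly_Mapping.keys (s (x, c)) \<subseteq> carrier G \<times> UNIV" if "x \<in> carrier G" for x c
    using s[OF that, of c] by (auto simp: lifted_cells_def)
  let ?\<eta> = "\<lambda>p. chain_value \<theta> (s p)"
  have \<eta>: "equivariant ?\<eta>"
    unfolding equivariant_def using s keys by (auto simp: value_translate[OF e])
  have "counit_left (D ?c) = frag_of ?c
      + (frag_extend (boundary l m n) (s ?c) + frag_extend s (boundary l m n ?c))"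
    using s[of "\<one>\<^bsub>G\<^esub>" "Cell2 R"] by (metis add.commute diff_add_cancel pi1_one_closed)
  then have "chain_value \<theta> (counit_left (D ?c)) = \<theta> ?c
      + (chain_value (\<lambda>p. chain_value \<theta> (boundary l m n p)) (s ?c) + chain_value ?\<eta> (boundary l m n ?c))"
    by (simp add: chain_value_add chain_value_extend)
  moreover have "chain_value (\<lambda>p. chain_value \<theta> (boundary l m n p)) (s ?c) = chain_value (\<lambda>p. 0) (s ?c)"
    using keys[of "\<one>\<^bsub>G\<^esub>" "Cell2 R"]
    by (intro chain_value_cong) (auto intro: cocycle_boundary[OF \<theta>])
  moreover have "chain_value ?\<eta> (boundary l m n ?c) = 0"
    using value_boundary[OF \<eta>, of "\<one>\<^bsub>G\<^esub>" "Cell2 R"] value_cell_boundary(3)[OF \<eta>, of R]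
    by (simp del: cell_boundary.simps)
  ultimately show ?thesis by simp
qed

lemma linear_psi_value:
  "chain_value (\<lambda>p. psi (f p) w) u = psi (chain_value f u) w"
  "chain_value (\<lambda>p. psi w (f p)) u = psi w (chain_value f u)"
  by (rule chain_value_linear[OF linear_psi_left], rule chain_value_linear[OF linear_psi_right])

lemma diagonal_keys:
  assumes D: "diagonal_approximation l m n D" and "x \<in> carrier G"
  shows "Poly_Mapping.keys (D (x, c)) \<subseteq> (carrier G \<times> UNIV) \<times> (carrier G \<times> UNIV)"
proof -
  have "Poly_Mapping.keys (D (x, c)) \<subseteq>
      (\<Union>i\<le>cell_dim c. lifted_cells l m n i \<times> lifted_cells l m n (cell_dim c - i))"
    using assms unfolding diagonal_approximation_def by blast
  also have "\<dots> \<subseteq> (carrier G \<times> UNIV) \<times> (carrier G \<times> UNIV)"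
    by (auto simp: lifted_cells_def)
  finally show ?thesis .
qed

text \<open>
  The functional that pairs the primitive of \<open>\<phi>\<close> in the first factor with \<open>\<theta>\<close> in the second.
  Since \<open>\<theta>\<close> is a cocycle, its coboundary is the negative of the pairing of \<open>\<phi>\<close> with \<open>\<theta>\<close>.
\<close>

definition product_functional :: "cochain \<Rightarrow> cochain \<Rightarrow> lcell \<times> lcell \<Rightarrow> complex" where
  "product_functional \<phi> \<theta> = (\<lambda>(p, q). psi (primitive_cochain \<phi> p) (\<theta> q))"

context
  fixes D \<phi> \<theta>
  assumes D: "diagonal_approximation l m n D"
    and \<phi>: "\<phi> \<in> C 1" and \<theta>: "\<theta> \<in> cocycles C \<delta> 2"
begin

lemma product_functional_boundary2:
  assumes "x \<in> carrier G" "y \<in> carrier G"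
  shows "chain_value (product_functional \<phi> \<theta>) (boundary2 l m n ((x, c), (y, c'))) = - psi (\<phi> (x, c)) (\<theta> (y, c'))"
  by (simp add: boundary2_def chain_value_add chain_value_cmul chain_value_extend
      product_functional_def linear_psi_value primitive_boundary[OF \<phi>] cocycle_boundary[OF \<theta>]
      assms psi_minus_left psi_zero_right)

text \<open>
  The diagonal is a chain map, so the coboundary can be moved from the functional to the cell.
  What is left depends on the diagonal of the boundary only.
\<close>

lemma cup_psi_eq_product_functional:
  assumes "x \<in> carrier G"
  shows "cup_psi D \<phi> \<theta> (x, c)
    = - chain_value (\<lambda>p. chain_value (product_functional \<phi> \<theta>) (D p)) (boundary l m n (x, c))"
proof -
  have "cup_psi D \<phi> \<theta> (x, c) = chain_value (\<lambda>p. - chain_value (product_functional \<phi> \<theta>) (boundary2 l m n p)) (D (x, c))"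
    unfolding cup_psi_chain_value
    using diagonal_keys[OF D assms, of c] by (intro chain_value_cong) (auto simp: product_functional_boundary2)
  also have "\<dots> = - chain_value (\<lambda>p. chain_value (product_functional \<phi> \<theta>) (boundary2 l m n p)) (D (x, c))"
    by (simp add: chain_value_def sum_negf)
  also have "\<dots> = - chain_value (product_functional \<phi> \<theta>) (frag_extend (boundary2 l m n) (D (x, c)))"
    by (simp add: chain_value_extend)
  also have "frag_extend (boundary2 l m n) (D (x, c)) = frag_extend D (boundary l m n (x, c))"
    using D[unfolded diagonal_approximation_def, THEN conjunct1, THEN bspec, OF assms, THEN spec, of c]
    by (simp only:)
  finally show ?thesis
    by (simp add: chain_value_extend)
qed

text \<open>
  By unitarity the functional fails to be invariant only through the cocycle term
  \<open>\<phi> g\<close> in the value of the primitive on \<open>g x\<close>.  The defect pairs a constant vector with the second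
  factors over the 0-dimensional first factors, that is, with the left projection of the diagonal.
  Here the choice of the diagonal disappears.
\<close>

lemma product_functional_translate:
  "chain_value (product_functional \<phi> \<theta>) (D (word_class l m n [(a, True)], Cell2 R))
   = chain_value (product_functional \<phi> \<theta>) (D (\<one>\<^bsub>G\<^esub>, Cell2 R))
     + psi (\<phi> (\<one>\<^bsub>G\<^esub>, Cell1 a)) (rep [(a, True)] *v \<theta> (\<one>\<^bsub>G\<^esub>, Cell2 R))"
proof -
  let ?x = "word_class l m n [(a, True)]" and ?c = "(\<one>\<^bsub>G\<^esub>, Cell2 R)"
  note e = C_equivariant[OF \<phi>]
  have e\<theta>: "equivariant \<theta>"
    using \<theta> by (auto simp: cocycles_def intro: C_equivariant)
  have "D (?x, Cell2 R) = translate2 l m n ?x (D ?c)"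
    using D[unfolded diagonal_approximation_def, THEN conjunct1, THEN bspec, OF pi1_one_closed,
        THEN spec, of "Cell2 R", THEN conjunct2, THEN conjunct1, THEN bspec, OF word_class_in_pi1[of l m n "[(a, True)]"]]
      pi1_mult_one(1)[OF word_class_in_pi1, of l m n "[(a, True)]"] by (simp only:)
  then have "chain_value (product_functional \<phi> \<theta>) (D (?x, Cell2 R))
    = chain_value (\<lambda>p. chain_value (product_functional \<phi> \<theta>) ((\<lambda>((y, c), (z, c')).
        frag_of ((?x \<otimes>\<^bsub>G\<^esub> y, c), (?x \<otimes>\<^bsub>G\<^esub> z, c'))) p)) (D ?c)"
    by (simp only: translate2_def chain_value_extend)
  also have "\<dots> = chain_value (\<lambda>p. product_functional \<phi> \<theta> p
        + psi (\<phi> (\<one>\<^bsub>G\<^esub>, Cell1 a)) (rep [(a, True)] *v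
            (if cell_dim (snd (fst p)) = 0 then \<theta> (snd p) else 0))) (D ?c)"
  proof (rule chain_value_cong)
    fix p assume "p \<in> Poly_Mapping.keys (D ?c)"
    then obtain y c z c' where p: "p = ((y, c), (z, c'))" "y \<in> carrier G" "z \<in> carrier G"
      using subsetD[OF diagonal_keys[OF D pi1_one_closed]] by (metis SigmaE)
    have \<theta>z: "\<theta> (?x \<otimes>\<^bsub>G\<^esub> z, c') = rep [(a, True)] *v \<theta> (z, c')"
      using e\<theta>[unfolded equivariant_def, THEN bspec, OF word_class_in_pi1] p(3) by blast
    have prim: "primitive \<phi> (?x \<otimes>\<^bsub>G\<^esub> y) = \<phi> (\<one>\<^bsub>G\<^esub>, Cell1 a) + rep [(a, True)] *v primitive \<phi> y"
      by (simp add: primitive_mult[OF e _ p(2)] primitive_gen[OF e])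
    show "chain_value (product_functional \<phi> \<theta>) ((\<lambda>((y, c), (z, c')).
        frag_of ((?x \<otimes>\<^bsub>G\<^esub> y, c), (?x \<otimes>\<^bsub>G\<^esub> z, c'))) p)
      = product_functional \<phi> \<theta> p + psi (\<phi> (\<one>\<^bsub>G\<^esub>, Cell1 a)) (rep [(a, True)] *v
          (if cell_dim (snd (fst p)) = 0 then \<theta> (snd p) else 0))"
      by (simp add: p(1) product_functional_def primitive_cochain_def \<theta>z prim psi_add_left
          SU2_psi[OF rep_SU2] psi_zero_left psi_zero_right)
  qed
  also have "\<dots> = chain_value (product_functional \<phi> \<theta>) (D ?c) + psi (\<phi> (\<one>\<^bsub>G\<^esub>, Cell1 a))
      (rep [(a, True)] *v chain_value (\<lambda>p. if cell_dim (snd (fst p)) = 0 then \<theta> (snd p) else 0) (D ?c))"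
    by (simp only: chain_value_fun_add linear_psi_value chain_value_linear[OF linear_mult2])
  also have "chain_value (\<lambda>p. if cell_dim (snd (fst p)) = 0 then \<theta> (snd p) else 0) (D ?c)
      = chain_value \<theta> (counit_left (D ?c))"
    unfolding counit_left_def chain_value_extend by (rule chain_value_cong) auto
  finally show ?thesis
    by (simp add: value_counit_left_diagonal[OF D \<theta>])
qed

lemma cup_psi_fundamental_cell:
  "cup_psi D \<phi> \<theta> (\<one>\<^bsub>G\<^esub>, Cell3) = psi (\<phi> (\<one>\<^bsub>G\<^esub>, Cell1 Gen_h)) (B *v \<theta> (\<one>\<^bsub>G\<^esub>, Cell2 Rel_r))
     + psi (\<phi> (\<one>\<^bsub>G\<^esub>, Cell1 Gen_g)) (A *v \<theta> (\<one>\<^bsub>G\<^esub>, Cell2 Rel_s))"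
proof -
  have "boundary l m n (\<one>\<^bsub>G\<^esub>, Cell3) = cell_boundary l m n Cell3"
    by (simp add: boundary_def translate_def frag_extend_add frag_extend_diff pi1_mult_one)
  then show ?thesis
    by (simp add: cup_psi_eq_product_functional chain_value_add chain_value_diff
        product_functional_translate)
qed

text \<open>
  The cochain \<open>\<phi>\<close> is the coboundary of \<open>u\<close> plus a cochain supported on \<open>h\<close>.  By unitarity the
  coboundary contributes the pairing of \<open>u\<close> with the left-hand side of the cocycle equation of \<open>\<theta>\<close>.
\<close>

lemma cup_psi_H1_coord:
  "cup_psi D \<phi> \<theta> (\<one>\<^bsub>G\<^esub>, Cell3) = psi (H1_coord \<phi>) (B *v \<theta> (\<one>\<^bsub>G\<^esub>, Cell2 Rel_r))"
proof -
  define u where "u = inv_one_minus_A *v \<phi> (\<one>\<^bsub>G\<^esub>, Cell1 Gen_g)"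
  let ?x = "\<theta> (\<one>\<^bsub>G\<^esub>, Cell2 Rel_r)" and ?y = "\<theta> (\<one>\<^bsub>G\<^esub>, Cell2 Rel_s)"
  have g: "\<phi> (\<one>\<^bsub>G\<^esub>, Cell1 Gen_g) = u - A *v u"
    using inv_one_minus_A(1)[of "\<phi> (\<one>\<^bsub>G\<^esub>, Cell1 Gen_g)", folded u_def]
    by (simp add: matrix_vector_mult_diff_rdistrib)
  have h: "\<phi> (\<one>\<^bsub>G\<^esub>, Cell1 Gen_h) = H1_coord \<phi> + (u - B *v u)"
    by (simp add: H1_coord_def u_def matrix_vector_mult_diff_rdistrib)
  have \<theta>0: "(?x - B *v ?x) + (?y - A *v ?y) = 0"
    using \<theta> unfolding cocycles_2 by (simp add: matrix_vector_mult_diff_rdistrib)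
  have "cup_psi D \<phi> \<theta> (\<one>\<^bsub>G\<^esub>, Cell3) = psi (H1_coord \<phi>) (B *v ?x)
      - psi u ((?x - B *v ?x) + (?y - A *v ?y))"
    unfolding cup_psi_fundamental_cell g h
    by (simp add: psi_add_left psi_add_right psi_diff_left psi_diff_right SU2_psi[OF rep_SU2])
  then show ?thesis
    by (simp add: \<theta>0 psi_zero_right)
qed

end

end

section \<open>Dual bases\<close>

text \<open>
  The determinant of the Gram matrix is the product of the determinants, one of them conjugated.
\<close>

lemma psi_gram:
  "psi w1 x1 * psi w2 x2 - psi w1 x2 * psi w2 x1 = cnj (det2 w1 w2) * det2 x1 x2"
  by (simp add: psi_def det2_def sum_2 algebra_simps)

lemma psi_scale: "psi (a *s v) (b *s w) = cnj a * b * psi v w"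
  by (simp add: psi_def sum_2 algebra_simps)

lemma psi_nondegenerate:
  assumes D: "det2 w1 w2 \<noteq> 0" and y: "psi w1 y = psi w1 y'" "psi w2 y = psi w2 y'"
  shows "y = y'"
proof -
  have "psi w1 (y - y') = 0" "psi w2 (y - y') = 0"
    by (simp_all add: psi_diff_right y)
  then have "cnj (det2 w1 w2) * det2 (y - y') x = 0" for x
    using psi_gram[of w1 "y - y'" w2 x] by simp
  then have "det2 (y - y') x = 0" for x
    using D by simp
  from this[of "axis 1 1"] this[of "axis 2 1"] show ?thesis
    by (simp add: det2_def axis_def vec2_eq_iff)
qed

lemma psi_dual_vectors:
  assumes D: "det2 w1 w2 \<noteq> 0"
  obtains y1 y2 where "psi w1 y1 = 1" "psi w1 y2 = 0" "psi w2 y1 = 0" "psi w2 y2 = 1"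
    and "\<And>K. is_subfield K \<Longrightarrow> (\<And>x. x \<in> K \<Longrightarrow> cnj x \<in> K) \<Longrightarrow> w1 \<in> plane K \<Longrightarrow> w2 \<in> plane K
      \<Longrightarrow> y1 \<in> plane K \<and> y2 \<in> plane K"
proof
  \<comment> \<open>The columns of the inverse of the conjugate transpose, by Cramer's rule.\<close>
  let ?d = "inverse (cnj (det2 w1 w2))"
  let ?y1 = "(\<chi> i. if i = 1 then ?d * cnj (w2 $ 2) else - (?d * cnj (w2 $ 1))) :: complex ^ 2"
  let ?y2 = "(\<chi> i. if i = 1 then - (?d * cnj (w1 $ 2)) else ?d * cnj (w1 $ 1)) :: complex ^ 2"
  have "?d * cnj (det2 w1 w2) = 1"
    using D by simp
  then have d: "?d * (cnj (w1 $ 1) * cnj (w2 $ 2) - cnj (w1 $ 2) * cnj (w2 $ 1)) = 1"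
    by (simp add: det2_def)
  show "psi w1 ?y1 = 1" "psi w2 ?y2 = 1" "psi w1 ?y2 = 0" "psi w2 ?y1 = 0"
    using d by (simp_all add: psi_def sum_2 algebra_simps)
  show "?y1 \<in> plane K \<and> ?y2 \<in> plane K"
    if "is_subfield K" "\<And>x. x \<in> K \<Longrightarrow> cnj x \<in> K" "w1 \<in> plane K" "w2 \<in> plane K" for K
    using that(2-4) unfolding mem_plane det2_def
    by (auto intro!: subfield_closed[OF that(1)])
qed

lemma sign_square: "\<sigma> \<in> {1, -1} \<Longrightarrow> of_int \<sigma> * of_int \<sigma> = (1 :: complex)"
  by auto

lemma sign_mult_eq_1_iff: "\<sigma> \<in> {1, -1} \<Longrightarrow> of_int \<sigma> * z = (1 :: complex) \<longleftrightarrow> z = of_int \<sigma>"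
  by (cases "\<sigma> = 1"; auto simp: minus_equation_iff[of z 1])

context twisted_coefficients
begin

lemma cohomology_basis_iff:
  assumes q: "linear_quotient F scale_cochain (coboundaries C \<delta> i) (cocycles C \<delta> i) (*s) (plane F) w"
  shows "cohomology_basis F scale_cochain C \<delta> i hs \<longleftrightarrow>
    (\<exists>z1\<in>cocycles C \<delta> i. \<exists>z2\<in>cocycles C \<delta> i.
       hs = [coh_class C \<delta> i z1, coh_class C \<delta> i z2] \<and> det2 (w z1) (w z2) \<noteq> 0)"
proof
  assume "cohomology_basis F scale_cochain C \<delta> i hs"
  then obtain zs where zs: "hs = map (coh_class C \<delta> i) zs"
      "basis_modulo F scale_cochain (coboundaries C \<delta> i) (cocycles C \<delta> i) zs"
    by (auto simp: cohomology_basis_def)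
  then have "set zs \<subseteq> cocycles C \<delta> i"
    by (simp add: basis_modulo_def)
  moreover from this have "basis_of F (*s) (plane F) (map w zs)"
    using linear_quotient_basis[OF q] zs(2) by blast
  then obtain v1 v2 where "map w zs = [v1, v2]" "det2 v1 v2 \<noteq> 0"
    unfolding basis_plane_iff[OF subfield] by (elim exE conjE)
  moreover from this obtain z1 z2 where "zs = [z1, z2]" "v1 = w z1" "v2 = w z2"
    by (auto simp: map_eq_Cons_conv)
  ultimately show "\<exists>z1\<in>cocycles C \<delta> i. \<exists>z2\<in>cocycles C \<delta> i.
       hs = [coh_class C \<delta> i z1, coh_class C \<delta> i z2] \<and> det2 (w z1) (w z2) \<noteq> 0"
    using zs(1) by (intro bexI[of _ z1] bexI[of _ z2]) auto
next
  assume "\<exists>z1\<in>cocycles C \<delta> i. \<exists>z2\<in>cocycles C \<delta> i.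
       hs = [coh_class C \<delta> i z1, coh_class C \<delta> i z2] \<and> det2 (w z1) (w z2) \<noteq> 0"
  then obtain z1 z2 where z: "z1 \<in> cocycles C \<delta> i" "z2 \<in> cocycles C \<delta> i"
      "hs = [coh_class C \<delta> i z1, coh_class C \<delta> i z2]" "det2 (w z1) (w z2) \<noteq> 0"
    by blast
  have "w z1 \<in> plane F" "w z2 \<in> plane F"
    using q z(1,2) by (auto simp: linear_quotient_def)
  then have "basis_modulo F scale_cochain (coboundaries C \<delta> i) (cocycles C \<delta> i) [z1, z2]"
    using z linear_quotient_basis[OF q, of "[z1, z2]"] by (simp add: basis_plane_iff[OF subfield])
  then show "cohomology_basis F scale_cochain C \<delta> i hs"
    unfolding cohomology_basis_def using z(3) by (intro exI[of _ "[z1, z2]"]) simp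
qed

lemma coh_class_1: "\<phi> \<in> C 1 \<Longrightarrow> coh_class C \<delta> 1 \<phi> = {\<phi>' \<in> C 1. H1_coord \<phi>' = H1_coord \<phi>}"
  using linear_quotient_coset[OF quotient_H1] unfolding coh_class_def cocycles_1 by blast

lemma coh_class_2: "coh_class C \<delta> 2 \<theta> = {\<theta>}"
  by (simp add: coh_class_def coboundaries_2)

lemma duality_pairing_eq:
  assumes D: "diagonal_approximation l m n D" and \<phi>: "\<phi> \<in> C 1" and \<theta>: "\<theta> \<in> cocycles C \<delta> 2"
  shows "duality_pairing l m n D \<sigma> (coh_class C \<delta> 1 \<phi>) (coh_class C \<delta> 2 \<theta>)
    = of_int \<sigma> * psi (H1_coord \<phi>) (B *v \<theta> (\<one>\<^bsub>G\<^esub>, Cell2 Rel_r))"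
  unfolding duality_pairing_def coh_class_1[OF \<phi>] coh_class_2
proof (rule the_equality)
  show "\<forall>\<phi>'\<in>{\<phi>' \<in> C 1. H1_coord \<phi>' = H1_coord \<phi>}. \<forall>\<theta>'\<in>{\<theta>}.
      of_int \<sigma> * psi (H1_coord \<phi>) (B *v \<theta> (\<one>\<^bsub>G\<^esub>, Cell2 Rel_r))
      = of_int \<sigma> * cup_psi D \<phi>' \<theta>' (\<one>\<^bsub>G\<^esub>, Cell3)"
    using cup_psi_H1_coord[OF D _ \<theta>] by simp
next
  fix t
  assume "\<forall>\<phi>'\<in>{\<phi>' \<in> C 1. H1_coord \<phi>' = H1_coord \<phi>}. \<forall>\<theta>'\<in>{\<theta>}.
      t = of_int \<sigma> * cup_psi D \<phi>' \<theta>' (\<one>\<^bsub>G\<^esub>, Cell3)"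
  then have "t = of_int \<sigma> * cup_psi D \<phi> \<theta> (\<one>\<^bsub>G\<^esub>, Cell3)"
    using \<phi> by blast
  then show "t = of_int \<sigma> * psi (H1_coord \<phi>) (B *v \<theta> (\<one>\<^bsub>G\<^esub>, Cell2 Rel_r))"
    by (simp add: cup_psi_H1_coord[OF D \<phi> \<theta>])
qed

text \<open>
  The condition on representatives for their classes to form the dual basis, with the sign
  \<open>\<sigma>\<close>, which is its own inverse, moved to the right-hand sides.
\<close>

definition dual_pair :: "int \<Rightarrow> cochain \<Rightarrow> cochain \<Rightarrow> cochain \<Rightarrow> cochain \<Rightarrow> bool" where
  "dual_pair \<sigma> \<phi>1 \<phi>2 \<theta>1 \<theta>2 \<longleftrightarrow> \<theta>1 \<in> cocycles C \<delta> 2 \<and> \<theta>2 \<in> cocycles C \<delta> 2 \<and>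
     psi (H1_coord \<phi>1) (B *v \<theta>1 (\<one>\<^bsub>G\<^esub>, Cell2 Rel_r)) = of_int \<sigma> \<and>
     psi (H1_coord \<phi>1) (B *v \<theta>2 (\<one>\<^bsub>G\<^esub>, Cell2 Rel_r)) = 0 \<and>
     psi (H1_coord \<phi>2) (B *v \<theta>1 (\<one>\<^bsub>G\<^esub>, Cell2 Rel_r)) = 0 \<and>
     psi (H1_coord \<phi>2) (B *v \<theta>2 (\<one>\<^bsub>G\<^esub>, Cell2 Rel_r)) = of_int \<sigma>"

context
  fixes \<sigma> :: int and \<phi>1 \<phi>2
  assumes \<sigma>: "\<sigma> \<in> {1, -1}"
    and \<phi>: "\<phi>1 \<in> C 1" "\<phi>2 \<in> C 1" and ind: "det2 (H1_coord \<phi>1) (H1_coord \<phi>2) \<noteq> 0"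
begin

text \<open>
  The Gram matrix of the coordinates of a basis with the images under \<open>B\<close> of those of its dual is
  \<open>\<sigma>\<close> times the identity, and both \<open>B\<close> and this matrix have determinant one.
\<close>

lemma dual_pair_det:
  assumes "dual_pair \<sigma> \<phi>1 \<phi>2 \<theta>1 \<theta>2"
  shows "cnj (det2 (H1_coord \<phi>1) (H1_coord \<phi>2))
    * det2 (\<theta>1 (\<one>\<^bsub>G\<^esub>, Cell2 Rel_r)) (\<theta>2 (\<one>\<^bsub>G\<^esub>, Cell2 Rel_r)) = 1"
proof -
  have "det2 (\<theta>1 (\<one>\<^bsub>G\<^esub>, Cell2 Rel_r)) (\<theta>2 (\<one>\<^bsub>G\<^esub>, Cell2 Rel_r))
    = det2 (B *v \<theta>1 (\<one>\<^bsub>G\<^esub>, Cell2 Rel_r)) (B *v \<theta>2 (\<one>\<^bsub>G\<^esub>, Cell2 Rel_r))"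
    by (simp add: det2_mult rep_det)
  then show ?thesis
    using assms unfolding dual_pair_def by (simp add: psi_gram[symmetric] sign_square[OF \<sigma>])
qed

lemma is_dual_basis_iff:
  assumes D: "diagonal_approximation l m n D"
  shows "is_dual_basis l m n F \<rho> D \<sigma> [coh_class C \<delta> 1 \<phi>1, coh_class C \<delta> 1 \<phi>2] ks \<longleftrightarrow>
     (\<exists>\<theta>1 \<theta>2. ks = [coh_class C \<delta> 2 \<theta>1, coh_class C \<delta> 2 \<theta>2] \<and> dual_pair \<sigma> \<phi>1 \<phi>2 \<theta>1 \<theta>2)" (is "?L \<longleftrightarrow> ?R")
proof -
  let ?hs = "[coh_class C \<delta> 1 \<phi>1, coh_class C \<delta> 1 \<phi>2]"
  have two: "(\<forall>i<2. Q i) \<longleftrightarrow> Q 0 \<and> Q 1" for Q :: "nat \<Rightarrow> bool"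
    by (auto simp: less_2_cases_iff)
  have pair: "(\<forall>i<length ?hs. \<forall>j<length [coh_class C \<delta> 2 \<theta>1, coh_class C \<delta> 2 \<theta>2].
      duality_pairing l m n D \<sigma> (?hs ! i) ([coh_class C \<delta> 2 \<theta>1, coh_class C \<delta> 2 \<theta>2] ! j)
        = (if i = j then 1 else 0)) \<longleftrightarrow> dual_pair \<sigma> \<phi>1 \<phi>2 \<theta>1 \<theta>2"
    if "\<theta>1 \<in> cocycles C \<delta> 2" "\<theta>2 \<in> cocycles C \<delta> 2" for \<theta>1 \<theta>2
    using that \<sigma> by (auto simp add: two numeral_2_eq_2[symmetric] dual_pair_def
        duality_pairing_eq[OF D] \<phi> sign_mult_eq_1_iff simp del: One_nat_def)
  show ?thesis
  proof
    assume L: ?L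
    then obtain \<theta>1 \<theta>2 where \<theta>: "\<theta>1 \<in> cocycles C \<delta> 2" "\<theta>2 \<in> cocycles C \<delta> 2"
        "ks = [coh_class C \<delta> 2 \<theta>1, coh_class C \<delta> 2 \<theta>2]"
      unfolding is_dual_basis_def tw_cohomology_basis_def cohomology_basis_iff[OF quotient_H2] by blast
    then have "dual_pair \<sigma> \<phi>1 \<phi>2 \<theta>1 \<theta>2"
      using L pair[OF \<theta>(1,2)] unfolding is_dual_basis_def by blast
    then show ?R using \<theta>(3) by blast
  next
    assume ?R
    then obtain \<theta>1 \<theta>2 where ks: "ks = [coh_class C \<delta> 2 \<theta>1, coh_class C \<delta> 2 \<theta>2]" and dp: "dual_pair \<sigma> \<phi>1 \<phi>2 \<theta>1 \<theta>2"
      by blast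
    have \<theta>: "\<theta>1 \<in> cocycles C \<delta> 2" "\<theta>2 \<in> cocycles C \<delta> 2"
      using dp by (simp_all add: dual_pair_def)
    have "det2 (\<theta>1 (\<one>\<^bsub>G\<^esub>, Cell2 Rel_r)) (\<theta>2 (\<one>\<^bsub>G\<^esub>, Cell2 Rel_r)) \<noteq> 0"
      using dual_pair_det[OF dp] by auto
    then have "tw_cohomology_basis l m n F \<rho> 2 ks"
      unfolding tw_cohomology_basis_def cohomology_basis_iff[OF quotient_H2] using \<theta> ks by blast
    then show ?L
      using pair[OF \<theta>] dp unfolding is_dual_basis_def ks by simp
  qed
qed

lemma dual_pair_unique:
  assumes "dual_pair \<sigma> \<phi>1 \<phi>2 \<theta>1 \<theta>2" "dual_pair \<sigma> \<phi>1 \<phi>2 \<theta>1' \<theta>2'"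
  shows "\<theta>1 = \<theta>1' \<and> \<theta>2 = \<theta>2'"
proof -
  have inj: "\<theta> = \<theta>'" if "\<theta> \<in> cocycles C \<delta> 2" "\<theta>' \<in> cocycles C \<delta> 2"
    "B *v \<theta> (\<one>\<^bsub>G\<^esub>, Cell2 Rel_r) = B *v \<theta>' (\<one>\<^bsub>G\<^esub>, Cell2 Rel_r)" for \<theta> \<theta>'
    using linear_quotient_coset[OF quotient_H2 that(1)] that(2) rep_inj[OF that(3)]
    by (auto simp: coboundaries_2)
  show ?thesis
    using assms unfolding dual_pair_def
    by (intro conjI inj psi_nondegenerate[OF ind]) simp_all
qed

lemma dual_pair_exists: "\<exists>\<theta>1 \<theta>2. dual_pair \<sigma> \<phi>1 \<phi>2 \<theta>1 \<theta>2"
proof -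
  have H1: "H1_coord \<phi>1 \<in> plane F" "H1_coord \<phi>2 \<in> plane F"
    using quotient_H1 \<phi> unfolding linear_quotient_def cocycles_1 by blast+
  obtain y1 y2 where y: "psi (H1_coord \<phi>1) y1 = 1" "psi (H1_coord \<phi>1) y2 = 0"
      "psi (H1_coord \<phi>2) y1 = 0" "psi (H1_coord \<phi>2) y2 = 1" and yF: "y1 \<in> plane F" "y2 \<in> plane F"
    using psi_dual_vectors[OF ind] subfield cnj_closed H1 by (metis (no_types, lifting))
  have lift: "\<exists>\<theta>\<in>cocycles C \<delta> 2. B *v \<theta> (\<one>\<^bsub>G\<^esub>, Cell2 Rel_r) = of_int \<sigma> *s y" if "y \<in> plane F" for y
  proof -
    have "of_int \<sigma> \<in> F"
      using \<sigma> subfield_closed[OF subfield] by auto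
    then have "rep [(Gen_h, False)] *v (of_int \<sigma> *s y) \<in> plane F"
      using that by (intro plane_closed[OF subfield] rep_entry) simp_all
    then have "rep [(Gen_h, False)] *v (of_int \<sigma> *s y) \<in> (\<lambda>\<theta>. \<theta> (\<one>\<^bsub>G\<^esub>, Cell2 Rel_r)) ` cocycles C \<delta> 2"
      using quotient_H2 unfolding linear_quotient_def by simp
    then obtain \<theta> where "\<theta> \<in> cocycles C \<delta> 2"
        "\<theta> (\<one>\<^bsub>G\<^esub>, Cell2 Rel_r) = rep [(Gen_h, False)] *v (of_int \<sigma> *s y)"
      by (elim imageE) simp
    then show ?thesis
      using rep_inverse[of Gen_h True] by (intro bexI[of _ \<theta>]) (simp_all add: matrix_vector_mul_assoc)
  qed
  obtain \<theta>1 where "\<theta>1 \<in> cocycles C \<delta> 2" "B *v \<theta>1 (\<one>\<^bsub>G\<^esub>, Cell2 Rel_r) = of_int \<sigma> *s y1"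
    using lift[OF yF(1)] by blast
  moreover obtain \<theta>2 where "\<theta>2 \<in> cocycles C \<delta> 2" "B *v \<theta>2 (\<one>\<^bsub>G\<^esub>, Cell2 Rel_r) = of_int \<sigma> *s y2"
    using lift[OF yF(2)] by blast
  ultimately have "dual_pair \<sigma> \<phi>1 \<phi>2 \<theta>1 \<theta>2"
    using y psi_scale[of 1 "H1_coord \<phi>1" "of_int \<sigma>"] psi_scale[of 1 "H1_coord \<phi>2" "of_int \<sigma>"]
    by (simp add: dual_pair_def)
  then show ?thesis by blast
qed

end

section \<open>The torsion\<close>

lemma prod_atMost_3: "(\<Prod>i\<le>(3::nat). f i) = f 0 * f 1 * f 2 * f 3"
  for f :: "nat \<Rightarrow> complex"
  by (simp add: eval_nat_numeral)

lemma basis_coboundaries_1_iff: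
  assumes "t1 \<in> C 0" "t2 \<in> C 0"
  shows "basis_of F scale_cochain (coboundaries C \<delta> 1) [\<delta> t1, \<delta> t2]
    \<longleftrightarrow> det2 (t1 (\<one>\<^bsub>G\<^esub>, Cell0)) (t2 (\<one>\<^bsub>G\<^esub>, Cell0)) \<noteq> 0"
proof -
  have sub: "set [\<delta> t1, \<delta> t2] \<subseteq> coboundaries C \<delta> 1"
    using assms by (auto simp: coboundaries_def)
  have "inv_one_minus_A *v \<delta> t (\<one>\<^bsub>G\<^esub>, Cell1 Gen_g) = t (\<one>\<^bsub>G\<^esub>, Cell0)" if "t \<in> C 0" for t
    by (simp add: coboundary_0[OF that] inv_one_minus_A)
  then show ?thesis
    using assms C_plane[OF assms(1)] C_plane[OF assms(2)]
    by (simp add: linear_quotient_basis[OF quotient_coboundaries_1 sub] basis_plane_iff[OF subfield]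
        del: One_nat_def)
qed

lemma basis_coboundaries_3_iff:
  assumes "s1 \<in> C 2" "s2 \<in> C 2"
  shows "basis_of F scale_cochain (coboundaries C \<delta> 3) [\<delta> s1, \<delta> s2]
    \<longleftrightarrow> det2 (\<delta> s1 (\<one>\<^bsub>G\<^esub>, Cell3)) (\<delta> s2 (\<one>\<^bsub>G\<^esub>, Cell3)) \<noteq> 0"
proof -
  have sub: "set [\<delta> s1, \<delta> s2] \<subseteq> coboundaries C \<delta> 3"
    unfolding coboundaries_3 using assms coboundary_2_in_C by auto
  show ?thesis
    using C_plane[OF coboundary_2_in_C[OF assms(1)]] C_plane[OF coboundary_2_in_C[OF assms(2)]]
    by (simp add: linear_quotient_basis[OF quotient_coboundaries_3 sub] basis_plane_iff[OF subfield])
qed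

lemma basis_coboundaries_length:
  assumes "basis_of F scale_cochain (coboundaries C \<delta> i) bs" "i = 1 \<or> i = 3"
  shows "length bs = 2"
proof -
  have "\<exists>w. linear_quotient F scale_cochain {0} (coboundaries C \<delta> i) (*s) (plane F) w"
    using assms(2) quotient_coboundaries_1 quotient_coboundaries_3 by blast
  then obtain w where w: "linear_quotient F scale_cochain {0} (coboundaries C \<delta> i) (*s) (plane F) w" ..
  have "set bs \<subseteq> coboundaries C \<delta> i"
    using assms(1) by (simp add: basis_modulo_def)
  then have "basis_of F (*s) (plane F) (map w bs)"
    using linear_quotient_basis[OF w] assms(1) by blast
  then show ?thesis
    using basis_plane_length[OF subfield] by fastforce
qed

context
  fixes \<phi>1 \<phi>2 \<theta>1 \<theta>2 :: cochain and h :: "nat \<Rightarrow> cochain set list"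
  assumes \<phi>: "\<phi>1 \<in> C 1" "\<phi>2 \<in> C 1"
    and \<theta>: "\<theta>1 \<in> cocycles C \<delta> 2" "\<theta>2 \<in> cocycles C \<delta> 2"
    and h: "h = (\<lambda>i. if i = 1 then [coh_class C \<delta> 1 \<phi>1, coh_class C \<delta> 1 \<phi>2]
      else if i = 2 then [coh_class C \<delta> 2 \<theta>1, coh_class C \<delta> 2 \<theta>2] else [])"
begin

text \<open>
  The bases chosen for the coboundaries and the lifts cancel.  In degree 1 the base change is
  \<open>det (1 - A)\<close> times the base change in degree 0 times the determinant of the \<open>H1\<close>-coordinates, which are unaffected by
  the choice of representatives.  In degree 2, the factor \<open>det (1 - A)\<close> multiplies the base change to the base
  change in degree 3 times the determinant of the values on \<open>r\<close>.
\<close>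

lemma torsion_value_eq:
  assumes t: "torsion_value F scale_cochain 3 C \<delta> (tw_basis l m n \<rho>) h t"
  shows "t = (Determinants.det (one_mat - A))\<^sup>2 * det2 (H1_coord \<phi>1) (H1_coord \<phi>2)
    / det2 (\<theta>1 (\<one>\<^bsub>G\<^esub>, Cell2 Rel_r)) (\<theta>2 (\<one>\<^bsub>G\<^esub>, Cell2 Rel_r))"
proof -
  obtain b bt ht where
    b: "\<And>i. i \<le> Suc 3 \<Longrightarrow> basis_of F scale_cochain (coboundaries C \<delta> i) (b i)"
    and bt: "\<And>i. i \<le> 3 \<Longrightarrow> set (bt (Suc i)) \<subseteq> C i \<and> map \<delta> (bt (Suc i)) = b (Suc i)"
    and ht: "\<And>i. i \<le> 3 \<Longrightarrow> set (ht i) \<subseteq> cocycles C \<delta> i \<and> map (coh_class C \<delta> i) (ht i) = h i"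
    and t_eq: "t = (\<Prod>i\<le>3. basis_change F scale_cochain (b i @ ht i @ bt (Suc i)) (tw_basis l m n \<rho> i)
      powi ((-1) ^ Suc i))"
    using t unfolding torsion_value_def by blast
  have zero: "basis_of F scale_cochain {0} bs \<Longrightarrow> bs = []" for bs
    by (simp add: basis_of_zero_iff[OF subfield])
  have b0: "b 0 = []"
    using b[of 0] zero by (simp add: coboundaries_def)
  have b2: "b 2 = []"
    using b[of 2] zero by (simp add: coboundaries_2)
  have b4: "b (Suc 3) = []"
    using b[of "Suc 3"] zero by (simp only: coboundaries_4)
  have bt2: "bt (Suc 1) = []" and bt4: "bt (Suc 3) = []"
    using bt[of 1] bt[of 3] b2 b4 by (simp_all add: numeral_2_eq_2)
  have ht0: "ht 0 = []" and ht3: "ht 3 = []"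
    using ht[of 0] ht[of 3] by (simp_all add: h)
  have "length (bt (Suc 0)) = length (b 1)" "length (bt (Suc 2)) = length (b 3)"
    using arg_cong[OF conjunct2[OF bt[of 0]], of length] arg_cong[OF conjunct2[OF bt[of 2]], of length]
    by simp_all
  then have len: "length (bt (Suc 0)) = 2" "length (bt (Suc 2)) = 2"
    using basis_coboundaries_length[OF b[of 1]] basis_coboundaries_length[OF b[of 3]] by simp_all
  then obtain t1 t2 where bt1: "bt (Suc 0) = [t1, t2]"
    using len(1) by (auto simp: numeral_2_eq_2 length_Suc_conv)
  then have t12: "t1 \<in> C 0" "t2 \<in> C 0" and b1: "b 1 = [\<delta> t1, \<delta> t2]"
    using bt[of 0] by auto
  obtain s1 s2 where bt3: "bt (Suc 2) = [s1, s2]"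
    using len(2) by (auto simp: numeral_2_eq_2 length_Suc_conv)
  then have s12: "s1 \<in> C 2" "s2 \<in> C 2" and b3: "b 3 = [\<delta> s1, \<delta> s2]"
    using bt[of 2] by (auto simp: eval_nat_numeral)
  obtain p1 p2 where ht1: "ht 1 = [p1, p2]"
    using ht[of 1] by (auto simp: h map_eq_Cons_conv)
  then have p12: "p1 \<in> C 1" "p2 \<in> C 1"
      and "coh_class C \<delta> 1 p1 = coh_class C \<delta> 1 \<phi>1" "coh_class C \<delta> 1 p2 = coh_class C \<delta> 1 \<phi>2"
    using ht[of 1] unfolding h cocycles_1 by auto
  then have p: "H1_coord p1 = H1_coord \<phi>1" "H1_coord p2 = H1_coord \<phi>2"
    using \<phi> coh_class_1 by blast+
  have ht2: "ht 2 = [\<theta>1, \<theta>2]"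
    using ht[of 2] by (auto simp: h map_eq_Cons_conv coh_class_2)
  let ?P = "one_mat - A" and ?Q = "one_mat - B"
  let ?T = "det2 (t1 (\<one>\<^bsub>G\<^esub>, Cell0)) (t2 (\<one>\<^bsub>G\<^esub>, Cell0))"
  let ?S = "det2 (\<delta> s1 (\<one>\<^bsub>G\<^esub>, Cell3)) (\<delta> s2 (\<one>\<^bsub>G\<^esub>, Cell3))"
  let ?H = "det2 (H1_coord \<phi>1) (H1_coord \<phi>2)"
  let ?X = "det2 (\<theta>1 (\<one>\<^bsub>G\<^esub>, Cell2 Rel_r)) (\<theta>2 (\<one>\<^bsub>G\<^esub>, Cell2 Rel_r))"
  have T: "?T \<noteq> 0"
    using b[of 1] basis_coboundaries_1_iff[OF t12] by (simp add: b1[simplified])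
  have S: "?S \<noteq> 0"
    using b[of 3] basis_coboundaries_3_iff[OF s12] by (simp add: b3)
  have detP: "Determinants.det ?P \<noteq> 0"
    using A_nth not_one A22_not_one by (simp add: Determinants.det_2 mat2_one_nth)
  have c0: "basis_change F scale_cochain (b 0 @ ht 0 @ bt (Suc 0)) (tw_basis l m n \<rho> 0) = ?T"
    by (simp add: b0 ht0 bt1 basis_change_one_cell[OF t12] cell_dim_iff)
  have c1: "basis_change F scale_cochain (b 1 @ ht 1 @ bt (Suc 1)) (tw_basis l m n \<rho> 1)
      = Determinants.det ?P * (?T * ?H)"
  proof -
    let ?v = "\<lambda>\<phi>::cochain. inv_one_minus_A *v \<phi> (\<one>\<^bsub>G\<^esub>, Cell1 Gen_g)"
    have split: "(\<phi> (\<one>\<^bsub>G\<^esub>, Cell1 Gen_g), \<phi> (\<one>\<^bsub>G\<^esub>, Cell1 Gen_h))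
        = (?P *v ?v \<phi>, ?Q *v ?v \<phi> + H1_coord \<phi>)" for \<phi>
      by (simp add: inv_one_minus_A H1_coord_def)
    have lift: "(\<delta> t (\<one>\<^bsub>G\<^esub>, Cell1 Gen_g), \<delta> t (\<one>\<^bsub>G\<^esub>, Cell1 Gen_h))
        = (?P *v t (\<one>\<^bsub>G\<^esub>, Cell0), ?Q *v t (\<one>\<^bsub>G\<^esub>, Cell0))" if "t \<in> C 0" for t
      by (simp add: coboundary_0[OF that])
    have "basis_change F scale_cochain [\<delta> t1, \<delta> t2, p1, p2] (tw_basis l m n \<rho> 1)
      = block_det (map (\<lambda>\<phi>. (\<phi> (\<one>\<^bsub>G\<^esub>, Cell1 Gen_g), \<phi> (\<one>\<^bsub>G\<^esub>, Cell1 Gen_h))) [\<delta> t1, \<delta> t2, p1, p2])"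
      using p12 t12 coboundary_0_in_C by (intro basis_change_two_cells) (auto simp: cell_dim_iff)
    also have "\<dots> = Determinants.det ?P * (?T * ?H)"
      unfolding list.map lift[OF t12(1)] lift[OF t12(2)] split[of p1] split[of p2]
      by (simp only: block_det_column_op p)
    finally show ?thesis
      unfolding b1 ht1 bt2 by simp
  qed
  have c2: "Determinants.det ?P * basis_change F scale_cochain (b 2 @ ht 2 @ bt (Suc 2)) (tw_basis l m n \<rho> 2)
      = ?X * ?S"
  proof -
    have "\<theta>1 \<in> C 2" "\<theta>2 \<in> C 2"
      using \<theta> by (simp_all add: cocycles_def)
    then have "basis_change F scale_cochain [\<theta>1, \<theta>2, s1, s2] (tw_basis l m n \<rho> 2)
      = block_det (map (\<lambda>\<phi>. (\<phi> (\<one>\<^bsub>G\<^esub>, Cell2 Rel_r), \<phi> (\<one>\<^bsub>G\<^esub>, Cell2 Rel_s))) [\<theta>1, \<theta>2, s1, s2])"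
      using s12 by (intro basis_change_two_cells) (auto simp: cell_dim_iff)
    moreover have "\<delta> s (\<one>\<^bsub>G\<^esub>, Cell3) = ?Q *v s (\<one>\<^bsub>G\<^esub>, Cell2 Rel_r) + ?P *v s (\<one>\<^bsub>G\<^esub>, Cell2 Rel_s)"
      if "s \<in> C 2" for s
      by (simp add: coboundary_2[OF that])
    ultimately show ?thesis
      using \<theta> s12 unfolding b2 ht2 bt3 cocycles_2 by (simp add: block_det_row_op)
  qed
  have c3: "basis_change F scale_cochain (b 3 @ ht 3 @ bt (Suc 3)) (tw_basis l m n \<rho> 3) = ?S"
    using coboundary_2_in_C s12
    by (simp only: b3 ht3 bt4 append_Nil append_Nil2)
       (simp add: basis_change_one_cell cell_dim_iff)
  have "t = inverse ?T * (Determinants.det ?P * (?T * ?H))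
      * inverse (basis_change F scale_cochain (b 2 @ ht 2 @ bt (Suc 2)) (tw_basis l m n \<rho> 2)) * ?S"
    unfolding t_eq prod_atMost_3 c0 c1 c3 by (simp add: power_int_minus)
  also have "basis_change F scale_cochain (b 2 @ ht 2 @ bt (Suc 2)) (tw_basis l m n \<rho> 2)
      = ?X * ?S / Determinants.det ?P"
    using c2 detP by (simp add: field_simps)
  finally show ?thesis
    using T S detP by (simp add: field_simps power2_eq_square)
qed

text \<open>
  The definite description that defines the torsion requires an admissible choice: unit vectors in degree 0, and
  preimages of the unit vectors of degree 3 under the surjective coboundary from degree 2.
\<close>

lemma torsion_value_exists: "\<exists>t. torsion_value F scale_cochain 3 C \<delta> (tw_basis l m n \<rho>) h t"
proof -
  let ?t = "\<lambda>i. cochain_of 0 (\<lambda>_. axis i 1)"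
  have t: "?t i \<in> C 0" for i
    using plane_closed(7)[OF subfield] by (intro cochain_of_in_C)
  have "det2 (?t 1 (\<one>\<^bsub>G\<^esub>, Cell0)) (?t 2 (\<one>\<^bsub>G\<^esub>, Cell0)) \<noteq> 0"
    by (simp add: det2_def axis_def)
  then have b1: "basis_of F scale_cochain (coboundaries C \<delta> 1) [\<delta> (?t 1), \<delta> (?t 2)]"
    using basis_coboundaries_1_iff[OF t t] by blast
  have "\<exists>s\<in>C 2. \<delta> s = cochain_of 3 (\<lambda>_. axis i 1)" for i
  proof -
    have "cochain_of 3 (\<lambda>_. axis i 1) \<in> coboundaries C \<delta> 3"
      unfolding coboundaries_3 using plane_closed(7)[OF subfield] by (intro cochain_of_in_C)
    then show ?thesis
      by (auto simp: coboundaries_def)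
  qed
  then obtain s where s: "\<And>i. s i \<in> C 2" "\<And>i. \<delta> (s i) = cochain_of 3 (\<lambda>_. axis i 1)"
    by metis
  have "det2 (\<delta> (s 1) (\<one>\<^bsub>G\<^esub>, Cell3)) (\<delta> (s 2) (\<one>\<^bsub>G\<^esub>, Cell3)) \<noteq> 0"
    by (simp add: s(2) det2_def axis_def)
  then have b3: "basis_of F scale_cochain (coboundaries C \<delta> 3) [\<delta> (s 1), \<delta> (s 2)]"
    using basis_coboundaries_3_iff[OF s(1) s(1)] by blast
  define b where "b = (\<lambda>i::nat. if i = 1 then [\<delta> (?t 1), \<delta> (?t 2)] else if i = 3 then [\<delta> (s 1), \<delta> (s 2)] else [])"
  define bt where "bt = (\<lambda>i::nat. if i = 1 then [?t 1, ?t 2] else if i = 3 then [s 1, s 2] else [])"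
  define ht where "ht = (\<lambda>i::nat. if i = 1 then [\<phi>1, \<phi>2] else if i = 2 then [\<theta>1, \<theta>2] else [])"
  have four: "i = 0 \<or> i = 1 \<or> i = 2 \<or> i = 3 \<or> i = Suc 3" if "i \<le> Suc 3" for i
    using that by auto
  have zero: "basis_of F scale_cochain {0} []"
    by (simp add: basis_of_zero_iff[OF subfield])
  have "basis_of F scale_cochain (coboundaries C \<delta> i) (b i)" if "i \<le> Suc 3" for i
    using four[OF that]
  proof (elim disjE)
    assume "i = 0"
    then show ?thesis using zero by (simp add: coboundaries_def b_def)
  next
    assume "i = 1"
    then show ?thesis using b1 by (simp add: b_def)
  next
    assume "i = 2"
    then show ?thesis using zero by (simp add: coboundaries_2 b_def)
  next
    assume "i = 3"
    then show ?thesis using b3 by (simp add: b_def)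
  next
    assume "i = Suc 3"
    then show ?thesis using zero coboundaries_4 by (simp add: b_def)
  qed
  moreover have "set (bt (Suc i)) \<subseteq> C i \<and> map \<delta> (bt (Suc i)) = b (Suc i)" if "i \<le> 3" for i
    using t s(1) by (auto simp: bt_def b_def)
  moreover have "set (ht i) \<subseteq> cocycles C \<delta> i \<and> map (coh_class C \<delta> i) (ht i) = h i" if "i \<le> 3" for i
    using \<phi> \<theta> cocycles_1 by (auto simp: ht_def h)
  ultimately show ?thesis
    unfolding torsion_value_def by blast
qed

lemma refined_torsion_eq:
  "refined_torsion l m n F \<rho> h = (Determinants.det (one_mat - A))\<^sup>2 * det2 (H1_coord \<phi>1) (H1_coord \<phi>2)
    / det2 (\<theta>1 (\<one>\<^bsub>G\<^esub>, Cell2 Rel_r)) (\<theta>2 (\<one>\<^bsub>G\<^esub>, Cell2 Rel_r))"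
  unfolding refined_torsion_def torsion_def
  using torsion_value_exists torsion_value_eq by (metis (no_types, lifting) the_equality)

end

end

section \<open>The class of the torsion modulo norms\<close>

context twisted_coefficients
begin

text \<open>
  Write \<open>p\<close> for the determinant of \<open>1 - A\<close>, and \<open>H\<close>, \<open>X\<close> for the determinants of the coordinates of
  a basis and its dual.  The torsion is \<open>p\<^sup>2 H / X\<close>, duality makes \<open>1 / X\<close> the conjugate of \<open>H\<close>, and \<open>p\<close> is
  real because the eigenvalues of \<open>A\<close> are conjugate.  So the torsion is the norm of \<open>p H\<close>.
\<close>

lemma dual_torsion_is_norm:
  assumes D: "diagonal_approximation l m n D" and \<sigma>: "\<sigma> \<in> {1, -1}"
    and h1: "tw_cohomology_basis l m n F \<rho> 1 h1"
  shows "\<exists>!h2. is_dual_basis l m n F \<rho> D \<sigma> h1 h2"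
    and "is_dual_basis l m n F \<rho> D \<sigma> h1 h2 \<Longrightarrow> \<exists>y\<in>F - {0}.
      refined_torsion l m n F \<rho> (\<lambda>i. if i = 1 then h1 else if i = 2 then h2 else []) = y * cnj y"
proof -
  obtain \<phi>1 \<phi>2 where \<phi>: "\<phi>1 \<in> C 1" "\<phi>2 \<in> C 1"
    and h1_eq: "h1 = [coh_class C \<delta> 1 \<phi>1, coh_class C \<delta> 1 \<phi>2]"
    and ind: "det2 (H1_coord \<phi>1) (H1_coord \<phi>2) \<noteq> 0"
    using h1 unfolding tw_cohomology_basis_def cohomology_basis_iff[OF quotient_H1] cocycles_1 by blast
  note iff = is_dual_basis_iff[OF \<sigma> \<phi> ind D, folded h1_eq]
  show "\<exists>!h2. is_dual_basis l m n F \<rho> D \<sigma> h1 h2"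
    unfolding iff using dual_pair_exists[OF \<sigma> \<phi> ind] dual_pair_unique[OF \<sigma> \<phi> ind] by blast
  assume "is_dual_basis l m n F \<rho> D \<sigma> h1 h2"
  then obtain \<theta>1 \<theta>2 where h2_eq: "h2 = [coh_class C \<delta> 2 \<theta>1, coh_class C \<delta> 2 \<theta>2]"
    and dp: "dual_pair \<sigma> \<phi>1 \<phi>2 \<theta>1 \<theta>2"
    unfolding iff by blast
  then have \<theta>: "\<theta>1 \<in> cocycles C \<delta> 2" "\<theta>2 \<in> cocycles C \<delta> 2"
    by (simp_all add: dual_pair_def)
  let ?P = "Determinants.det (one_mat - A)" and ?H = "det2 (H1_coord \<phi>1) (H1_coord \<phi>2)"
    and ?X = "det2 (\<theta>1 (\<one>\<^bsub>G\<^esub>, Cell2 Rel_r)) (\<theta>2 (\<one>\<^bsub>G\<^esub>, Cell2 Rel_r))"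
  have X: "cnj ?H * ?X = 1"
    by (rule dual_pair_det[OF \<sigma> \<phi> ind dp])
  have "?P = (1 - A $ 1 $ 1) * cnj (1 - A $ 1 $ 1)"
    using A_nth SU2_entries(1)[OF rep_SU2[OF word_class_in_pi1]]
    by (simp add: Determinants.det_2 mat2_one_nth)
  then have P: "cnj ?P = ?P" "?P \<noteq> 0"
    using not_one by (simp_all add: mult.commute)
  have inv: "inverse ?X = cnj ?H"
    by (rule inverse_unique) (subst mult.commute, rule X)
  have "refined_torsion l m n F \<rho> (\<lambda>i. if i = 1 then h1 else if i = 2 then h2 else []) = ?P\<^sup>2 * ?H / ?X"
    by (rule refined_torsion_eq[OF \<phi> \<theta>]) (simp only: h1_eq h2_eq)
  also have "\<dots> = ?P\<^sup>2 * ?H * cnj ?H"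
    by (simp only: divide_inverse inv)
  also have "\<dots> = (?P * ?H) * cnj (?P * ?H)"
    by (simp only: complex_cnj_mult P(1) power2_eq_square mult_ac)
  finally have "refined_torsion l m n F \<rho> (\<lambda>i. if i = 1 then h1 else if i = 2 then h2 else [])
    = (?P * ?H) * cnj (?P * ?H)" .
  moreover have "?P * ?H \<in> F - {0}"
  proof -
    have "H1_coord \<phi>1 \<in> plane F" "H1_coord \<phi>2 \<in> plane F"
      using quotient_H1 \<phi> unfolding linear_quotient_def cocycles_1 by blast+
    then have "?H \<in> F"
      by (auto simp: det2_def mem_plane intro!: subfield_closed[OF subfield])
    moreover have "?P \<in> F"
      using rep_entry[of "word_class l m n [(Gen_g, True)]"]
      by (auto simp: Determinants.det_2 mat2_one_nth intro!: subfield_closed[OF subfield])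
    ultimately show ?thesis
      using ind P(2) by (simp add: subfield_mult[OF subfield])
  qed
  ultimately show "\<exists>y\<in>F - {0}.
      refined_torsion l m n F \<rho> (\<lambda>i. if i = 1 then h1 else if i = 2 then h2 else []) = y * cnj y"
    by blast
qed

end

theorem proposition8p3:
  fixes l m n d :: nat
    and F :: "complex set"
    and \<rho> :: "word set \<Rightarrow> complex ^ 2 ^ 2"
    and A B :: "complex ^ 2 ^ 2"
    and \<alpha> \<beta> \<gamma> :: complex
    and C :: "nat \<Rightarrow> cochain set"
    and \<delta> :: "cochain \<Rightarrow> cochain"
  assumes "l \<ge> m" and "m \<ge> n" and "n \<ge> 2"
    and "d = lcm n (lcm m l)"
    and "F = cyclotomic_field d"
    and "\<rho> \<in> hom (pi1 l m n) SU2"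
    and "\<rho> \<in> hom (pi1 l m n) (SL2 F)"
    and "irreducible_rep (pi1 l m n) \<rho>"
    and "\<rho> (word_class l m n [(Gen_g, True)]) = A"
    and "\<rho> (word_class l m n [(Gen_h, True)]) = B"
    and "A $ 1 $ 1 = \<alpha>" and "A $ 1 $ 2 = 0" and "A $ 2 $ 1 = 0" and "A $ 2 $ 2 = inverse \<alpha>"
    and "\<alpha> \<noteq> 1" and "\<alpha> \<noteq> -1"
    and "eigenvalues B = {\<beta>, inverse \<beta>}"
    and "eigenvalues (A ** B) = {\<gamma>, inverse \<gamma>}"
    and "\<alpha> ^ l = 1" and "\<beta> ^ m = 1" and "\<gamma> ^ n = 1"
    and "C = tw_cochains l m n F \<rho>" and "\<delta> = tw_coboundary l m n"
  shows "cohomology C \<delta> 0 = {coh_class C \<delta> 0 0} \<and>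
    cohomology C \<delta> 3 = {coh_class C \<delta> 3 0} \<and>
    cohomology_iso F scale_cochain C \<delta> 1 (*s) (plane F) \<and>
    cohomology_iso F scale_cochain C \<delta> 2 (*s) (plane F) \<and>
    (\<forall>D \<sigma> h1. diagonal_approximation l m n D \<and> \<sigma> \<in> {1, -1} \<and>
        tw_cohomology_basis l m n F \<rho> 1 h1 \<longrightarrow>
      (\<exists>!h1_dual. is_dual_basis l m n F \<rho> D \<sigma> h1 h1_dual) \<and>
      (\<forall>h1_dual. is_dual_basis l m n F \<rho> D \<sigma> h1 h1_dual \<longrightarrow>
        (let \<tau> = refined_torsion l m n F \<rho> (\<lambda>i. if i = 1 then h1 else if i = 2 then h1_dual else [])
         in \<tau> \<in> carrier (field_units F) \<and>
            norm_group F #>\<^bsub>field_units F\<^esub> \<tau> = \<one>\<^bsub>field_units F Mod norm_group F\<^esub>)))"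
proof -
  have F: "is_subfield F" and cnj: "\<And>x. x \<in> F \<Longrightarrow> cnj x \<in> F"
    using is_subfield_cyclotomic cnj_cyclotomic_field by (simp_all add: \<open>F = cyclotomic_field d\<close>)
  interpret tw: twisted_coefficients l m n F \<rho>
    using assms F cnj by unfold_locales simp_all
  have norm: "\<tau> \<in> carrier (field_units F) \<and>
      norm_group F #>\<^bsub>field_units F\<^esub> \<tau> = \<one>\<^bsub>field_units F Mod norm_group F\<^esub>"
    if "\<exists>y\<in>F - {0}. \<tau> = y * cnj y" for \<tau>
  proof -
    obtain y where y: "y \<in> F" "y \<noteq> 0" and \<tau>: "\<tau> = y * cnj y"
      using \<open>\<exists>y\<in>F - {0}. \<tau> = y * cnj y\<close> by blast
    have "\<tau> \<in> carrier (field_units F)"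
      using y cnj subfield_mult[OF F] by (simp add: \<tau> field_units_def)
    then show ?thesis
      using norm_group_coset[OF F y] by (simp add: \<tau>)
  qed
  show ?thesis
    unfolding \<open>C = _\<close> \<open>\<delta> = _\<close> Let_def
  proof (intro conjI[OF tw.cohomology_0] conjI[OF tw.cohomology_3]
      conjI[OF linear_quotient_cohomology_iso[OF tw.quotient_H1]]
      conjI[OF linear_quotient_cohomology_iso[OF tw.quotient_H2]] allI impI)
    fix D h1 and \<sigma> :: int
    assume "diagonal_approximation l m n D \<and> \<sigma> \<in> {1, -1} \<and> tw_cohomology_basis l m n F \<rho> 1 h1"
    then have dual: "diagonal_approximation l m n D" "\<sigma> \<in> {1, -1}" "tw_cohomology_basis l m n F \<rho> 1 h1"
      by blast+
    show "(\<exists>!h1_dual. is_dual_basis l m n F \<rho> D \<sigma> h1 h1_dual) \<and>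
      (\<forall>h1_dual. is_dual_basis l m n F \<rho> D \<sigma> h1 h1_dual \<longrightarrow>
        refined_torsion l m n F \<rho> (\<lambda>i. if i = 1 then h1 else if i = 2 then h1_dual else [])
          \<in> carrier (field_units F) \<and>
        norm_group F #>\<^bsub>field_units F\<^esub>
          refined_torsion l m n F \<rho> (\<lambda>i. if i = 1 then h1 else if i = 2 then h1_dual else [])
          = \<one>\<^bsub>field_units F Mod norm_group F\<^esub>)"
      by (intro conjI[OF tw.dual_torsion_is_norm(1)[OF dual]] allI impI norm
          tw.dual_torsion_is_norm(2)[OF dual])
  qed
qed

end
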